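(* Fix integers $k\ge 1$ and $N_0\ge 1$. For $N\ge N_0$ let $A_1(N),\dots,A_k(N)$ be $N\times N$ random matrices forming either an ensemble of type (U) or an ensemble of type (G), as defined in the context. Then for every non-commutative polynomial $p$ in the indeterminates $a_1,\dots,a_k$ and $(e_{ij}:1\le i,j\le N_0)$ the following limits exist: $$\tau(p)=\lim_{N\to\infty}\frac1N\,\mathbb{E}\,Tr\big(p(A_1(N),\dots,A_k(N),\{E_{ij}\}_{i,j=1}^{N_0})\big),$$ $$\tau'(p)=\lim_{N\to\infty}\Big(\mathbb{E}\,Tr\big(p(A_1(N),\dots,A_k(N),\{E_{ij}\}_{i,j=1}^{N_0})\big)-N\tau(p)\Big).$$ Furthermore, the families $(a_1,\dots,a_k)$ and $(e_{ij}:1\le i,j\le N_0)$ are infinitesimally free with respect to $(\tau,\tau')$.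
   Context: $Tr$ is the non-normalized trace on $N\times N$ matrices. $E_{ij}$ is the $N\times N$ matrix whose only nonzero entry is a $1$ in position $(i,j)$. Polynomials are non-commutative with complex coefficients and may have a constant term (evaluated as a multiple of the identity matrix). Ensemble (U) (unitarily invariant): $A_j(N)=U\Lambda_j(N)U^*$, $j=1,\dots,k$, where $\Lambda_1(N),\dots,\Lambda_k(N)$ are deterministic self-adjoint $N\times N$ matrices and $U$ is a Haar-distributed random $N\times N$ unitary matrix (the same $U$ for all $j$); for every non-commutative polynomial $q$, $N^{-1}\mathbb{E}\,Tr(q(A_1(N),\dots,A_k(N)))$ converges as $N\to\infty$, to a limit denoted $\tau(q)$; and $\sup_{j,N}\|A_j(N)\|_\infty<\infty$ (operator norm). Ensemble (G) (Gaussian): $A_1(N),\dots,A_k(N)$ are self-adjoint $N\times N$ random matrices whose entries $[A_r(N)]_{i,j}$, $1\le r\le k$, $1\le i\le j\le N$, are independent centered Gaussian random variables of variance $(1+\delta_{ij})N^{-1}$; the off-diagonal entries are real Gaussian or complex Gaussian (in the complex case variance means $\mathbb{E}|\cdot|^2$, with $\mathbb{E}(\cdot)^2=0$), and the diagonal entries are real Gaussian. An infinitesimal non-commutative probability space is a unital $*$-algebra $A$ with two linear functionals $\phi,\phi':A\to\mathbb{C}$ satisfying $\phi(1)=1$, $\phi'(1)=0$. Unital subalgebras $A_1,A_2\subset A$ are infinitesimally free with respect to $(\phi,\phi')$ if, whenever $a_m\in A_{i_m}$ ($m=1,\dots,r$, $i_m\in\{1,2\}$) with $i_1\ne i_2$,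 $i_2\ne i_3,\dots,i_{r-1}\neq i_r$ and $\phi(a_1)=\dots=\phi(a_r)=0$, one has $$\phi(a_1\cdots a_r)=0,\qquad \phi'(a_1\cdots a_r)=\sum_{j=1}^r\phi'(a_j)\,\phi(a_1\cdots a_{j-1}a_{j+1}\cdots a_r).$$ Families of elements are infinitesimally free if the unital subalgebras they generate are. Here $A$ is the algebra of non-commutative polynomials in $a_1,\dots,a_k,(e_{ij})_{1\le i,j\le N_0}$, with $a_j^*=a_j$, $e_{ij}^*=e_{ji}$, and $\phi=\tau$, $\phi'=\tau'$.
   Formalization: For type (U), existence of τ' and infinitesimal freeness are proved assuming E Tr(q) − Nτ(q) converges for every polynomial q in a_1,…,a_k alone; without it the claim fails, e.g. k=1, Λ_1(N)=(1+N^{-1/2})Id. *)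

theory Defs
  imports
    "HOL-Probability.Probability"
    "HOL-Library.Poly_Mapping"
    "Jordan_Normal_Form.Schur_Decomposition"
begin

section \<open>Non-commutative polynomials\<close>

text \<open>
  Words are wrapped in a datatype, written additively, so that the convolution product of
  \<^theory>\<open>HOL-Library.Poly_Mapping\<close> on finitely supported functions from words to \<open>complex\<close>
  is the product of the free algebra. It is not commutative.
\<close>

datatype 'x ncword = NCWord (letters: "'x list")

instantiation ncword :: (type) monoid_add
begin

definition zero_ncword :: "'a ncword" where
  "0 = NCWord []"

definition plus_ncword :: "'a ncword \<Rightarrow> 'a ncword \<Rightarrow> 'a ncword" where
  "v + w = NCWord (letters v @ letters w)"

instance
  by standard (simp_all add: zero_ncword_def plus_ncword_def)

end

type_synonym 'x ncpoly = "'x ncword \<Rightarrow>\<^sub>0 complex"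

definition nc_var :: "'x \<Rightarrow> 'x ncpoly" where
  "nc_var x = Poly_Mapping.single (NCWord [x]) 1"

definition nc_scale :: "complex \<Rightarrow> 'x ncpoly \<Rightarrow> 'x ncpoly" where
  "nc_scale c p = Poly_Mapping.map ((*) c) p"

definition ncpolys :: "'x set \<Rightarrow> 'x ncpoly set" where
  "ncpolys S = {p. \<forall>w\<in>Poly_Mapping.keys p. set (letters w) \<subseteq> S}"

text \<open>The conjugate-linear anti-automorphism extending the involution \<open>s\<close> of the indeterminates.\<close>

definition nc_star :: "('x \<Rightarrow> 'x) \<Rightarrow> 'x ncpoly \<Rightarrow> 'x ncpoly" where
  "nc_star s p = (\<Sum>w\<in>Poly_Mapping.keys p.
     Poly_Mapping.single (NCWord (rev (map s (letters w)))) (cnj (Poly_Mapping.lookup p w)))"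

text \<open>The empty word evaluates to the identity, so constant terms become multiples of it.\<close>

definition nc_eval :: "nat \<Rightarrow> ('x \<Rightarrow> complex mat) \<Rightarrow> 'x ncpoly \<Rightarrow> complex mat" where
  "nc_eval N f p = mat N N (\<lambda>(i, j). \<Sum>w\<in>Poly_Mapping.keys p.
     Poly_Mapping.lookup p w * foldr (\<lambda>x B. f x * B) (letters w) (1\<^sub>m N) $$ (i, j))"


section \<open>Infinitesimal freeness\<close>

definition unital_subalgebra :: "(complex \<Rightarrow> 'a \<Rightarrow> 'a::ring_1) \<Rightarrow> 'a set \<Rightarrow> bool" where
  "unital_subalgebra smul B \<longleftrightarrow>
     1 \<in> B \<and> (\<forall>x\<in>B. \<forall>y\<in>B. x + y \<in> B \<and> x * y \<in> B) \<and> (\<forall>c. \<forall>x\<in>B. smul c x \<in> B)"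

text \<open>
  The algebra is a unital subalgebra \<open>\<A>\<close> of an ambient type, so that the set of indeterminates
  may depend on natural numbers.
\<close>

locale infinitesimal_ncps = vector_space smul
  for smul :: "complex \<Rightarrow> 'a \<Rightarrow> 'a::ring_1" +
  fixes \<A> :: "'a set" and star :: "'a \<Rightarrow> 'a" and \<phi> \<phi>' :: "'a \<Rightarrow> complex"
  assumes scale_mult_left: "smul c x * y = smul c (x * y)"
    and scale_mult_right: "x * smul c y = smul c (x * y)"
    and unital_subalgebra: "unital_subalgebra smul \<A>"
    and star_closed: "x \<in> \<A> \<Longrightarrow> star x \<in> \<A>"
    and star_star: "x \<in> \<A> \<Longrightarrow> star (star x) = x"
    and star_add: "x \<in> \<A> \<Longrightarrow> y \<in> \<A> \<Longrightarrow> star (x + y) = star x + star y"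
    and star_mult: "x \<in> \<A> \<Longrightarrow> y \<in> \<A> \<Longrightarrow> star (x * y) = star y * star x"
    and star_scale: "x \<in> \<A> \<Longrightarrow> star (smul c x) = smul (cnj c) (star x)"
    and phi_add: "x \<in> \<A> \<Longrightarrow> y \<in> \<A> \<Longrightarrow> \<phi> (x + y) = \<phi> x + \<phi> y"
    and phi_scale: "x \<in> \<A> \<Longrightarrow> \<phi> (smul c x) = c * \<phi> x"
    and phi'_add: "x \<in> \<A> \<Longrightarrow> y \<in> \<A> \<Longrightarrow> \<phi>' (x + y) = \<phi>' x + \<phi>' y"
    and phi'_scale: "x \<in> \<A> \<Longrightarrow> \<phi>' (smul c x) = c * \<phi>' x"
    and phi_one: "\<phi> 1 = 1"
    and phi'_one: "\<phi>' 1 = 0"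

definition inf_free_subalgebras ::
    "('a::ring_1 \<Rightarrow> complex) \<Rightarrow> ('a \<Rightarrow> complex) \<Rightarrow> 'a set \<Rightarrow> 'a set \<Rightarrow> bool" where
  "inf_free_subalgebras \<phi> \<phi>' B1 B2 \<longleftrightarrow>
     (\<forall>(xs :: 'a list) (ind :: nat \<Rightarrow> nat).
        xs \<noteq> [] \<and>
        (\<forall>m<length xs. ind m \<in> {1, 2} \<and> xs ! m \<in> (if ind m = 1 then B1 else B2)) \<and>
        (\<forall>m. Suc m < length xs \<longrightarrow> ind m \<noteq> ind (Suc m)) \<and>
        (\<forall>m<length xs. \<phi> (xs ! m) = 0)
        \<longrightarrow>
        \<phi> (prod_list xs) = 0 \<and>
        \<phi>' (prod_list xs) =
          (\<Sum>j<length xs. \<phi>' (xs ! j) * \<phi> (prod_list (take j xs @ drop (Suc j) xs))))"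

definition infinitesimally_free ::
    "(complex \<Rightarrow> 'a \<Rightarrow> 'a::ring_1) \<Rightarrow> ('a \<Rightarrow> complex) \<Rightarrow> ('a \<Rightarrow> complex) \<Rightarrow>
     'a set \<Rightarrow> 'a set \<Rightarrow> bool" where
  "infinitesimally_free smul \<phi> \<phi>' S T \<longleftrightarrow>
     inf_free_subalgebras \<phi> \<phi>' (unital_subalgebra smul hull S) (unital_subalgebra smul hull T)"


section \<open>Random matrix ensembles\<close>

definition mat_tr :: "complex mat \<Rightarrow> complex" where
  "mat_tr X = (\<Sum>i<dim_row X. X $$ (i, i))"

definition self_adjoint_mats :: "nat \<Rightarrow> complex mat set" where
  "self_adjoint_mats N = {X \<in> carrier_mat N N. mat_adjoint X = X}"

definition unitary_group :: "nat \<Rightarrow> complex mat set" where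
  "unitary_group N =
     {V \<in> carrier_mat N N. V * mat_adjoint V = 1\<^sub>m N \<and> mat_adjoint V * V = 1\<^sub>m N}"

definition l2_norm_vec :: "complex Matrix.vec \<Rightarrow> real" where
  "l2_norm_vec v = sqrt (\<Sum>i<dim_vec v. (cmod (vec_index v i))\<^sup>2)"

definition mat_op_norm :: "complex mat \<Rightarrow> real" where
  "mat_op_norm X = (SUP v\<in>{v \<in> carrier_vec (dim_col X). l2_norm_vec v \<le> 1}. l2_norm_vec (X *\<^sub>v v))"

text \<open>The Borel \<open>\<sigma>\<close>-algebra of the \<open>N \<times> N\<close> matrices, identified with \<open>\<complex>\<close> to the power \<open>N\<^sup>2\<close>.\<close>

definition borel_mat :: "nat \<Rightarrow> complex mat measure" where
  "borel_mat N = vimage_algebra (carrier_mat N N)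
     (\<lambda>X. \<lambda>ij\<in>{..<N} \<times> {..<N}. X $$ ij) (Pi\<^sub>M ({..<N} \<times> {..<N}) (\<lambda>_. borel))"

text \<open>
  Left invariance characterises the Haar probability measure of the unitary group; as the group
  is compact, right invariance is then automatic.
\<close>

definition haar_unitary :: "'w measure \<Rightarrow> nat \<Rightarrow> ('w \<Rightarrow> complex mat) \<Rightarrow> bool" where
  "haar_unitary M N U \<longleftrightarrow>
     U \<in> M \<rightarrow>\<^sub>M borel_mat N \<and>
     (\<forall>\<omega>\<in>space M. U \<omega> \<in> unitary_group N) \<and>
     (\<forall>V\<in>unitary_group N. distr M (borel_mat N) (\<lambda>\<omega>. V * U \<omega>) = distr M (borel_mat N) U)"

text \<open>
  Matrices and indeterminates are indexed from \<open>0\<close>: \<open>a\<^sub>1, \<dots>, a\<^sub>k\<close> are \<open>Ind_a 0, \<dots>, Ind_a (k - 1)\<close>,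
  and \<open>e\<^bsub>ij\<^esub>\<close> with \<open>1 \<le> i, j \<le> N\<^sub>0\<close> is \<open>Ind_e (i - 1) (j - 1)\<close>.
\<close>

datatype indet = Ind_a nat | Ind_e nat nat

definition a_indets :: "nat \<Rightarrow> indet set" where
  "a_indets k = Ind_a ` {..<k}"

definition e_indets :: "nat \<Rightarrow> indet set" where
  "e_indets N0 = (\<lambda>(i, j). Ind_e i j) ` ({..<N0} \<times> {..<N0})"

fun indet_star :: "indet \<Rightarrow> indet" where
  "indet_star (Ind_a j) = Ind_a j"
| "indet_star (Ind_e i j) = Ind_e j i"

definition matrix_unit :: "nat \<Rightarrow> nat \<Rightarrow> nat \<Rightarrow> complex mat" where
  "matrix_unit N i j = mat N N (\<lambda>ij. if ij = (i, j) then 1 else 0)"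

fun assign :: "nat \<Rightarrow> (nat \<Rightarrow> complex mat) \<Rightarrow> indet \<Rightarrow> complex mat" where
  "assign N X (Ind_a j) = X j"
| "assign N X (Ind_e i j) = matrix_unit N i j"

text \<open>
  In a sequence of ensembles, \<open>A N j\<close> is the \<open>j\<close>-th random matrix of size \<open>N\<close>, defined on the
  probability space \<open>M N\<close>; only \<open>N \<ge> N0\<close> matters.
\<close>

definition expected_trace ::
    "(nat \<Rightarrow> 'w measure) \<Rightarrow> (nat \<Rightarrow> nat \<Rightarrow> 'w \<Rightarrow> complex mat) \<Rightarrow> nat \<Rightarrow> indet ncpoly \<Rightarrow> complex" where
  "expected_trace M A N p = (\<integral>\<omega>. mat_tr (nc_eval N (assign N (\<lambda>j. A N j \<omega>)) p) \<partial>M N)"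

definition ensemble_U ::
    "nat \<Rightarrow> nat \<Rightarrow> (nat \<Rightarrow> 'w measure) \<Rightarrow> (nat \<Rightarrow> nat \<Rightarrow> 'w \<Rightarrow> complex mat) \<Rightarrow> bool" where
  "ensemble_U k N0 M A \<longleftrightarrow>
     (\<forall>N\<ge>N0. prob_space (M N)) \<and>
     (\<exists>U \<Lambda>. \<forall>N\<ge>N0.
        haar_unitary (M N) N (U N) \<and>
        (\<forall>j<k. \<Lambda> N j \<in> self_adjoint_mats N \<and>
           (\<forall>\<omega>\<in>space (M N). A N j \<omega> = U N \<omega> * \<Lambda> N j * mat_adjoint (U N \<omega>)))) \<and>
     (\<forall>q\<in>ncpolys (a_indets k). convergent (\<lambda>N. expected_trace M A N q / of_nat N)) \<and>
     (\<exists>C. \<forall>N\<ge>N0. \<forall>j<k. \<forall>\<omega>\<in>space (M N). mat_op_norm (A N j \<omega>) \<le> C)"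

definition real_gaussian :: "'w measure \<Rightarrow> real \<Rightarrow> ('w \<Rightarrow> complex) \<Rightarrow> bool" where
  "real_gaussian M v X \<longleftrightarrow>
     (\<forall>\<omega>\<in>space M. X \<omega> \<in> \<real>) \<and>
     distributed M lborel (\<lambda>\<omega>. Re (X \<omega>)) (normal_density 0 (sqrt v))"

text \<open>Here \<open>v\<close> is the expectation of \<open>\<bar>X\<bar>\<^sup>2\<close>, and the expectation of \<open>X\<^sup>2\<close> is \<open>0\<close>.\<close>

definition complex_gaussian :: "'w measure \<Rightarrow> real \<Rightarrow> ('w \<Rightarrow> complex) \<Rightarrow> bool" where
  "complex_gaussian M v X \<longleftrightarrow>
     prob_space.indep_var M borel (\<lambda>\<omega>. Re (X \<omega>)) borel (\<lambda>\<omega>. Im (X \<omega>)) \<and>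
     distributed M lborel (\<lambda>\<omega>. Re (X \<omega>)) (normal_density 0 (sqrt (v / 2))) \<and>
     distributed M lborel (\<lambda>\<omega>. Im (X \<omega>)) (normal_density 0 (sqrt (v / 2)))"

definition gaussian_ensemble ::
    "('w measure \<Rightarrow> real \<Rightarrow> ('w \<Rightarrow> complex) \<Rightarrow> bool) \<Rightarrow>
     nat \<Rightarrow> nat \<Rightarrow> (nat \<Rightarrow> 'w measure) \<Rightarrow> (nat \<Rightarrow> nat \<Rightarrow> 'w \<Rightarrow> complex mat) \<Rightarrow> bool" where
  "gaussian_ensemble off_diag k N0 M A \<longleftrightarrow>
     (\<forall>N\<ge>N0.
        prob_space (M N) \<and>
        (\<forall>r<k. \<forall>\<omega>\<in>space (M N). A N r \<omega> \<in> self_adjoint_mats N) \<and>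
        prob_space.indep_vars (M N) (\<lambda>_. borel) (\<lambda>(r, i, j) \<omega>. A N r \<omega> $$ (i, j))
          {(r, i, j). r < k \<and> i \<le> j \<and> j < N} \<and>
        (\<forall>r<k. \<forall>i<N. real_gaussian (M N) (2 / real N) (\<lambda>\<omega>. A N r \<omega> $$ (i, i))) \<and>
        (\<forall>r<k. \<forall>j<N. \<forall>i<j. off_diag (M N) (1 / real N) (\<lambda>\<omega>. A N r \<omega> $$ (i, j))))"

text \<open>The choice between real and complex off-diagonal entries is made once, for all sizes.\<close>

definition ensemble_G ::
    "nat \<Rightarrow> nat \<Rightarrow> (nat \<Rightarrow> 'w measure) \<Rightarrow> (nat \<Rightarrow> nat \<Rightarrow> 'w \<Rightarrow> complex mat) \<Rightarrow> bool" where
  "ensemble_G k N0 M A \<longleftrightarrow>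
     gaussian_ensemble real_gaussian k N0 M A \<or> gaussian_ensemble complex_gaussian k N0 M A"

end

theory Submission
  imports Defs "HOL-Real_Asymp.Real_Asymp"
begin

text \<open>
  Since \<open>E\<^bsub>ij\<^esub>\<close> is a matrix unit, the trace of a word that contains matrix units is, by cyclicity,
  a product of entries of words in the \<open>A\<^sub>r\<close>. Everything follows once the expectation of a product of
  entries \<open>[q]\<^bsub>ij\<^esub>\<close> is known to converge to the product of the numbers \<open>\<delta>\<^bsub>ij\<^esub> \<tau>(q)\<close>: then \<open>\<tau>\<close> vanishes
  on words with matrix units, \<open>\<tau>'\<close> multiplies a factor \<open>\<tau>(q)\<close> for each word \<open>q\<close> between two of
  them, and the two sides of the formula for \<open>\<tau>'\<close> are compared according to whether an alternating
  product of centred elements has zero, one, or several factors from the algebra of the \<open>e\<^bsub>ij\<^esub>\<close>.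

  In the unitary ensemble the law of \<open>Y = U B U\<^sup>*\<close> is invariant under conjugation. Transpositions of
  coordinates make all off-diagonal entries of a column equally large, hence small in mean square, and a
  rotation by 45 degrees in a coordinate plane turns the difference of two diagonal entries into
  off-diagonal entries, so that every diagonal entry is close to the normalised trace.

  In the Gaussian ensemble Wick's formula, applied to the first letter of a word, expresses expectations
  of products of entries by such expectations with two letters less, uniformly in the indices; all
  pairings but the planar ones are lost in the limit. The same recursion shows that the expected trace of
  a word is a Laurent polynomial in \<open>N\<close>; being of order \<open>N\<close>, it differs from its leading term by a
  convergent sequence.
\<close>

section \<open>Wick's formula\<close>

text \<open>The trace sums N diagonal entries, so knowing every entry up to o(1) gives the expected
  trace only up to o(N). This suffices for \<open>\<tau>\<close>, and also for
  \<open>\<tau>'\<close> on words with a matrix unit, where a single product of finitely many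
  entries remains. It does not suffice for \<open>\<tau>'\<close> on words in the \<open>a_r\<close>
  alone. In ensemble (G) the Laurent expansion closes this gap: pairings of the twisted orientation,
  present in the real case and on the diagonal, do contribute to the expected trace at order 1. In
  ensemble (U) nothing closes it. There the trace of q(A_1, ..., A_k) is the deterministic trace of
  q(Lambda_1, ..., Lambda_k), and convergence after division by N does not control the next order:
  if Lambda_1 is N^(-1/2) times the identity, then \<open>\<tau>\<close> vanishes at a_1 while the
  trace is sqrt N. Convergence of the correction on polynomials in the \<open>a_r\<close> therefore
  enters as a premise in ensemble (U). Its values do not affect the freeness relation, because
  \<open>\<tau>'\<close> at a word with a matrix unit is expressed through \<open>\<tau>\<close>
  alone.\<close>

definition remove_nth :: "nat \<Rightarrow> 'b list \<Rightarrow> 'b list" where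
  "remove_nth m L = take m L @ drop (Suc m) L"

lemma remove_nth_0 [simp]: "remove_nth 0 (x # L) = L"
  by (simp add: remove_nth_def)

lemma remove_nth_Suc [simp]: "remove_nth (Suc m) (x # L) = x # remove_nth m L"
  by (simp add: remove_nth_def)

lemma set_remove_nth: "set (remove_nth m L) \<subseteq> set L"
  by (auto simp: remove_nth_def dest: in_set_takeD in_set_dropD)

lemma length_remove_nth: "m < length L \<Longrightarrow> length (remove_nth m L) = length L - 1"
  by (simp add: remove_nth_def)

lemma sum_nth_Cons:
  fixes g :: "nat \<Rightarrow> 'c::comm_monoid_add"
  shows "(\<Sum>m<length (x # L). g m) = g 0 + (\<Sum>m<length L. g (Suc m))"
  by (simp add: sum.lessThan_Suc_shift del: sum.lessThan_Suc)

text \<open>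
  The relation between the expectations of products that holds for centred jointly Gaussian
  variables with \<open>c p q\<close> the expectation of the product of the variables labelled \<open>p\<close> and \<open>q\<close>.
\<close>

definition wick :: "'w measure \<Rightarrow> ('p \<Rightarrow> 'w \<Rightarrow> complex) \<Rightarrow> 'p set \<Rightarrow> ('p \<Rightarrow> 'p \<Rightarrow> complex) \<Rightarrow> bool" where
  "wick M X P c \<longleftrightarrow>
     (\<forall>L. set L \<subseteq> P \<longrightarrow> integrable M (\<lambda>\<omega>. \<Prod>q\<leftarrow>L. X q \<omega>)) \<and>
     (\<forall>p\<in>P. \<forall>L. set L \<subseteq> P \<longrightarrow>
        (\<integral>\<omega>. X p \<omega> * (\<Prod>q\<leftarrow>L. X q \<omega>) \<partial>M) =
        (\<Sum>m<length L. c p (L ! m) * (\<integral>\<omega>. (\<Prod>q\<leftarrow>remove_nth m L. X q \<omega>) \<partial>M)))"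

section \<open>Moments of a single real Gaussian variable\<close>

text \<open>By the closed formula with factorials, consecutive even moments have ratio (2k + 1)
  \<sigma>^2, and odd moments vanish. At \<open>n = 0\<close> the truncated exponent
  \<open>n - 1\<close> does no harm, since the factor \<open>real n\<close> is 0.\<close>

lemma normal_moment_rec:
  fixes \<sigma> :: real
  assumes "\<sigma> > 0"
  shows "(\<integral>x. normal_density 0 \<sigma> x * x ^ Suc n \<partial>lborel) =
    real n * \<sigma>\<^sup>2 * (\<integral>x. normal_density 0 \<sigma> x * x ^ (n - 1) \<partial>lborel)"
proof (cases "even n")
  case True
  then obtain k where k: "n = 2 * k" by blast
  have 1: "(\<integral>x. normal_density 0 \<sigma> x * x ^ Suc n \<partial>lborel) = 0"
    using integral_normal_moment_odd[OF assms, of 0 k] by (simp add: k)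
  show ?thesis
  proof (cases k)
    case 0
    with 1 k show ?thesis by simp
  next
    case (Suc l)
    have "(\<integral>x. normal_density 0 \<sigma> x * x ^ (n - 1) \<partial>lborel) = 0"
      using integral_normal_moment_odd[OF assms, of 0 l] by (simp add: k Suc)
    with 1 show ?thesis by simp
  qed
next
  case False
  then obtain k where k: "n = Suc (2 * k)" by (metis oddE Suc_eq_plus1)
  have e: "(\<integral>x. normal_density 0 \<sigma> x * x ^ (2 * j) \<partial>lborel) = fact (2 * j) / ((2 / \<sigma>\<^sup>2) ^ j * fact j)" for j
    using integral_normal_moment_even[OF assms, of 0 j] by simp
  have "(\<integral>x. normal_density 0 \<sigma> x * x ^ Suc n \<partial>lborel) =
      fact (2 * Suc k) / ((2 / \<sigma>\<^sup>2) ^ Suc k * fact (Suc k))"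
    using e[of "Suc k"] by (simp add: k)
  also have "\<dots> = (2 * real k + 2) * (2 * real k + 1) * fact (2 * k) /
      ((2 / \<sigma>\<^sup>2) * (2 / \<sigma>\<^sup>2) ^ k * ((real k + 1) * fact k))"
    by (simp add: algebra_simps)
  also have "\<dots> = real n * \<sigma>\<^sup>2 * (fact (2 * k) / ((2 / \<sigma>\<^sup>2) ^ k * fact k))"
  proof -
    have "(2 * a + 2) * (2 * a + 1) * F / ((2 / s) * S * ((a + 1) * G)) = (2 * a + 1) * s * (F / (S * G))"
      if "s > 0" "a \<ge> 0" for a F s S G :: real
      using that by (simp add: divide_simps)
    from this[of "\<sigma>\<^sup>2" "real k" "fact (2 * k)" "(2 / \<sigma>\<^sup>2) ^ k" "fact k"] assms show ?thesis
      by (simp add: k add_ac)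
  qed
  finally show ?thesis using e[of k] by (simp add: k)
qed

lemma real_gaussian_moments:
  assumes "prob_space M" "v > 0" and Z: "real_gaussian M v Z"
  shows "integrable M (\<lambda>\<omega>. Z \<omega> ^ n)"
    and "(\<integral>\<omega>. Z \<omega> ^ Suc n \<partial>M) = of_nat n * of_real v * (\<integral>\<omega>. Z \<omega> ^ (n - 1) \<partial>M)"
proof -
  interpret prob_space M by fact
  have D: "distributed M lborel (\<lambda>\<omega>. Re (Z \<omega>)) (normal_density 0 (sqrt v))"
    using Z by (simp add: real_gaussian_def)
  have s: "sqrt v > 0" using \<open>v > 0\<close> by simp
  have Zr: "Z \<omega> ^ n = complex_of_real (Re (Z \<omega>) ^ n)" if "\<omega> \<in> space M" for \<omega> n
    using Z that by (simp add: real_gaussian_def)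
  have i: "integrable M (\<lambda>\<omega>. Re (Z \<omega>) ^ n)" for n
    using distributed_integrable[OF D, of "\<lambda>x. x ^ n"] integrable_normal_moment[OF s, of 0 n] by simp
  have E: "(\<integral>\<omega>. Z \<omega> ^ n \<partial>M) = of_real (\<integral>x. normal_density 0 (sqrt v) x * x ^ n \<partial>lborel)" for n
  proof -
    have "(\<integral>\<omega>. Z \<omega> ^ n \<partial>M) = (\<integral>\<omega>. complex_of_real (Re (Z \<omega>) ^ n) \<partial>M)"
      by (rule Bochner_Integration.integral_cong) (auto simp: Zr)
    also have "\<dots> = of_real (\<integral>\<omega>. Re (Z \<omega>) ^ n \<partial>M)" by (simp del: of_real_power)
    finally show ?thesis using distributed_integral[OF D, of "\<lambda>x. x ^ n"] by simp
  qed
  have "integrable M (\<lambda>\<omega>. complex_of_real (Re (Z \<omega>) ^ n))" using i by (simp del: of_real_power)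
  then show "integrable M (\<lambda>\<omega>. Z \<omega> ^ n)"
    by (subst Bochner_Integration.integrable_cong[OF refl Zr])
  show "(\<integral>\<omega>. Z \<omega> ^ Suc n \<partial>M) = of_nat n * of_real v * (\<integral>\<omega>. Z \<omega> ^ (n - 1) \<partial>M)"
    unfolding E normal_moment_rec[OF s] using \<open>v > 0\<close> by simp
qed

lemma prod_list_map_const: "(\<Prod>q\<leftarrow>L. z) = (z::'c::comm_monoid_mult) ^ length L"
  by (induction L) simp_all

text \<open>All labels stand for the same variable \<open>Z\<close>, so the product over
  \<open>L\<close> is a power of \<open>Z\<close> and the sum over \<open>m\<close> has
  \<open>length L\<close> equal terms. What remains is the recursion for the moments of one
  variable.\<close>

lemma wick_real_gaussian:
  assumes "prob_space M" "v > 0" "real_gaussian M v Z"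
  shows "wick M (\<lambda>p. Z) P (\<lambda>p q. of_real v)"
  using real_gaussian_moments[OF assms]
  by (simp add: wick_def prod_list_map_const length_remove_nth flip: power_Suc)

lemma wick_cong:
  assumes w: "wick M X P c"
    and X: "\<And>p \<omega>. p \<in> P \<Longrightarrow> \<omega> \<in> space M \<Longrightarrow> X' p \<omega> = X p \<omega>"
    and c: "\<And>p q. p \<in> P \<Longrightarrow> q \<in> P \<Longrightarrow> c' p q = c p q"
  shows "wick M X' P c'"
proof -
  have e: "(\<Prod>q\<leftarrow>L. X' q \<omega>) = (\<Prod>q\<leftarrow>L. X q \<omega>)" if "set L \<subseteq> P" "\<omega> \<in> space M" for L \<omega>
    using that by (intro arg_cong[where f=prod_list] map_cong) (auto simp: X)
  show ?thesis unfolding wick_def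
  proof (intro conjI ballI allI impI)
    fix L assume L: "set L \<subseteq> P"
    have "integrable M (\<lambda>\<omega>. \<Prod>q\<leftarrow>L. X q \<omega>)" using w L by (simp add: wick_def)
    then show "integrable M (\<lambda>\<omega>. \<Prod>q\<leftarrow>L. X' q \<omega>)"
      by (subst Bochner_Integration.integrable_cong[OF refl e[OF L]])
    fix p assume p: "p \<in> P"
    have "(\<integral>\<omega>. X' p \<omega> * (\<Prod>q\<leftarrow>L. X' q \<omega>) \<partial>M) = (\<integral>\<omega>. X p \<omega> * (\<Prod>q\<leftarrow>L. X q \<omega>) \<partial>M)"
      by (rule Bochner_Integration.integral_cong) (auto simp: X p e L)
    also have "\<dots> = (\<Sum>m<length L. c p (L ! m) * (\<integral>\<omega>. (\<Prod>q\<leftarrow>remove_nth m L. X q \<omega>) \<partial>M))"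
      using w L p by (simp add: wick_def)
    also have "\<dots> = (\<Sum>m<length L. c' p (L ! m) * (\<integral>\<omega>. (\<Prod>q\<leftarrow>remove_nth m L. X' q \<omega>) \<partial>M))"
    proof (rule sum.cong[OF refl])
      fix m assume "m \<in> {..<length L}"
      with L have "L ! m \<in> P" by auto
      moreover have "(\<integral>\<omega>. (\<Prod>q\<leftarrow>remove_nth m L. X q \<omega>) \<partial>M) = (\<integral>\<omega>. (\<Prod>q\<leftarrow>remove_nth m L. X' q \<omega>) \<partial>M)"
        using L set_remove_nth[of m L] by (intro Bochner_Integration.integral_cong) (auto simp: e)
      ultimately show "c p (L ! m) * (\<integral>\<omega>. (\<Prod>q\<leftarrow>remove_nth m L. X q \<omega>) \<partial>M) =
        c' p (L ! m) * (\<integral>\<omega>. (\<Prod>q\<leftarrow>remove_nth m L. X' q \<omega>) \<partial>M)"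
        by (simp add: c p)
    qed
    finally show "(\<integral>\<omega>. X' p \<omega> * (\<Prod>q\<leftarrow>L. X' q \<omega>) \<partial>M) =
       (\<Sum>m<length L. c' p (L ! m) * (\<integral>\<omega>. (\<Prod>q\<leftarrow>remove_nth m L. X' q \<omega>) \<partial>M))" .
  qed
qed

section \<open>Wick's relation for independent blocks of variables\<close>

lemma prod_list_filter_split:
  fixes f :: "'p \<Rightarrow> 'c::comm_monoid_mult"
  assumes "finite I" "\<And>q. q \<in> set L \<Longrightarrow> b q \<in> I"
  shows "(\<Prod>q\<leftarrow>L. f q) = (\<Prod>i\<in>I. \<Prod>q\<leftarrow>filter (\<lambda>q. b q = i) L. f q)"
  using assms(2)
proof (induction L)
  case (Cons x L)
  have "(\<Prod>i\<in>I. \<Prod>q\<leftarrow>filter (\<lambda>q. b q = i) (x # L). f q) =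
     (\<Prod>i\<in>I. (if b x = i then f x else 1) * (\<Prod>q\<leftarrow>filter (\<lambda>q. b q = i) L. f q))"
    by (rule prod.cong) auto
  also have "\<dots> = f x * (\<Prod>q\<leftarrow>L. f q)"
    using Cons assms(1) by (simp add: prod.distrib)
  finally show ?case by simp
qed simp

text \<open>Deleting a position that satisfies \<open>Q\<close> deletes the corresponding position
  of the sublist satisfying \<open>Q\<close> and leaves the complementary sublist alone. The summand
  \<open>g\<close> is arbitrary, so that in the induction it can absorb the head of the list on
  either side.\<close>

lemma sum_filter_remove_nth:
  fixes g :: "'b \<Rightarrow> 'b list \<Rightarrow> 'b list \<Rightarrow> 'c::comm_monoid_add"
  shows "(\<Sum>m<length L. if Q (L ! m) then g (L ! m) (filter Q (remove_nth m L)) (filter (\<lambda>x. \<not> Q x) (remove_nth m L)) else 0) =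
    (\<Sum>m<length (filter Q L). g (filter Q L ! m) (remove_nth m (filter Q L)) (filter (\<lambda>x. \<not> Q x) L))"
proof (induction L arbitrary: g)
  case (Cons x L)
  show ?case
  proof (cases "Q x")
    case True
    then show ?thesis
      using Cons.IH[of "\<lambda>y A B. g y (x # A) B"] by (simp add: sum.lessThan_Suc_shift del: sum.lessThan_Suc cong: if_cong)
  next
    case False
    then show ?thesis
      using Cons.IH[of "\<lambda>y A B. g y A (x # B)"] by (simp add: sum.lessThan_Suc_shift del: sum.lessThan_Suc cong: if_cong)
  qed
qed simp

text \<open>The label \<open>p\<close> names a function \<open>h p\<close> of the independent
  variable \<open>Z (b p)\<close>, so the labels fall into blocks according to \<open>b\<close>. The
  expectation of a product factors over the blocks; the relation within the block of
  \<open>p\<close> then gives the terms pairing \<open>p\<close> with a label of its own block, and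
  the terms with other blocks have coefficient 0.\<close>

lemma wick_indep:
  fixes Z :: "'i \<Rightarrow> 'w \<Rightarrow> complex"
  assumes M: "prob_space M" and ind: "prob_space.indep_vars M (\<lambda>_. borel) Z I" and I: "finite I"
    and b: "\<And>p. p \<in> P \<Longrightarrow> b p \<in> I"
    and h: "\<And>p. p \<in> P \<Longrightarrow> h p \<in> borel_measurable borel"
    and w: "\<And>i. i \<in> I \<Longrightarrow> wick M (\<lambda>p \<omega>. h p (Z (b p) \<omega>)) {p \<in> P. b p = i} c"
    and c0: "\<And>p q. p \<in> P \<Longrightarrow> q \<in> P \<Longrightarrow> b p \<noteq> b q \<Longrightarrow> c p q = 0"
  shows "wick M (\<lambda>p \<omega>. h p (Z (b p) \<omega>)) P c"
proof -
  interpret prob_space M by fact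
  define X where "X = (\<lambda>p \<omega>. h p (Z (b p) \<omega>))"
  define G where "G = (\<lambda>L i z. \<Prod>q\<leftarrow>filter (\<lambda>q. b q = i) L. h q z)"
  have GX: "G L i (Z i \<omega>) = (\<Prod>q\<leftarrow>filter (\<lambda>q. b q = i) L. X q \<omega>)" for L i \<omega>
    unfolding G_def X_def by (intro arg_cong[where f=prod_list] map_cong) auto
  have iG: "integrable M (\<lambda>\<omega>. G L i (Z i \<omega>))" if "set L \<subseteq> P" "i \<in> I" for L i
  proof -
    have "set (filter (\<lambda>q. b q = i) L) \<subseteq> {p \<in> P. b p = i}" using that by auto
    with w[OF \<open>i \<in> I\<close>] show ?thesis unfolding GX wick_def X_def by blast
  qed
  have mG: "G L i \<in> borel_measurable borel" if "set L \<subseteq> P" for L i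
  proof -
    have "(\<lambda>z. \<Prod>q\<leftarrow>L'. h q z) \<in> borel_measurable borel" if "set L' \<subseteq> P" for L'
      using that by (induction L') (auto intro!: borel_measurable_times h)
    from this[of "filter (\<lambda>q. b q = i) L"] that show ?thesis unfolding G_def by auto
  qed
  have indG: "indep_vars (\<lambda>_. borel) (\<lambda>i \<omega>. G L i (Z i \<omega>)) I" if "set L \<subseteq> P" for L
    using indep_vars_compose2[OF ind, of "G L" "\<lambda>_. borel"] mG[OF that] by simp
  have prodG: "(\<Prod>q\<leftarrow>L. X q \<omega>) = (\<Prod>i\<in>I. G L i (Z i \<omega>))" if "set L \<subseteq> P" for L \<omega>
    unfolding GX using that b by (intro prod_list_filter_split I) auto
  have int: "integrable M (\<lambda>\<omega>. \<Prod>q\<leftarrow>L. X q \<omega>)" if "set L \<subseteq> P" for L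
    unfolding prodG[OF that] by (rule indep_vars_integrable[OF I indG[OF that] iG[OF that]])
  have EG: "(\<integral>\<omega>. (\<Prod>q\<leftarrow>L. X q \<omega>) \<partial>M) = (\<Prod>i\<in>I. \<integral>\<omega>. G L i (Z i \<omega>) \<partial>M)" if "set L \<subseteq> P" for L
    unfolding prodG[OF that] by (rule indep_vars_lebesgue_integral[OF I indG[OF that] iG[OF that]])
  \<comment> \<open>Only the block of one label has to be separated; all other blocks stay together
    in the second factor.\<close>
  have split: "(\<integral>\<omega>. (\<Prod>q\<leftarrow>L. X q \<omega>) \<partial>M) =
      (\<integral>\<omega>. (\<Prod>q\<leftarrow>filter (\<lambda>q. b q = i) L. X q \<omega>) \<partial>M) *
      (\<integral>\<omega>. (\<Prod>q\<leftarrow>filter (\<lambda>q. b q \<noteq> i) L. X q \<omega>) \<partial>M)" if L: "set L \<subseteq> P" and i: "i \<in> I" for L i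
  proof -
    let ?L' = "filter (\<lambda>q. b q \<noteq> i) L"
    have L': "set ?L' \<subseteq> P" using L by auto
    \<comment> \<open>Removing block \<open>i\<close> from the list turns its factor into the empty
      product, whose expectation is 1, and does not touch the other factors.\<close>
    have 1: "G ?L' j = (if j = i then (\<lambda>_. 1) else G L j)" for j
      unfolding G_def by (auto simp: fun_eq_iff intro!: arg_cong[where f=prod_list] arg_cong[where f="\<lambda>l. map _ l"] filter_cong)
    have "(\<integral>\<omega>. (\<Prod>q\<leftarrow>?L'. X q \<omega>) \<partial>M) = (\<Prod>j\<in>I. \<integral>\<omega>. G ?L' j (Z j \<omega>) \<partial>M)"
      by (rule EG[OF L'])
    also have "\<dots> = (\<Prod>j\<in>I - {i}. \<integral>\<omega>. G L j (Z j \<omega>) \<partial>M)"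
      unfolding prod.remove[OF I i] using prob_space by (simp add: 1)
    finally show ?thesis
      unfolding EG[OF L] prod.remove[OF I i] by (simp add: GX)
  qed
  show ?thesis
    unfolding X_def[symmetric] unfolding wick_def
  proof (intro conjI ballI allI impI)
    show "integrable M (\<lambda>\<omega>. \<Prod>q\<leftarrow>L. X q \<omega>)" if "set L \<subseteq> P" for L by (rule int[OF that])
    fix p L assume p: "p \<in> P" and L: "set L \<subseteq> P"
    let ?i = "b p" let ?Q = "\<lambda>q. b q = ?i"
    have i: "?i \<in> I" by (rule b[OF p])
    have w': "(\<integral>\<omega>. X p \<omega> * (\<Prod>q\<leftarrow>filter ?Q L. X q \<omega>) \<partial>M) =
       (\<Sum>m<length (filter ?Q L). c p (filter ?Q L ! m) * (\<integral>\<omega>. (\<Prod>q\<leftarrow>remove_nth m (filter ?Q L). X q \<omega>) \<partial>M))"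
    proof -
      have "set (filter ?Q L) \<subseteq> {q \<in> P. b q = ?i}" using L by auto
      with w[OF i] p show ?thesis unfolding wick_def X_def by blast
    qed
    have "(\<integral>\<omega>. X p \<omega> * (\<Prod>q\<leftarrow>L. X q \<omega>) \<partial>M) = (\<integral>\<omega>. (\<Prod>q\<leftarrow>p # L. X q \<omega>) \<partial>M)" by simp
    also have "\<dots> = (\<integral>\<omega>. X p \<omega> * (\<Prod>q\<leftarrow>filter ?Q L. X q \<omega>) \<partial>M) *
        (\<integral>\<omega>. (\<Prod>q\<leftarrow>filter (\<lambda>q. \<not> ?Q q) L. X q \<omega>) \<partial>M)"
      using split[of "p # L" ?i] p L i by simp
    also have "\<dots> = (\<Sum>m<length (filter ?Q L). c p (filter ?Q L ! m) *
        ((\<integral>\<omega>. (\<Prod>q\<leftarrow>remove_nth m (filter ?Q L). X q \<omega>) \<partial>M) *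
         (\<integral>\<omega>. (\<Prod>q\<leftarrow>filter (\<lambda>q. \<not> ?Q q) L. X q \<omega>) \<partial>M)))"
      unfolding w' by (simp add: sum_distrib_left sum_distrib_right mult_ac)
    also have "\<dots> = (\<Sum>m<length L. if ?Q (L ! m) then c p (L ! m) *
        ((\<integral>\<omega>. (\<Prod>q\<leftarrow>filter ?Q (remove_nth m L). X q \<omega>) \<partial>M) *
         (\<integral>\<omega>. (\<Prod>q\<leftarrow>filter (\<lambda>q. \<not> ?Q q) (remove_nth m L). X q \<omega>) \<partial>M)) else 0)"
      by (rule sum_filter_remove_nth[symmetric])
    also have "\<dots> = (\<Sum>m<length L. c p (L ! m) * (\<integral>\<omega>. (\<Prod>q\<leftarrow>remove_nth m L. X q \<omega>) \<partial>M))"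
    proof (rule sum.cong[OF refl])
      fix m assume "m \<in> {..<length L}"
      then have "L ! m \<in> P" using L by auto
      moreover have "set (remove_nth m L) \<subseteq> P" using L set_remove_nth[of m L] by auto
      note split[OF this i]
      ultimately show "(if ?Q (L ! m) then c p (L ! m) *
        ((\<integral>\<omega>. (\<Prod>q\<leftarrow>filter ?Q (remove_nth m L). X q \<omega>) \<partial>M) *
         (\<integral>\<omega>. (\<Prod>q\<leftarrow>filter (\<lambda>q. \<not> ?Q q) (remove_nth m L). X q \<omega>) \<partial>M)) else 0) =
         c p (L ! m) * (\<integral>\<omega>. (\<Prod>q\<leftarrow>remove_nth m L. X q \<omega>) \<partial>M)"
        using c0[OF p, of "L ! m"] by auto
    qed
    finally show "(\<integral>\<omega>. X p \<omega> * (\<Prod>q\<leftarrow>L. X q \<omega>) \<partial>M) =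
       (\<Sum>m<length L. c p (L ! m) * (\<integral>\<omega>. (\<Prod>q\<leftarrow>remove_nth m L. X q \<omega>) \<partial>M))" .
  qed
qed

section \<open>Gaussian integration by parts for polynomials\<close>

text \<open>\<open>poly_deriv X P F D\<close>: \<open>F\<close> is a polynomial in the variables \<open>X p\<close>, \<open>p \<in> P\<close>, with formal partial derivatives \<open>D p\<close>.\<close>

inductive poly_deriv :: "('p \<Rightarrow> 'w \<Rightarrow> complex) \<Rightarrow> 'p set \<Rightarrow> ('w \<Rightarrow> complex) \<Rightarrow> ('p \<Rightarrow> 'w \<Rightarrow> complex) \<Rightarrow> bool"
  for X P where
  poly_deriv_const: "poly_deriv X P (\<lambda>_. c) (\<lambda>_ _. 0)"
| poly_deriv_var: "p \<in> P \<Longrightarrow> poly_deriv X P (X p) (\<lambda>q _. of_bool (q = p))"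
| poly_deriv_add: "poly_deriv X P F D \<Longrightarrow> poly_deriv X P G E \<Longrightarrow> poly_deriv X P (\<lambda>\<omega>. F \<omega> + G \<omega>) (\<lambda>q \<omega>. D q \<omega> + E q \<omega>)"
| poly_deriv_mult: "poly_deriv X P F D \<Longrightarrow> poly_deriv X P G E \<Longrightarrow>
    poly_deriv X P (\<lambda>\<omega>. F \<omega> * G \<omega>) (\<lambda>q \<omega>. D q \<omega> * G \<omega> + F \<omega> * E q \<omega>)"
| poly_deriv_cong: "poly_deriv X P F D \<Longrightarrow> (\<And>q. q \<in> P \<Longrightarrow> D' q = D q) \<Longrightarrow> poly_deriv X P F D'"

lemma poly_deriv_sum:
  assumes "\<And>a. a \<in> S \<Longrightarrow> poly_deriv X P (F a) (D a)"
  shows "poly_deriv X P (\<lambda>\<omega>. \<Sum>a\<in>S. F a \<omega>) (\<lambda>q \<omega>. \<Sum>a\<in>S. D a q \<omega>)"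
  using assms
proof (induction S rule: infinite_finite_induct)
  case (insert a S)
  then have "poly_deriv X P (\<lambda>\<omega>. F a \<omega> + (\<Sum>a\<in>S. F a \<omega>)) (\<lambda>q \<omega>. D a q \<omega> + (\<Sum>a\<in>S. D a q \<omega>))"
    by (intro poly_deriv_add) auto
  with insert show ?case by simp
qed (simp_all add: poly_deriv_const)

lemma poly_deriv_prod_list:
  assumes "\<And>x. x \<in> set T \<Longrightarrow> poly_deriv X P (f x) (d x)"
  shows "poly_deriv X P (\<lambda>\<omega>. \<Prod>x\<leftarrow>T. f x \<omega>)
    (\<lambda>q \<omega>. \<Sum>m<length T. d (T ! m) q \<omega> * (\<Prod>x\<leftarrow>remove_nth m T. f x \<omega>))"
  using assms
proof (induction T)
  case Nil
  then show ?case using poly_deriv_const[of X P 1] by simp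
next
  case (Cons y T)
  have "poly_deriv X P (\<lambda>\<omega>. f y \<omega> * (\<Prod>x\<leftarrow>T. f x \<omega>))
    (\<lambda>q \<omega>. d y q \<omega> * (\<Prod>x\<leftarrow>T. f x \<omega>) +
       f y \<omega> * (\<Sum>m<length T. d (T ! m) q \<omega> * (\<Prod>x\<leftarrow>remove_nth m T. f x \<omega>)))"
    by (rule poly_deriv_mult) (use Cons in auto)
  then show ?case
    by (simp add: sum.lessThan_Suc_shift sum_distrib_left mult_ac del: sum.lessThan_Suc)
qed

text \<open>Integration by parts, E(X_p G) = sum over q of c p q E(D_q G), demanded for every G that
  is \<open>H\<close> times a monomial in the variables, with the product rule written out. Having
  all monomials at hand makes the property stable under multiplication of \<open>H\<close> by a
  variable.\<close>

definition stein_multiplier ::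
    "'w measure \<Rightarrow> ('p \<Rightarrow> 'w \<Rightarrow> complex) \<Rightarrow> 'p set \<Rightarrow> ('p \<Rightarrow> 'p \<Rightarrow> complex) \<Rightarrow>
     ('w \<Rightarrow> complex) \<Rightarrow> ('p \<Rightarrow> 'w \<Rightarrow> complex) \<Rightarrow> bool" where
  "stein_multiplier M X P c H D \<longleftrightarrow>
     (\<forall>L. set L \<subseteq> P \<longrightarrow> integrable M (\<lambda>\<omega>. H \<omega> * (\<Prod>q\<leftarrow>L. X q \<omega>)) \<and>
       (\<forall>p\<in>P. integrable M (\<lambda>\<omega>. D p \<omega> * (\<Prod>q\<leftarrow>L. X q \<omega>)) \<and>
         (\<integral>\<omega>. X p \<omega> * (H \<omega> * (\<Prod>q\<leftarrow>L. X q \<omega>)) \<partial>M) =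
           (\<Sum>q\<in>P. c p q * (\<integral>\<omega>. D q \<omega> * (\<Prod>q\<leftarrow>L. X q \<omega>) \<partial>M)) +
           (\<Sum>m<length L. c p (L ! m) * (\<integral>\<omega>. H \<omega> * (\<Prod>q\<leftarrow>remove_nth m L. X q \<omega>) \<partial>M))))"

lemma stein_multiplier_one:
  assumes "wick M X P c"
  shows "stein_multiplier M X P c (\<lambda>_. 1) (\<lambda>_ _. 0)"
  using assms by (auto simp: wick_def stein_multiplier_def)

text \<open>
  Multiplying an arbitrary multiplier rather than \<open>1\<close> makes the product case of the induction trivial.
\<close>

lemma stein_multiplier_poly_deriv:
  assumes "poly_deriv X P F D" and P: "finite P"
  shows "stein_multiplier M X P c H E \<Longrightarrow>
    stein_multiplier M X P c (\<lambda>\<omega>. F \<omega> * H \<omega>) (\<lambda>q \<omega>. D q \<omega> * H \<omega> + F \<omega> * E q \<omega>)"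
  using assms(1)
proof (induction arbitrary: H E)
  case (poly_deriv_const k)
  have *: "X p \<omega> * (k * H \<omega> * R) = k * (X p \<omega> * (H \<omega> * R))" for p \<omega> R by simp
  from poly_deriv_const show ?case
    unfolding stein_multiplier_def *
    by (simp add: mult.assoc sum_distrib_left distrib_left mult.left_commute[of _ k])
next
  case (poly_deriv_var r)
  note S = poly_deriv_var(2)[unfolded stein_multiplier_def]
  have i1: "integrable M (\<lambda>\<omega>. H \<omega> * (\<Prod>q\<leftarrow>L. X q \<omega>))" if "set L \<subseteq> P" for L
    using S that by blast
  have i2: "integrable M (\<lambda>\<omega>. E p \<omega> * (\<Prod>q\<leftarrow>L. X q \<omega>))" if "set L \<subseteq> P" "p \<in> P" for L p
    using S that by blast
  have i3: "integrable M (\<lambda>\<omega>. X r \<omega> * H \<omega> * (\<Prod>q\<leftarrow>L. X q \<omega>))" if "set L \<subseteq> P" for L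
    using i1[of "r # L"] that poly_deriv_var(1) by (simp add: mult_ac)
  have i4: "integrable M (\<lambda>\<omega>. X r \<omega> * E p \<omega> * (\<Prod>q\<leftarrow>L. X q \<omega>))" if "set L \<subseteq> P" "p \<in> P" for L p
    using i2[of "r # L"] that poly_deriv_var(1) by (simp add: mult_ac)
  show ?case unfolding stein_multiplier_def
  proof (intro allI impI conjI ballI)
    fix L assume L: "set L \<subseteq> P"
    show "integrable M (\<lambda>\<omega>. X r \<omega> * H \<omega> * (\<Prod>q\<leftarrow>L. X q \<omega>))" by (rule i3[OF L])
    fix p assume p: "p \<in> P"
    show "integrable M (\<lambda>\<omega>. (of_bool (p = r) * H \<omega> + X r \<omega> * E p \<omega>) * (\<Prod>q\<leftarrow>L. X q \<omega>))"
      using i1[OF L] i4[OF L p] by (simp add: distrib_right mult.assoc)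
    \<comment> \<open>The factor \<open>X r\<close> is moved from the multiplier to the front of the
      monomial. The term in which \<open>p\<close> is paired with this new head is exactly the
      contribution of the derivative of \<open>X r\<close>.\<close>
    have "set (r # L) \<subseteq> P" using L poly_deriv_var(1) by simp
    then have "(\<integral>\<omega>. X p \<omega> * (H \<omega> * (\<Prod>q\<leftarrow>r # L. X q \<omega>)) \<partial>M) =
           (\<Sum>q\<in>P. c p q * (\<integral>\<omega>. E q \<omega> * (\<Prod>q\<leftarrow>r # L. X q \<omega>) \<partial>M)) +
           (\<Sum>m<length (r # L). c p ((r # L) ! m) * (\<integral>\<omega>. H \<omega> * (\<Prod>q\<leftarrow>remove_nth m (r # L). X q \<omega>) \<partial>M))"
      using S p by blast
    also have "(\<Sum>m<length (r # L). c p ((r # L) ! m) * (\<integral>\<omega>. H \<omega> * (\<Prod>q\<leftarrow>remove_nth m (r # L). X q \<omega>) \<partial>M)) =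
       c p r * (\<integral>\<omega>. H \<omega> * (\<Prod>q\<leftarrow>L. X q \<omega>) \<partial>M) +
       (\<Sum>m<length L. c p (L ! m) * (\<integral>\<omega>. X r \<omega> * H \<omega> * (\<Prod>q\<leftarrow>remove_nth m L. X q \<omega>) \<partial>M))"
      by (simp only: sum_nth_Cons) (simp add: mult_ac)
    also have "(\<Sum>q\<in>P. c p q * (\<integral>\<omega>. E q \<omega> * (\<Prod>q\<leftarrow>r # L. X q \<omega>) \<partial>M)) +
        (c p r * (\<integral>\<omega>. H \<omega> * (\<Prod>q\<leftarrow>L. X q \<omega>) \<partial>M) +
       (\<Sum>m<length L. c p (L ! m) * (\<integral>\<omega>. X r \<omega> * H \<omega> * (\<Prod>q\<leftarrow>remove_nth m L. X q \<omega>) \<partial>M))) =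
       (\<Sum>q\<in>P. c p q * (\<integral>\<omega>. (of_bool (q = r) * H \<omega> + X r \<omega> * E q \<omega>) * (\<Prod>q\<leftarrow>L. X q \<omega>) \<partial>M)) +
       (\<Sum>m<length L. c p (L ! m) * (\<integral>\<omega>. X r \<omega> * H \<omega> * (\<Prod>q\<leftarrow>remove_nth m L. X q \<omega>) \<partial>M))"
    proof -
      have "(\<integral>\<omega>. (of_bool (q = r) * H \<omega> + X r \<omega> * E q \<omega>) * (\<Prod>q\<leftarrow>L. X q \<omega>) \<partial>M) =
          of_bool (q = r) * (\<integral>\<omega>. H \<omega> * (\<Prod>q\<leftarrow>L. X q \<omega>) \<partial>M) +
          (\<integral>\<omega>. E q \<omega> * (\<Prod>q\<leftarrow>r # L. X q \<omega>) \<partial>M)" if "q \<in> P" for q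
      proof -
        have "(\<integral>\<omega>. (of_bool (q = r) * H \<omega> + X r \<omega> * E q \<omega>) * (\<Prod>q\<leftarrow>L. X q \<omega>) \<partial>M) =
          (\<integral>\<omega>. of_bool (q = r) * (H \<omega> * (\<Prod>q\<leftarrow>L. X q \<omega>)) + X r \<omega> * E q \<omega> * (\<Prod>q\<leftarrow>L. X q \<omega>) \<partial>M)"
          by (simp add: distrib_right mult.assoc)
        also have "\<dots> = of_bool (q = r) * (\<integral>\<omega>. H \<omega> * (\<Prod>q\<leftarrow>L. X q \<omega>) \<partial>M) +
          (\<integral>\<omega>. X r \<omega> * E q \<omega> * (\<Prod>q\<leftarrow>L. X q \<omega>) \<partial>M)"
          using i1[OF L] i4[OF L that] by (subst Bochner_Integration.integral_add) simp_all
        finally show ?thesis by (simp add: mult_ac)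
      qed
      moreover have "(\<Sum>q\<in>P. c p q * (of_bool (q = r) * z)) = c p r * z" for z
      proof -
        have "(\<Sum>q\<in>P. c p q * (of_bool (q = r) * z)) = (\<Sum>q\<in>P. if q = r then c p r * z else 0)"
          by (rule sum.cong) auto
        then show ?thesis using P poly_deriv_var(1) by simp
      qed
      ultimately show ?thesis by (simp add: distrib_left sum.distrib)
    qed
    finally show "(\<integral>\<omega>. X p \<omega> * (X r \<omega> * H \<omega> * (\<Prod>q\<leftarrow>L. X q \<omega>)) \<partial>M) =
       (\<Sum>q\<in>P. c p q * (\<integral>\<omega>. (of_bool (q = r) * H \<omega> + X r \<omega> * E q \<omega>) * (\<Prod>q\<leftarrow>L. X q \<omega>) \<partial>M)) +
       (\<Sum>m<length L. c p (L ! m) * (\<integral>\<omega>. X r \<omega> * H \<omega> * (\<Prod>q\<leftarrow>remove_nth m L. X q \<omega>) \<partial>M))"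
      by (simp add: mult_ac)
  qed
next
  case (poly_deriv_add F D G K)
  note A = poly_deriv_add.IH(1)[OF poly_deriv_add.prems, unfolded stein_multiplier_def, rule_format]
    and B = poly_deriv_add.IH(2)[OF poly_deriv_add.prems, unfolded stein_multiplier_def, rule_format]
  note A1 = A[THEN conjunct1] and B1 = B[THEN conjunct1]
    and A2 = A[THEN conjunct2, rule_format] and B2 = B[THEN conjunct2, rule_format]
  show ?case unfolding stein_multiplier_def
  proof (intro allI impI conjI ballI)
    fix L assume L: "set L \<subseteq> P"
    let ?X = "\<lambda>\<omega>. (\<Prod>q\<leftarrow>L. X q \<omega>)"
    have e: "(F \<omega> + G \<omega>) * H \<omega> * R = F \<omega> * H \<omega> * R + G \<omega> * H \<omega> * R" for \<omega> R
      by (simp add: algebra_simps)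
    have e2: "((D q \<omega> + K q \<omega>) * H \<omega> + (F \<omega> + G \<omega>) * E q \<omega>) * R =
       (D q \<omega> * H \<omega> + F \<omega> * E q \<omega>) * R + (K q \<omega> * H \<omega> + G \<omega> * E q \<omega>) * R" for q \<omega> R
      by (simp add: algebra_simps)
    have i: "integrable M (\<lambda>\<omega>. F \<omega> * H \<omega> * (\<Prod>q\<leftarrow>L. X q \<omega>))"
       "integrable M (\<lambda>\<omega>. G \<omega> * H \<omega> * (\<Prod>q\<leftarrow>L. X q \<omega>))" if "set L \<subseteq> P" for L
      using that by (rule A1, rule B1)
    have i2: "integrable M (\<lambda>\<omega>. (D q \<omega> * H \<omega> + F \<omega> * E q \<omega>) * ?X \<omega>)"
       "integrable M (\<lambda>\<omega>. (K q \<omega> * H \<omega> + G \<omega> * E q \<omega>) * ?X \<omega>)" if "q \<in> P" for q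
      using A2[OF L that] B2[OF L that] by simp_all
    show "integrable M (\<lambda>\<omega>. (F \<omega> + G \<omega>) * H \<omega> * ?X \<omega>)"
      unfolding e by (intro Bochner_Integration.integrable_add i L)
    fix p assume p: "p \<in> P"
    show "integrable M (\<lambda>\<omega>. ((D p \<omega> + K p \<omega>) * H \<omega> + (F \<omega> + G \<omega>) * E p \<omega>) * ?X \<omega>)"
      unfolding e2 by (intro Bochner_Integration.integrable_add i2 p)
    have iX: "integrable M (\<lambda>\<omega>. X p \<omega> * (F \<omega> * H \<omega> * ?X \<omega>))"
        "integrable M (\<lambda>\<omega>. X p \<omega> * (G \<omega> * H \<omega> * ?X \<omega>))"
      using i[of "p # L"] p L by (simp_all add: mult_ac)
    have "(\<integral>\<omega>. X p \<omega> * ((F \<omega> + G \<omega>) * H \<omega> * ?X \<omega>) \<partial>M) =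
      (\<integral>\<omega>. X p \<omega> * (F \<omega> * H \<omega> * ?X \<omega>) \<partial>M) + (\<integral>\<omega>. X p \<omega> * (G \<omega> * H \<omega> * ?X \<omega>) \<partial>M)"
      unfolding e distrib_left by (rule Bochner_Integration.integral_add[OF iX])
    also have "\<dots> = ((\<Sum>q\<in>P. c p q * (\<integral>\<omega>. (D q \<omega> * H \<omega> + F \<omega> * E q \<omega>) * ?X \<omega> \<partial>M)) +
           (\<Sum>m<length L. c p (L ! m) * (\<integral>\<omega>. F \<omega> * H \<omega> * (\<Prod>q\<leftarrow>remove_nth m L. X q \<omega>) \<partial>M))) +
         ((\<Sum>q\<in>P. c p q * (\<integral>\<omega>. (K q \<omega> * H \<omega> + G \<omega> * E q \<omega>) * ?X \<omega> \<partial>M)) +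
           (\<Sum>m<length L. c p (L ! m) * (\<integral>\<omega>. G \<omega> * H \<omega> * (\<Prod>q\<leftarrow>remove_nth m L. X q \<omega>) \<partial>M)))"
      unfolding A2[OF L p, THEN conjunct2]
        B2[OF L p, THEN conjunct2] ..
    also have "\<dots> = (\<Sum>q\<in>P. c p q * (\<integral>\<omega>. ((D q \<omega> + K q \<omega>) * H \<omega> + (F \<omega> + G \<omega>) * E q \<omega>) * ?X \<omega> \<partial>M)) +
           (\<Sum>m<length L. c p (L ! m) * (\<integral>\<omega>. (F \<omega> + G \<omega>) * H \<omega> * (\<Prod>q\<leftarrow>remove_nth m L. X q \<omega>) \<partial>M))"
    proof -
      have 1: "(\<integral>\<omega>. ((D q \<omega> + K q \<omega>) * H \<omega> + (F \<omega> + G \<omega>) * E q \<omega>) * ?X \<omega> \<partial>M) =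
        (\<integral>\<omega>. (D q \<omega> * H \<omega> + F \<omega> * E q \<omega>) * ?X \<omega> \<partial>M) + (\<integral>\<omega>. (K q \<omega> * H \<omega> + G \<omega> * E q \<omega>) * ?X \<omega> \<partial>M)"
        if "q \<in> P" for q
        unfolding e2 by (rule Bochner_Integration.integral_add[OF i2[OF that]])
      have 2: "(\<integral>\<omega>. (F \<omega> + G \<omega>) * H \<omega> * (\<Prod>q\<leftarrow>remove_nth m L. X q \<omega>) \<partial>M) =
        (\<integral>\<omega>. F \<omega> * H \<omega> * (\<Prod>q\<leftarrow>remove_nth m L. X q \<omega>) \<partial>M) +
        (\<integral>\<omega>. G \<omega> * H \<omega> * (\<Prod>q\<leftarrow>remove_nth m L. X q \<omega>) \<partial>M)" for m
        unfolding e by (rule Bochner_Integration.integral_add[OF i]) (use L set_remove_nth[of m L] in auto)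
      have 3: "(\<Sum>q\<in>P. c p q * (\<integral>\<omega>. ((D q \<omega> + K q \<omega>) * H \<omega> + (F \<omega> + G \<omega>) * E q \<omega>) * ?X \<omega> \<partial>M)) =
         (\<Sum>q\<in>P. c p q * (\<integral>\<omega>. (D q \<omega> * H \<omega> + F \<omega> * E q \<omega>) * ?X \<omega> \<partial>M)) +
         (\<Sum>q\<in>P. c p q * (\<integral>\<omega>. (K q \<omega> * H \<omega> + G \<omega> * E q \<omega>) * ?X \<omega> \<partial>M))"
        unfolding sum.distrib[symmetric] by (rule sum.cong) (simp_all only: 1 distrib_left)
      show ?thesis unfolding 2 3 by (simp add: distrib_left sum.distrib)
    qed
    finally show "(\<integral>\<omega>. X p \<omega> * ((F \<omega> + G \<omega>) * H \<omega> * ?X \<omega>) \<partial>M) = \<dots>" .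
  qed
next
  case (poly_deriv_mult F D G K)
  have "stein_multiplier M X P c (\<lambda>\<omega>. F \<omega> * (G \<omega> * H \<omega>))
     (\<lambda>q \<omega>. D q \<omega> * (G \<omega> * H \<omega>) + F \<omega> * (K q \<omega> * H \<omega> + G \<omega> * E q \<omega>))"
    by (intro poly_deriv_mult)
  then show ?case by (simp add: algebra_simps)
next
  case (poly_deriv_cong F D D')
  have "(\<Sum>q\<in>P. c p q * (\<integral>\<omega>. (D' q \<omega> * H \<omega> + F \<omega> * E q \<omega>) * (\<Prod>q\<leftarrow>L. X q \<omega>) \<partial>M)) =
     (\<Sum>q\<in>P. c p q * (\<integral>\<omega>. (D q \<omega> * H \<omega> + F \<omega> * E q \<omega>) * (\<Prod>q\<leftarrow>L. X q \<omega>) \<partial>M))" for L p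
    by (rule sum.cong) (simp_all add: poly_deriv_cong(2))
  with poly_deriv_cong(3)[OF poly_deriv_cong(4)] poly_deriv_cong(2) show ?case
    unfolding stein_multiplier_def by simp
qed

text \<open>A polynomial \<open>F\<close> turns the multiplier 1 into the multiplier
  \<open>F\<close>; the empty monomial then leaves the plain formula.\<close>

theorem stein:
  assumes "wick M X P c" "finite P" "poly_deriv X P F D"
  shows "integrable M F" "q \<in> P \<Longrightarrow> integrable M (D q)"
    and "p \<in> P \<Longrightarrow> (\<integral>\<omega>. X p \<omega> * F \<omega> \<partial>M) = (\<Sum>q\<in>P. c p q * (\<integral>\<omega>. D q \<omega> \<partial>M))"
proof -
  have *: "stein_multiplier M X P c F D"
    using stein_multiplier_poly_deriv[OF assms(3,2) stein_multiplier_one[OF assms(1)]] by simp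
  from *[unfolded stein_multiplier_def, rule_format, of "[]"]
  show "integrable M F" "q \<in> P \<Longrightarrow> integrable M (D q)"
    "p \<in> P \<Longrightarrow> (\<integral>\<omega>. X p \<omega> * F \<omega> \<partial>M) = (\<Sum>q\<in>P. c p q * (\<integral>\<omega>. D q \<omega> \<partial>M))"
    by auto
qed

text \<open>A product of linear combinations is a polynomial in the \<open>X p\<close>, so
  integration by parts applies to each summand of the distinguished factor, and the coefficients
  collect into the bilinear extension of \<open>c\<close>. This serves to pass from the real and
  imaginary part of a complex Gaussian variable to the variable and its conjugate.\<close>

lemma wick_linear:
  assumes w: "wick M X P c" and P: "finite P"
  shows "wick M (\<lambda>y \<omega>. \<Sum>p\<in>P. a y p * X p \<omega>) Q (\<lambda>y z. \<Sum>p\<in>P. \<Sum>q\<in>P. a y p * a z q * c p q)"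
proof -
  define Y where "Y = (\<lambda>y \<omega>. \<Sum>p\<in>P. a y p * X p \<omega>)"
  have Y: "poly_deriv X P (Y y) (\<lambda>q _. a y q)" for y
  proof -
    have "poly_deriv X P (Y y) (\<lambda>q \<omega>. \<Sum>p\<in>P. 0 * X p \<omega> + a y p * of_bool (q = p))"
      unfolding Y_def by (intro poly_deriv_sum poly_deriv_mult poly_deriv_const poly_deriv_var)
    then show ?thesis by (rule poly_deriv_cong) (simp add: P)
  qed
  have L: "poly_deriv X P (\<lambda>\<omega>. \<Prod>y\<leftarrow>L. Y y \<omega>)
     (\<lambda>q \<omega>. \<Sum>m<length L. a (L ! m) q * (\<Prod>y\<leftarrow>remove_nth m L. Y y \<omega>))" for L
    by (rule poly_deriv_prod_list[OF Y])
  have iL: "integrable M (\<lambda>\<omega>. \<Prod>y\<leftarrow>L. Y y \<omega>)" for L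
    by (rule stein(1)[OF w P L])
  show ?thesis
    unfolding wick_def Y_def[symmetric]
  proof (intro conjI allI impI ballI)
    show "integrable M (\<lambda>\<omega>. \<Prod>y\<leftarrow>L. Y y \<omega>)" for L by (rule iL)
    fix y L
    have ip: "integrable M (\<lambda>\<omega>. X p \<omega> * (\<Prod>y\<leftarrow>L. Y y \<omega>))" if "p \<in> P" for p
      by (rule stein(1)[OF w P poly_deriv_mult[OF poly_deriv_var[OF that] L]])
    have "(\<integral>\<omega>. Y y \<omega> * (\<Prod>y\<leftarrow>L. Y y \<omega>) \<partial>M) =
      (\<integral>\<omega>. (\<Sum>p\<in>P. a y p * (X p \<omega> * (\<Prod>y\<leftarrow>L. Y y \<omega>))) \<partial>M)"
      by (simp add: Y_def sum_distrib_right mult.assoc)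
    also have "\<dots> = (\<Sum>p\<in>P. a y p * (\<integral>\<omega>. X p \<omega> * (\<Prod>y\<leftarrow>L. Y y \<omega>) \<partial>M))"
      using ip by simp
    also have "\<dots> = (\<Sum>p\<in>P. a y p * (\<Sum>q\<in>P. c p q *
        (\<Sum>m<length L. a (L ! m) q * (\<integral>\<omega>. (\<Prod>y\<leftarrow>remove_nth m L. Y y \<omega>) \<partial>M))))"
      using stein(3)[OF w P L] iL by simp
    also have "\<dots> = (\<Sum>p\<in>P. \<Sum>q\<in>P. \<Sum>m<length L.
         a y p * a (L ! m) q * c p q * (\<integral>\<omega>. (\<Prod>y\<leftarrow>remove_nth m L. Y y \<omega>) \<partial>M))"
      by (simp add: sum_distrib_left mult_ac)
    also have "\<dots> = (\<Sum>p\<in>P. \<Sum>m<length L. \<Sum>q\<in>P.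
         a y p * a (L ! m) q * c p q * (\<integral>\<omega>. (\<Prod>y\<leftarrow>remove_nth m L. Y y \<omega>) \<partial>M))"
      by (intro sum.cong refl sum.swap)
    also have "\<dots> = (\<Sum>m<length L. \<Sum>p\<in>P. \<Sum>q\<in>P.
         a y p * a (L ! m) q * c p q * (\<integral>\<omega>. (\<Prod>y\<leftarrow>remove_nth m L. Y y \<omega>) \<partial>M))"
      by (rule sum.swap)
    finally show "(\<integral>\<omega>. Y y \<omega> * (\<Prod>y\<leftarrow>L. Y y \<omega>) \<partial>M) =
       (\<Sum>m<length L. (\<Sum>p\<in>P. \<Sum>q\<in>P. a y p * a (L ! m) q * c p q) *
         (\<integral>\<omega>. (\<Prod>y\<leftarrow>remove_nth m L. Y y \<omega>) \<partial>M))"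
      by (simp add: sum_distrib_right)
  qed
qed

text \<open>Here \<open>h p\<close> tells whether the label \<open>p\<close> stands for the variable or for its conjugate.\<close>

lemma wick_complex_gaussian:
  assumes M: "prob_space M" and v: "v > 0" and Z: "complex_gaussian M v Z"
  shows "wick M (\<lambda>p \<omega>. if h p then Z \<omega> else cnj (Z \<omega>)) P (\<lambda>p q. of_real v * of_bool (h p \<noteq> h q))"
proof -
  interpret prob_space M by fact
  define X where "X = (\<lambda>b \<omega>. complex_of_real (if b then Re (Z \<omega>) else Im (Z \<omega>)))"
  have g: "real_gaussian M (v / 2) (X b)" for b
    using Z by (cases b) (simp_all add: complex_gaussian_def real_gaussian_def X_def)
  have "indep_vars (case_bool borel borel) (case_bool (\<lambda>\<omega>. Re (Z \<omega>)) (\<lambda>\<omega>. Im (Z \<omega>))) UNIV"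
    using Z by (simp add: complex_gaussian_def indep_var_def)
  then have "indep_vars (\<lambda>_. borel)
      (\<lambda>b \<omega>. complex_of_real ((case_bool (\<lambda>\<omega>. Re (Z \<omega>)) (\<lambda>\<omega>. Im (Z \<omega>)) b) \<omega>)) UNIV"
    by (rule indep_vars_compose2) (simp split: bool.split)
  also have "(\<lambda>b \<omega>. complex_of_real ((case_bool (\<lambda>\<omega>. Re (Z \<omega>)) (\<lambda>\<omega>. Im (Z \<omega>)) b) \<omega>)) = X"
    by (auto simp: X_def fun_eq_iff split: bool.split)
  finally have ind: "indep_vars (\<lambda>_. borel) X UNIV" .
  have "wick M (\<lambda>p \<omega>. X p \<omega>) UNIV (\<lambda>p q. of_bool (p = q) * of_real (v / 2))"
  proof (rule wick_indep[OF M ind, where b="\<lambda>p. p" and h="\<lambda>_ z. z"])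
    fix i :: bool
    have "wick M (\<lambda>p. X i) {p \<in> UNIV. p = i} (\<lambda>p q. of_real (v / 2))"
      by (rule wick_real_gaussian[OF M _ g]) (use v in simp)
    then show "wick M (\<lambda>p \<omega>. X p \<omega>) {p \<in> UNIV. p = i} (\<lambda>p q. of_bool (p = q) * of_real (v / 2))"
      by (rule wick_cong) auto
  qed auto
  \<comment> \<open>The variable and its conjugate are Re Z + i Im Z and Re Z - i Im Z. Their
    covariances are v/2 + v/2 for one of each and v/2 - v/2 for two of the same kind.\<close>
  from wick_linear[OF this finite, of "\<lambda>p b. if b then 1 else if h p then \<i> else - \<i>" P]
  show ?thesis
  proof (rule wick_cong)
    fix p \<omega>
    show "(if h p then Z \<omega> else cnj (Z \<omega>)) =
      (\<Sum>b\<in>UNIV. (if b then 1 else if h p then \<i> else - \<i>) * X b \<omega>)"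
      by (simp add: UNIV_bool X_def complex_eq_iff)
  next
    fix p q
    show "complex_of_real v * of_bool (h p \<noteq> h q) =
      (\<Sum>b\<in>UNIV. \<Sum>b'\<in>UNIV. (if b then 1 else if h p then \<i> else - \<i>) *
         (if b' then 1 else if h q then \<i> else - \<i>) * (of_bool (b = b') * complex_of_real (v / 2)))"
      by (auto simp: UNIV_bool field_simps)
  qed
qed

section \<open>Covariances of the entries of the Gaussian ensemble\<close>

lemma mat_adjoint_index:
  assumes "X \<in> carrier_mat n m" "i < m" "j < n"
  shows "mat_adjoint X $$ (i, j) = cnj (X $$ (j, i))"
  using assms by (simp add: mat_adjoint_def mat_of_rows_def)

text \<open>The expectation of the product of two entries. The first indicator is the pairing of an
  entry with its conjugate, the second the pairing with itself, which off the diagonal survives only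
  for real entries. On the diagonal both apply, whence the variance 2/N in both cases.\<close>

definition gauss_cov :: "bool \<Rightarrow> nat \<Rightarrow> nat \<times> nat \<times> nat \<Rightarrow> nat \<times> nat \<times> nat \<Rightarrow> complex" where
  "gauss_cov re N = (\<lambda>(r, i, j) q.
     (of_bool (q = (r, j, i)) + of_bool (q = (r, i, j) \<and> (re \<or> i = j))) / of_nat N)"

definition entry_labels :: "nat \<Rightarrow> nat \<Rightarrow> (nat \<times> nat \<times> nat) set" where
  "entry_labels k N = {..<k} \<times> {..<N} \<times> {..<N}"

lemma finite_entry_labels [simp]: "finite (entry_labels k N)"
  by (simp add: entry_labels_def)

text \<open>Independence is assumed for the entries on and above the diagonal. An entry below it is
  the conjugate of its mirror image: \<open>b\<close> reflects its label upwards and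
  \<open>h\<close> conjugates the value, so the independent entries are the blocks.\<close>

lemma wick_gaussian_ensemble:
  assumes G: "gaussian_ensemble (if re then real_gaussian else complex_gaussian) k N0 M A"
    and N: "N \<ge> N0" "N > 0"
  shows "wick (M N) (\<lambda>(r, i, j) \<omega>. A N r \<omega> $$ (i, j)) (entry_labels k N) (gauss_cov re N)"
proof -
  note G' = G[unfolded gaussian_ensemble_def, THEN spec, THEN mp, OF N(1)]
  note M = G'[THEN conjunct1]
    and sa = G'[THEN conjunct2, THEN conjunct1, rule_format]
    and indep = G'[THEN conjunct2, THEN conjunct2, THEN conjunct1]
    and diag = G'[THEN conjunct2, THEN conjunct2, THEN conjunct2, THEN conjunct1, rule_format]
    and off = G'[THEN conjunct2, THEN conjunct2, THEN conjunct2, THEN conjunct2, rule_format]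
  define Z where "Z = (\<lambda>(r, i, j) \<omega>. A N r \<omega> $$ (i, j))"
  define b :: "nat \<times> nat \<times> nat \<Rightarrow> nat \<times> nat \<times> nat" where "b = (\<lambda>(r, i, j). (r, min i j, max i j))"
  define h :: "nat \<times> nat \<times> nat \<Rightarrow> complex \<Rightarrow> complex" where "h = (\<lambda>(r, i, j) z. if i \<le> j then z else cnj z)"
  let ?I = "{(r, i, j). r < k \<and> i \<le> j \<and> j < N}"
  have fin: "finite ?I" by (rule finite_subset[of _ "{..<k} \<times> {..<N} \<times> {..<N}"]) auto
  have "wick (M N) (\<lambda>p \<omega>. h p (Z (b p) \<omega>)) (entry_labels k N) (gauss_cov re N)"
  proof (rule wick_indep[where I="?I" and Z=Z and b=b and h=h, OF M _ fin])
    show "prob_space.indep_vars (M N) (\<lambda>_. borel) Z ?I" unfolding Z_def by (rule indep)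
    show "b p \<in> ?I" if "p \<in> entry_labels k N" for p
      using that by (auto simp: b_def entry_labels_def)
    show "h p \<in> borel_measurable borel" for p
    proof -
      have "cnj \<in> borel_measurable borel"
        by (intro borel_measurable_continuous_onI continuous_intros)
      moreover obtain r i j where "p = (r, i, j)" by (cases p) auto
      ultimately show ?thesis by (cases "i \<le> j") (simp_all add: h_def)
    qed
    show "gauss_cov re N p q = 0" if "b p \<noteq> b q" for p q
    proof -
      obtain r i j where p: "p = (r, i, j)" by (cases p)
      have "q \<noteq> (r, j, i)" "q \<noteq> (r, i, j)"
        using that by (auto simp: p b_def min.commute max.commute)
      then show ?thesis by (simp add: gauss_cov_def p)
    qed
    fix e assume "e \<in> ?I"
    then obtain r i j where e: "e = (r, i, j)" "r < k" "i \<le> j" "j < N" by auto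
    let ?P = "{p \<in> entry_labels k N. b p = e}"
    have P: "p = (r, i, j) \<or> p = (r, j, i)" "b p = e" if "p \<in> ?P" for p
    proof -
      obtain r' i' j' where [simp]: "p = (r', i', j')" by (cases p) blast
      show "b p = e" using that by simp
      then have "r' = r" "min i' j' = i" "max i' j' = j" by (simp_all add: e b_def)
      then show "p = (r, i, j) \<or> p = (r, j, i)"
        by (cases "i' \<le> j'") (simp_all add: min_def max_def)
    qed
    have pos: "2 / real N > 0" "1 / real N > 0" using N by simp_all
    \<comment> \<open>A block consists of the labels \<open>(r, i, j)\<close> and
      \<open>(r, j, i)\<close>. On the diagonal they coincide; for real entries they name the same
      variable; for complex entries they name a variable and its conjugate, and only such a pair is
      correlated.\<close>
    consider "i = j" | "i < j" re | "i < j" "\<not> re" using e(3) by fastforce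
    then show "wick (M N) (\<lambda>p \<omega>. h p (Z (b p) \<omega>)) ?P (gauss_cov re N)"
    proof cases
      case 1
      have g: "real_gaussian (M N) (2 / real N) (Z e)" using diag[of r i] e 1 by (simp add: Z_def)
      have eq: "h p z = z" if "p \<in> ?P" for p z
        using P(1)[OF that] 1 by (auto simp: h_def)
      have c: "gauss_cov re N p q = of_real (2 / real N)" if "p \<in> ?P" "q \<in> ?P" for p q
        using P(1)[OF that(1)] P(1)[OF that(2)] 1 by (simp add: gauss_cov_def)
      show ?thesis
        by (rule wick_cong[OF wick_real_gaussian[OF M pos(1) g]]) (simp_all only: P(2) eq c)
    next
      case 2
      have g: "real_gaussian (M N) (1 / real N) (Z e)" using off[of r j i] e 2 by (simp add: Z_def)
      have "cnj (Z e \<omega>) = Z e \<omega>" if "\<omega> \<in> space (M N)" for \<omega>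
        using g that by (simp add: real_gaussian_def Reals_cnj_iff)
      then have eq: "h p (Z e \<omega>) = Z e \<omega>" if "p \<in> ?P" "\<omega> \<in> space (M N)" for p \<omega>
        using P(1)[OF that(1)] that(2) by (elim disjE) (simp_all add: h_def)
      have c: "gauss_cov re N p q = of_real (1 / real N)" if "p \<in> ?P" "q \<in> ?P" for p q
        using P(1)[OF that(1)] P(1)[OF that(2)] 2 by (elim disjE) (simp_all add: gauss_cov_def)
      show ?thesis
        by (rule wick_cong[OF wick_real_gaussian[OF M pos(2) g]]) (simp_all only: P(2) eq c)
    next
      case 3
      have g: "complex_gaussian (M N) (1 / real N) (Z e)" using off[of r j i] e 3 by (simp add: Z_def)
      define f where "f = (\<lambda>(r :: nat, i :: nat, j :: nat). i \<le> j)"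
      have eq: "h p z = (if f p then z else cnj z)" for p z
        by (simp add: h_def f_def split: prod.split)
      have c: "gauss_cov re N p q = of_real (1 / real N) * of_bool (f p \<noteq> f q)" if "p \<in> ?P" "q \<in> ?P" for p q
        using P(1)[OF that(1)] P(1)[OF that(2)] 3
        by (elim disjE) (simp_all add: gauss_cov_def f_def)
      show ?thesis
        by (rule wick_cong[OF wick_complex_gaussian[OF M pos(2) g, of f]]) (simp_all only: P(2) eq c)
    qed
  qed
  then show ?thesis
  proof (rule wick_cong)
    fix p \<omega> assume p: "p \<in> entry_labels k N" and \<omega>: "\<omega> \<in> space (M N)"
    obtain r i j where e: "p = (r, i, j)" by (cases p) auto
    have rij: "r < k" "i < N" "j < N" using p by (auto simp: e entry_labels_def)
    have "mat_adjoint (A N r \<omega>) = A N r \<omega>" "A N r \<omega> \<in> carrier_mat N N"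
      using sa[OF rij(1) \<omega>] by (auto simp: self_adjoint_mats_def)
    then have "A N r \<omega> $$ (i, j) = cnj (A N r \<omega> $$ (j, i))"
      using mat_adjoint_index[of "A N r \<omega>" N N i j] rij by simp
    then show "(case p of (r, i, j) \<Rightarrow> \<lambda>\<omega>. A N r \<omega> $$ (i, j)) \<omega> = h p (Z (b p) \<omega>)"
      by (cases "i \<le> j") (simp_all add: e h_def Z_def b_def min_def max_def)
  qed simp
qed

section \<open>Moments of Gaussian matrices\<close>

fun word_entry :: "('x \<Rightarrow> nat \<Rightarrow> nat \<Rightarrow> complex) \<Rightarrow> nat \<Rightarrow> 'x list \<Rightarrow> nat \<Rightarrow> nat \<Rightarrow> complex" where
  "word_entry F N [] i j = of_bool (i = j)"
| "word_entry F N (x # w) i j = (\<Sum>a<N. F x i a * word_entry F N w a j)"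

text \<open>An item \<open>(w, i, j)\<close> stands for the \<open>(i, j)\<close> entry of the
  matrix word \<open>w\<close>. Products of such entries are closed under integration by parts,
  since deleting a letter splits one entry into a product of two.\<close>

type_synonym item = "nat list \<times> nat \<times> nat"

definition items_prod :: "(nat \<times> nat \<times> nat \<Rightarrow> 'w \<Rightarrow> complex) \<Rightarrow> nat \<Rightarrow> item list \<Rightarrow> 'w \<Rightarrow> complex" where
  "items_prod X N T \<omega> = (\<Prod>(w, i, j)\<leftarrow>T. word_entry (\<lambda>r i j. X (r, i, j) \<omega>) N w i j)"

definition ok_item :: "nat \<Rightarrow> nat \<Rightarrow> item \<Rightarrow> bool" where
  "ok_item k N = (\<lambda>(w, i, j). set w \<subseteq> {..<k} \<and> i < N \<and> j < N)"

text \<open>The derivative of an entry of a word in the entry \<open>(b, c)\<close> of the matrix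
  \<open>r\<close>: each occurrence of the letter \<open>r\<close> is cut out, leaving an entry of
  the prefix that ends at \<open>b\<close> and an entry of the suffix that starts at
  \<open>c\<close>.\<close>

definition word_deriv :: "(nat \<times> nat \<times> nat \<Rightarrow> 'w \<Rightarrow> complex) \<Rightarrow> nat \<Rightarrow> item \<Rightarrow> nat \<times> nat \<times> nat \<Rightarrow> 'w \<Rightarrow> complex" where
  "word_deriv X N = (\<lambda>(w, i, j) (r, b, c) \<omega>. \<Sum>m<length w. of_bool (w ! m = r) *
     (word_entry (\<lambda>r i j. X (r, i, j) \<omega>) N (take m w) i b *
      word_entry (\<lambda>r i j. X (r, i, j) \<omega>) N (drop (Suc m) w) c j))"

lemma sum_of_bool_eq:
  fixes g :: "'b \<Rightarrow> 'c::semiring_1"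
  assumes "finite S" "p \<in> S"
  shows "(\<Sum>q\<in>S. of_bool (q = p) * g q) = g p"
proof -
  have "(\<Sum>q\<in>S. of_bool (q = p) * g q) = (\<Sum>q\<in>S. if q = p then g p else 0)"
    by (rule sum.cong) auto
  then show ?thesis using assms by simp
qed

lemma poly_deriv_word_entry:
  assumes "set w \<subseteq> {..<k}" "i < N" "j < N"
  shows "poly_deriv X (entry_labels k N) (\<lambda>\<omega>. word_entry (\<lambda>r i j. X (r, i, j) \<omega>) N w i j) (word_deriv X N (w, i, j))"
  using assms
proof (induction w arbitrary: i)
  case Nil
  have "poly_deriv X (entry_labels k N) (\<lambda>\<omega>. of_bool (i = j)) (\<lambda>_ _. 0)" by (rule poly_deriv_const)
  then show ?case by (simp add: word_deriv_def case_prod_unfold)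
next
  case (Cons x w)
  let ?e = "\<lambda>\<omega>. word_entry (\<lambda>r i j. X (r, i, j) \<omega>) N"
  have "poly_deriv X (entry_labels k N) (\<lambda>\<omega>. \<Sum>a<N. X (x, i, a) \<omega> * ?e \<omega> w a j)
     (\<lambda>q \<omega>. \<Sum>a<N. of_bool (q = (x, i, a)) * ?e \<omega> w a j + X (x, i, a) \<omega> * word_deriv X N (w, a, j) q \<omega>)"
    by (intro poly_deriv_sum poly_deriv_mult poly_deriv_var Cons.IH) (use Cons.prems in \<open>auto simp: entry_labels_def\<close>)
  then show ?case
    unfolding word_entry.simps
  proof (rule poly_deriv_cong)
    fix q assume q: "q \<in> entry_labels k N"
    obtain r b c where [simp]: "q = (r, b, c)" by (cases q) auto
    have c: "c < N" using q by (simp add: entry_labels_def)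
    show "word_deriv X N (x # w, i, j) q =
      (\<lambda>\<omega>. \<Sum>a<N. of_bool (q = (x, i, a)) * ?e \<omega> w a j + X (x, i, a) \<omega> * word_deriv X N (w, a, j) q \<omega>)"
    proof
      fix \<omega>
      have 1: "(\<Sum>a<N. of_bool (q = (x, i, a)) * ?e \<omega> w a j) = of_bool (x = r) * (of_bool (i = b) * ?e \<omega> w c j)"
      proof -
        have "(\<Sum>a<N. of_bool (q = (x, i, a)) * ?e \<omega> w a j) =
          (\<Sum>a<N. if a = c then of_bool (x = r) * (of_bool (i = b) * ?e \<omega> w c j) else 0)"
          by (rule sum.cong) auto
        then show ?thesis using c by simp
      qed
      have 2: "(\<Sum>a<N. X (x, i, a) \<omega> * word_deriv X N (w, a, j) q \<omega>) =
         (\<Sum>m<length w. of_bool (w ! m = r) * (?e \<omega> (x # take m w) i b * ?e \<omega> (drop (Suc m) w) c j))"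
        unfolding word_deriv_def \<open>q = (r, b, c)\<close> prod.case word_entry.simps sum_distrib_left sum_distrib_right
        by (subst sum.swap) (intro sum.cong refl, simp only: mult_ac)
      have "word_deriv X N (x # w, i, j) q \<omega> = of_bool (x = r) * (of_bool (i = b) * ?e \<omega> w c j) +
         (\<Sum>m<length w. of_bool (w ! m = r) * (?e \<omega> (x # take m w) i b * ?e \<omega> (drop (Suc m) w) c j))"
        unfolding word_deriv_def \<open>q = (r, b, c)\<close> prod.case sum_nth_Cons
        by (simp only: nth_Cons_0 nth_Cons_Suc take_0 take_Suc_Cons drop_0 drop_Suc_Cons word_entry.simps(1))
      then show "word_deriv X N (x # w, i, j) q \<omega> =
        (\<Sum>a<N. of_bool (q = (x, i, a)) * ?e \<omega> w a j + X (x, i, a) \<omega> * word_deriv X N (w, a, j) q \<omega>)"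
        unfolding sum.distrib 1 2 .
    qed
  qed
qed

text \<open>The items that remain when letter \<open>m\<close> of item \<open>l\<close> is
  differentiated in its entry \<open>(b, c)\<close>; the two halves of the word come first.\<close>

definition contract :: "item list \<Rightarrow> nat \<Rightarrow> nat \<Rightarrow> nat \<Rightarrow> nat \<Rightarrow> item list" where
  "contract T l m b c = (case T ! l of (w, i, j) \<Rightarrow> (take m w, i, b) # (drop (Suc m) w, c, j) # remove_nth l T)"

lemma items_prod_Cons:
  "items_prod X N ((w, i, j) # T) \<omega> = word_entry (\<lambda>r i j. X (r, i, j) \<omega>) N w i j * items_prod X N T \<omega>"
  by (simp add: items_prod_def)

lemma poly_deriv_items_prod:
  assumes "\<And>t. t \<in> set T \<Longrightarrow> ok_item k N t"
  shows "poly_deriv X (entry_labels k N) (items_prod X N T)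
    (\<lambda>q \<omega>. \<Sum>l<length T. word_deriv X N (T ! l) q \<omega> * items_prod X N (remove_nth l T) \<omega>)"
proof -
  define f where "f = (\<lambda>(w, i, j) \<omega>. word_entry (\<lambda>r i j. X (r, i, j) \<omega>) N w i j)"
  have f: "items_prod X N T = (\<lambda>\<omega>. \<Prod>t\<leftarrow>T. f t \<omega>)" for T
    by (simp add: items_prod_def f_def fun_eq_iff case_prod_unfold)
  show ?thesis unfolding f
  proof (rule poly_deriv_prod_list)
    fix t assume t: "t \<in> set T"
    obtain w i j where [simp]: "t = (w, i, j)" by (cases t) auto
    show "poly_deriv X (entry_labels k N) (f t) (word_deriv X N t)"
      using assms[OF t] poly_deriv_word_entry[of w k i N j X] by (simp add: f_def ok_item_def)
  qed
qed

section \<open>Wick's recursion for products of entries\<close>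

locale gauss_model =
  fixes M :: "'w measure" and X :: "nat \<times> nat \<times> nat \<Rightarrow> 'w \<Rightarrow> complex" and k N :: nat and re :: bool
  assumes M: "prob_space M" and N: "N > 0"
    and W: "wick M X (entry_labels k N) (gauss_cov re N)"
begin

definition EV :: "item list \<Rightarrow> complex" where
  "EV T = (\<integral>\<omega>. items_prod X N T \<omega> \<partial>M)"

lemma integrable_items_prod:
  assumes "\<And>t. t \<in> set T \<Longrightarrow> ok_item k N t"
  shows "integrable M (items_prod X N T)"
  by (rule stein(1)[OF W _ poly_deriv_items_prod[OF assms]]) auto

lemma EV_Nil [simp]: "EV [] = 1"
proof -
  interpret prob_space M by (rule M)
  show ?thesis by (simp add: EV_def items_prod_def prob_space)
qed

lemma EV_empty_word: "EV (([], i, j) # T) = of_bool (i = j) * EV T"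
  by (simp add: EV_def items_prod_Cons)

text \<open>The entry \<open>(i, a)\<close> is correlated only with \<open>(a, i)\<close> and with
  itself. For \<open>i = a\<close> the two terms coincide and are both counted, as the doubled
  diagonal variance requires.\<close>

lemma sum_gauss_cov:
  assumes "r < k" "i < N" "a < N"
  shows "(\<Sum>q\<in>entry_labels k N. gauss_cov re N (r, i, a) q * g q) =
    (g (r, a, i) + of_bool (re \<or> i = a) * g (r, i, a)) / of_nat N"
proof -
  have *: "gauss_cov re N (r, i, a) q * g q = (of_bool (q = (r, a, i)) * g q +
      of_bool (re \<or> i = a) * (of_bool (q = (r, i, a)) * g q)) / of_nat N" for q
    unfolding gauss_cov_def prod.case of_bool_conj by (simp only: distrib_right distrib_left mult_ac times_divide_eq_left times_divide_eq_right)
  have mem: "(r, a, i) \<in> entry_labels k N" "(r, i, a) \<in> entry_labels k N"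
    using assms by (simp_all add: entry_labels_def)
  show ?thesis
    unfolding * sum_divide_distrib[symmetric] sum.distrib sum_distrib_left[symmetric]
    by (simp only: sum_of_bool_eq mem finite_entry_labels)
qed

lemma ok_contract:
  assumes "\<And>t. t \<in> set T \<Longrightarrow> ok_item k N t" "l < length T" "b < N" "c < N" "t \<in> set (contract T l m b c)"
  shows "ok_item k N t"
proof -
  obtain w i j where e: "T ! l = (w, i, j)" by (cases "T ! l") auto
  have o: "ok_item k N (w, i, j)" using assms(1)[OF nth_mem[OF assms(2)]] e by simp
  have "t = (take m w, i, b) \<or> t = (drop (Suc m) w, c, j) \<or> t \<in> set (remove_nth l T)"
    using assms(5) by (simp add: contract_def e)
  moreover have "set (take m w) \<subseteq> set w" "set (drop (Suc m) w) \<subseteq> set w"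
    by (rule set_take_subset, rule set_drop_subset)
  ultimately show ?thesis
    using o assms(1)[of t] set_remove_nth[of l T] assms(3,4)
    by (elim disjE) (auto simp: ok_item_def)
qed

text \<open>The first letter is paired with letter \<open>m\<close> of item \<open>l\<close>, in one of the two possible orientations.\<close>

theorem EV_rec:
  assumes T: "\<And>t. t \<in> set ((x # w, i, j) # T) \<Longrightarrow> ok_item k N t"
  shows "EV ((x # w, i, j) # T) =
    (\<Sum>l<length ((w, i, j) # T). \<Sum>m<length (fst (((w, i, j) # T) ! l)).
       of_bool (fst (((w, i, j) # T) ! l) ! m = x) *
       ((\<Sum>a<N. EV (contract ((w, a, j) # T) l m a i) + of_bool (re \<or> i = a) * EV (contract ((w, a, j) # T) l m i a)) / of_nat N))"
proof -
  have x: "x < k" and i: "i < N" and j: "j < N" and w: "set w \<subseteq> {..<k}"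
    using T[of "(x # w, i, j)"] by (auto simp: ok_item_def)
  let ?T = "\<lambda>a. (w, a, j) # T"
  have okT: "ok_item k N t" if "t \<in> set (?T a)" "a < N" for t a
    using that T[of t] w j by (auto simp: ok_item_def)
  have int: "integrable M (\<lambda>\<omega>. X (x, i, a) \<omega> * items_prod X N (?T a) \<omega>)" if "a < N" for a
  proof -
    have "poly_deriv X (entry_labels k N) (X (x, i, a)) (\<lambda>q _. of_bool (q = (x, i, a)))"
      using x i that by (intro poly_deriv_var) (simp add: entry_labels_def)
    from stein(1)[OF W _ poly_deriv_mult[OF this poly_deriv_items_prod[where T="?T a", OF okT[OF _ that]]]] show ?thesis by simp
  qed
  have cutI: "integrable M (items_prod X N (contract (?T a) l m b c))"
    if "a < N" "b < N" "c < N" "l < length (?T a)" for a b c l m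
    using that by (intro integrable_items_prod ok_contract[OF okT])
  have deriv: "(\<integral>\<omega>. (\<Sum>l<length (?T a). word_deriv X N (?T a ! l) (x, b, c) \<omega> * items_prod X N (remove_nth l (?T a)) \<omega>) \<partial>M) =
     (\<Sum>l<length (?T a). \<Sum>m<length (fst (?T a ! l)). of_bool (fst (?T a ! l) ! m = x) * EV (contract (?T a) l m b c))"
    if "a < N" "b < N" "c < N" for a b c
  proof -
    have "(\<integral>\<omega>. (\<Sum>l<length (?T a). word_deriv X N (?T a ! l) (x, b, c) \<omega> * items_prod X N (remove_nth l (?T a)) \<omega>) \<partial>M) =
      (\<integral>\<omega>. (\<Sum>l<length (?T a). \<Sum>m<length (fst (?T a ! l)). of_bool (fst (?T a ! l) ! m = x) * items_prod X N (contract (?T a) l m b c) \<omega>) \<partial>M)"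
    proof (intro Bochner_Integration.integral_cong refl sum.cong)
      fix \<omega> l
      obtain w' i' j' where e: "?T a ! l = (w', i', j')" by (cases "?T a ! l") auto
      show "word_deriv X N (?T a ! l) (x, b, c) \<omega> * items_prod X N (remove_nth l (?T a)) \<omega> =
        (\<Sum>m<length (fst (?T a ! l)). of_bool (fst (?T a ! l) ! m = x) * items_prod X N (contract (?T a) l m b c) \<omega>)"
        unfolding contract_def e prod.case fst_conv word_deriv_def items_prod_Cons sum_distrib_right
        by (simp add: mult.assoc)
    qed
    also have "\<dots> = (\<Sum>l<length (?T a). \<Sum>m<length (fst (?T a ! l)). of_bool (fst (?T a ! l) ! m = x) * EV (contract (?T a) l m b c))"
    proof -
      have i1: "integrable M (\<lambda>\<omega>. of_bool (fst (?T a ! l) ! m = x) * items_prod X N (contract (?T a) l m b c) \<omega>)"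
        if "l < length (?T a)" for l m
        by (rule integrable_mult_right[OF cutI[OF \<open>a < N\<close> \<open>b < N\<close> \<open>c < N\<close> that]])
      have "(\<integral>\<omega>. (\<Sum>m<length (fst (?T a ! l)). of_bool (fst (?T a ! l) ! m = x) * items_prod X N (contract (?T a) l m b c) \<omega>) \<partial>M) =
        (\<Sum>m<length (fst (?T a ! l)). of_bool (fst (?T a ! l) ! m = x) * EV (contract (?T a) l m b c))"
        if "l < length (?T a)" for l
        unfolding EV_def integral_mult_right_zero[symmetric]
        by (rule Bochner_Integration.integral_sum) (rule i1[OF that])
      then show ?thesis
        by (subst Bochner_Integration.integral_sum)
          (intro Bochner_Integration.integrable_sum i1, simp, intro sum.cong refl, simp)
    qed
    finally show ?thesis .
  qed
  \<comment> \<open>The words in the items do not depend on the intermediate index \<open>a\<close>,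
    only the left index of the first item does. Writing the ranges of \<open>l\<close> and
    \<open>m\<close> with \<open>i\<close> in place of \<open>a\<close> lets the sum over
    \<open>a\<close> move inside.\<close>
  have fst_eq: "fst (?T a ! l) = fst (?T i ! l)" for a l by (cases l) auto
  have one: "(\<integral>\<omega>. X (x, i, a) \<omega> * items_prod X N (?T a) \<omega> \<partial>M) =
     (\<Sum>l<length (?T i). \<Sum>m<length (fst (?T i ! l)). of_bool (fst (?T i ! l) ! m = x) *
       ((EV (contract (?T a) l m a i) + of_bool (re \<or> i = a) * EV (contract (?T a) l m i a)) / of_nat N))"
    if a: "a < N" for a
  proof -
    have "(x, i, a) \<in> entry_labels k N" using x i a by (simp add: entry_labels_def)
    from stein(3)[OF W _ poly_deriv_items_prod[where T="?T a", OF okT[OF _ a]] this]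
    have "(\<integral>\<omega>. X (x, i, a) \<omega> * items_prod X N (?T a) \<omega> \<partial>M) =
      (\<Sum>q\<in>entry_labels k N. gauss_cov re N (x, i, a) q *
        (\<integral>\<omega>. (\<Sum>l<length (?T a). word_deriv X N (?T a ! l) q \<omega> * items_prod X N (remove_nth l (?T a)) \<omega>) \<partial>M))"
      by simp
    also have "\<dots> = ((\<Sum>l<length (?T a). \<Sum>m<length (fst (?T a ! l)). of_bool (fst (?T a ! l) ! m = x) * EV (contract (?T a) l m a i)) +
        of_bool (re \<or> i = a) *
        (\<Sum>l<length (?T a). \<Sum>m<length (fst (?T a ! l)). of_bool (fst (?T a ! l) ! m = x) * EV (contract (?T a) l m i a))) / of_nat N"
      unfolding sum_gauss_cov[OF x i a] deriv[OF a a i] deriv[OF a i a] ..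
    also have "\<dots> = (\<Sum>l<length (?T i). \<Sum>m<length (fst (?T i ! l)). of_bool (fst (?T i ! l) ! m = x) *
       ((EV (contract (?T a) l m a i) + of_bool (re \<or> i = a) * EV (contract (?T a) l m i a)) / of_nat N))"
      unfolding fst_eq[of a] sum_distrib_left sum.distrib[symmetric] sum_divide_distrib
      by (intro sum.cong refl) (simp_all only: list.size distrib_left mult_ac times_divide_eq_right)
    finally show ?thesis .
  qed
  have "EV ((x # w, i, j) # T) = (\<integral>\<omega>. (\<Sum>a<N. X (x, i, a) \<omega> * items_prod X N (?T a) \<omega>) \<partial>M)"
    by (simp add: EV_def items_prod_Cons sum_distrib_right mult.assoc)
  also have "\<dots> = (\<Sum>a<N. \<integral>\<omega>. X (x, i, a) \<omega> * items_prod X N (?T a) \<omega> \<partial>M)"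
    using int by (intro Bochner_Integration.integral_sum) simp
  also have "\<dots> = (\<Sum>a<N. \<Sum>l<length (?T i). \<Sum>m<length (fst (?T i ! l)). of_bool (fst (?T i ! l) ! m = x) *
       ((EV (contract (?T a) l m a i) + of_bool (re \<or> i = a) * EV (contract (?T a) l m i a)) / of_nat N))"
    using one by (intro sum.cong) simp_all
  also have "\<dots> = (\<Sum>l<length (?T i). \<Sum>a<N. \<Sum>m<length (fst (?T i ! l)). of_bool (fst (?T i ! l) ! m = x) *
       ((EV (contract (?T a) l m a i) + of_bool (re \<or> i = a) * EV (contract (?T a) l m i a)) / of_nat N))"
    by (rule sum.swap)
  also have "\<dots> = (\<Sum>l<length (?T i). \<Sum>m<length (fst (?T i ! l)). \<Sum>a<N. of_bool (fst (?T i ! l) ! m = x) *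
       ((EV (contract (?T a) l m a i) + of_bool (re \<or> i = a) * EV (contract (?T a) l m i a)) / of_nat N))"
    by (intro sum.cong refl sum.swap)
  finally show ?thesis by (simp only: sum_distrib_left sum_divide_distrib)
qed

end

section \<open>Limits of products of entries, uniformly in the indices\<close>

text \<open>The joint moments of free standard semicircular elements, that is, the number of
  non-crossing pairings of equal letters. The partner of the first letter separates the letters
  enclosed from those after it, and each group is paired within itself.\<close>

fun free_moment :: "nat list \<Rightarrow> complex" where
  "free_moment [] = 1"
| "free_moment (x # w) = (\<Sum>m<length w. of_bool (w ! m = x) *
     (free_moment (take m w) * free_moment (drop (Suc m) w)))"

definition items_limit :: "(nat list \<Rightarrow> complex) \<Rightarrow> item list \<Rightarrow> complex" where
  "items_limit t T = (\<Prod>(w, i, j)\<leftarrow>T. of_bool (i = j) * t w)"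

definition words_bound :: "(nat list \<Rightarrow> complex) \<Rightarrow> nat list list \<Rightarrow> real" where
  "words_bound t ws = (\<Prod>w\<leftarrow>ws. norm (t w))"

lemma words_bound_nonneg: "0 \<le> words_bound t ws"
  by (induction ws) (simp_all add: words_bound_def)

lemma items_limit_Nil [simp]: "items_limit t [] = 1"
  by (simp add: items_limit_def)

lemma items_limit_Cons: "items_limit t ((w, i, j) # T) = of_bool (i = j) * t w * items_limit t T"
  by (simp add: items_limit_def)

lemma norm_items_limit_le: "norm (items_limit t T) \<le> words_bound t (map fst T)"
proof (induction T)
  case (Cons a T)
  obtain w i j where [simp]: "a = (w, i, j)" by (cases a) auto
  have "norm (of_bool (i = j) * t w) \<le> norm (t w)" by simp
  from mult_mono[OF this Cons] show ?case
    by (simp add: items_limit_Cons norm_mult words_bound_def)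
qed (simp add: words_bound_def)

lemma map_remove_nth: "map f (remove_nth l T) = remove_nth l (map f T)"
  by (simp add: remove_nth_def take_map drop_map)

definition contract_words :: "'x list list \<Rightarrow> nat \<Rightarrow> nat \<Rightarrow> 'x list list" where
  "contract_words ws l m = take m (ws ! l) # drop (Suc m) (ws ! l) # remove_nth l ws"

lemma map_fst_contract: "l < length T \<Longrightarrow> map fst (contract T l m b c) = contract_words (map fst T) l m"
  by (cases "T ! l") (simp add: contract_def contract_words_def map_remove_nth)

text \<open>The halves of the cut word carry the indices \<open>(i, b)\<close> and
  \<open>(c, j)\<close>, and the limit of an entry off the diagonal is 0. So the limit ties
  \<open>b\<close> to \<open>i\<close> and \<open>c\<close> to \<open>j\<close>; a summation index
  placed at such an end is pinned to one value.\<close>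

lemma norm_items_limit_contract:
  assumes "l < length T" "T ! l = (w, i, j)"
  shows "norm (items_limit t (contract T l m b c)) \<le> of_bool (b = i) * words_bound t (contract_words (map fst T) l m)"
    and "norm (items_limit t (contract T l m b c)) \<le> of_bool (c = j) * words_bound t (contract_words (map fst T) l m)"
proof -
  have c: "contract T l m b c = (take m w, i, b) # (drop (Suc m) w, c, j) # remove_nth l T"
    by (simp add: contract_def assms)
  have *: "norm (items_limit t (contract T l m b c)) \<le> words_bound t (contract_words (map fst T) l m)"
    using norm_items_limit_le[of t "contract T l m b c"] map_fst_contract[OF assms(1)] by simp
  show "norm (items_limit t (contract T l m b c)) \<le> of_bool (b = i) * words_bound t (contract_words (map fst T) l m)"
    using * by (cases "b = i") (simp_all add: c items_limit_Cons)
  show "norm (items_limit t (contract T l m b c)) \<le> of_bool (c = j) * words_bound t (contract_words (map fst T) l m)"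
    using * by (cases "c = j") (simp_all add: c items_limit_Cons)
qed

text \<open>Letters plus items. A contraction deletes a letter and creates an item, so it preserves
  this number, and the recursion lowers it by one through the removal of the first letter. Counting
  the items also makes it drop when an empty word is discarded.\<close>

definition words_size :: "'x list list \<Rightarrow> nat" where
  "words_size ws = (\<Sum>w\<leftarrow>ws. Suc (length w))"

lemma words_size_remove_nth:
  "l < length ws \<Longrightarrow> words_size ws = Suc (length (ws ! l)) + words_size (remove_nth l ws)"
proof (induction ws arbitrary: l)
  case (Cons w ws)
  then show ?case by (cases l) (simp_all add: words_size_def)
qed simp

lemma words_size_contract:
  assumes "l < length ws" "m < length (ws ! l)"
  shows "words_size (contract_words ws l m) = words_size ws"
proof -
  have "words_size (contract_words ws l m) =
      Suc m + Suc (length (ws ! l) - Suc m) + words_size (remove_nth l ws)"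
    using assms by (simp add: contract_words_def words_size_def)
  then show ?thesis using words_size_remove_nth[OF assms(1)] assms(2) by linarith
qed

lemma sum_of_bool_le:
  assumes "K \<ge> 0"
  shows "(\<Sum>a<(N::nat). of_bool (a = p) * K) \<le> (K::real)"
proof -
  have "(\<Sum>a<N. of_bool (a = p) * K) = (\<Sum>a<N. if a = p then K else 0)"
    by (rule sum.cong) auto
  then show ?thesis using assms by simp
qed

lemma norm_of_bool_mult_le: "norm (of_bool b * z) \<le> norm (z :: complex)"
  by (cases b) simp_all

lemma norm_pair_estimate:
  fixes A A' B B' Q r :: complex
  assumes r: "norm r \<le> 1" and A: "norm (A - A') \<le> \<epsilon>" "norm (A' - Q) \<le> u"
    and B: "norm (B - B') \<le> \<epsilon>" "norm B' \<le> v"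
  shows "norm (A + r * B - Q) \<le> 2 * \<epsilon> + (u + v)"
proof -
  have "norm (A + r * B - Q) = norm ((A - A') + (A' - Q) + r * B)"
    by (rule arg_cong[where f=norm]) (simp add: algebra_simps)
  also have "\<dots> \<le> norm (A - A') + norm (A' - Q) + norm (r * B)"
    by (intro norm_triangle_mono order_refl)
  also have "norm (r * B) \<le> norm B"
    using mult_right_mono[OF r, of "norm B"] by (simp add: norm_mult)
  also have "norm B \<le> norm (B - B') + norm B'"
    using norm_triangle_ineq[of "B - B'" B'] by simp
  finally show ?thesis using A B by linarith
qed

locale gauss_models =
  fixes M :: "nat \<Rightarrow> 'w measure" and X :: "nat \<Rightarrow> nat \<times> nat \<times> nat \<Rightarrow> 'w \<Rightarrow> complex"
    and k N0 :: nat and re :: bool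
  assumes model: "N \<ge> N0 \<Longrightarrow> gauss_model (M N) (X N) k N re" and N0: "N0 \<ge> 1"
begin

abbreviation EVN :: "nat \<Rightarrow> item list \<Rightarrow> complex" where
  "EVN N \<equiv> gauss_model.EV (M N) (X N) N"

text \<open>For \<open>l = 0\<close> and the first orientation, the enclosed part is
  \<open>(take m w, a, a)\<close>, whose limit is the same for every \<open>a\<close>: this is the
  planar term, and it survives the average. In all other cases the limit contains a Kronecker delta
  fixing \<open>a\<close>, so at most one of the N summands is present and the average is at most a
  constant over N. The two orientations account for the factors 2.\<close>

lemma average_contract:
  fixes w x i j T
  assumes N: "N \<ge> N0" and ok: "\<And>t. t \<in> set ((x # w, i, j) # T) \<Longrightarrow> ok_item k N t"
    and l: "l < length (w # map fst T)" and m: "m < length ((w # map fst T) ! l)"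
    and E: "\<And>S. map fst S = contract_words (w # map fst T) l m \<Longrightarrow> (\<And>t. t \<in> set S \<Longrightarrow> ok_item k N t) \<Longrightarrow>
        norm (EVN N S - items_limit free_moment S) \<le> \<epsilon>"
  shows "norm ((\<Sum>a<N. EVN N (contract ((w, a, j) # T) l m a i) +
         of_bool (re \<or> i = a) * EVN N (contract ((w, a, j) # T) l m i a)) / of_nat N -
      (if l = 0 then of_bool (i = j) * (free_moment (take m w) * free_moment (drop (Suc m) w)) *
         items_limit free_moment T else 0)) \<le> 2 * \<epsilon> + 2 * words_bound free_moment (contract_words (w # map fst T) l m) / real N"
proof -
  let ?T = "\<lambda>a. (w, a, j) # T" and ?L = "items_limit free_moment"
  let ?K = "words_bound free_moment (contract_words (w # map fst T) l m)"
  let ?Q = "if l = 0 then of_bool (i = j) * (free_moment (take m w) * free_moment (drop (Suc m) w)) * ?L T else 0"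
  have Npos: "N > 0" using N N0 by simp
  have okT: "ok_item k N t" if "t \<in> set (?T a)" "a < N" for t a
    using that ok[of t] ok[of "(x # w, i, j)"] by (auto simp: ok_item_def)
  have i: "i < N" using ok[of "(x # w, i, j)"] by (simp add: ok_item_def)
  interpret gauss_model "M N" "X N" k N re by (rule model[OF N])
  have ok_c: "ok_item k N t" if "t \<in> set (contract (?T a) l m b c)" "a < N" "b < N" "c < N" for t a b c
    by (rule ok_contract[OF okT[OF _ that(2)] _ that(3,4,1)]) (use l in simp_all)
  have fst_c: "map fst (contract (?T a) l m b c) = contract_words (w # map fst T) l m" for a b c
    using map_fst_contract[of l "?T a" m b c] l by simp
  have E': "norm (EVN N (contract (?T a) l m b c) - ?L (contract (?T a) l m b c)) \<le> \<epsilon>"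
    if "a < N" "b < N" "c < N" for a b c
    by (rule E[OF fst_c ok_c[OF _ that]])
  \<comment> \<open>The one value of \<open>a\<close> at which the limit may differ from
    \<open>?Q\<close>. For \<open>l = 0\<close> the two are equal and any value will do; otherwise
    it is the left index of item \<open>l\<close>, to which \<open>a\<close> is attached.\<close>
  obtain p1 where p1: "norm (?L (contract (?T a) l m a i) - ?Q) \<le> of_bool (a = p1) * ?K" for a
  proof (cases l)
    case 0
    have "?L (contract (?T a) l m a i) = ?Q" for a
      by (simp add: 0 contract_def items_limit_Cons mult_ac)
    then have "norm (?L (contract (?T a) l m a i) - ?Q) = 0" for a by (simp only: diff_self norm_zero)
    moreover have "0 \<le> of_bool (a = 0) * ?K" for a :: nat
      by (intro mult_nonneg_nonneg words_bound_nonneg) simp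
    ultimately show ?thesis by (intro that[of 0]) (simp only:)
  next
    case (Suc l')
    obtain u p q where e: "T ! l' = (u, p, q)" by (cases "T ! l'") auto
    have "norm (?L (contract (?T a) l m a i)) \<le> of_bool (a = p) * ?K" for a
      using norm_items_limit_contract(1)[of l "?T a" u p q free_moment m a i] l e
      by (simp only: Suc nth_Cons_Suc length_Cons Suc_less_eq list.map fst_conv length_map)
    moreover have "?Q = 0" by (simp only: Suc nat.distinct if_False)
    ultimately show ?thesis by (intro that[of p]) (simp only: diff_0_right)
  qed
  \<comment> \<open>In the second orientation \<open>a\<close> becomes the left index of the suffix,
    hence is tied to the right index of item \<open>l\<close>; for \<open>l = 0\<close> that is
    \<open>j\<close>.\<close>
  obtain p2 where p2: "norm (?L (contract (?T a) l m i a)) \<le> of_bool (a = p2) * ?K" for a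
  proof (cases l)
    case 0
    have "norm (?L (contract (?T a) l m i a)) \<le> of_bool (a = j) * ?K" for a
      using norm_items_limit_contract(2)[of l "?T a" w a j free_moment m i a] l
      by (simp only: 0 nth_Cons_0 length_Cons zero_less_Suc list.map fst_conv)
    then show ?thesis by (rule that)
  next
    case (Suc l')
    obtain u p q where e: "T ! l' = (u, p, q)" by (cases "T ! l'") auto
    have "norm (?L (contract (?T a) l m i a)) \<le> of_bool (a = q) * ?K" for a
      using norm_items_limit_contract(2)[of l "?T a" u p q free_moment m i a] l e
      by (simp only: Suc nth_Cons_Suc length_Cons Suc_less_eq list.map fst_conv length_map)
    then show ?thesis by (rule that)
  qed
  have "norm (EVN N (contract (?T a) l m a i) + of_bool (re \<or> i = a) * EVN N (contract (?T a) l m i a) - ?Q) \<le>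
     2 * \<epsilon> + (of_bool (a = p1) * ?K + of_bool (a = p2) * ?K)" if a: "a < N" for a
  proof -
    have "norm (of_bool (re \<or> i = a) :: complex) \<le> 1" by simp
    from norm_pair_estimate[OF this E'[OF a a i] p1 E'[OF a i a] p2] show ?thesis .
  qed
  then have "norm (\<Sum>a<N. (EVN N (contract (?T a) l m a i) + of_bool (re \<or> i = a) * EVN N (contract (?T a) l m i a) - ?Q)) \<le>
     (\<Sum>a<N. 2 * \<epsilon> + (of_bool (a = p1) * ?K + of_bool (a = p2) * ?K))"
    by (intro sum_norm_le) simp
  also have "\<dots> = real N * (2 * \<epsilon>) + ((\<Sum>a<N. of_bool (a = p1) * ?K) + (\<Sum>a<N. of_bool (a = p2) * ?K))"
    by (simp only: sum.distrib sum_constant card_lessThan)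
  also have "\<dots> \<le> real N * (2 * \<epsilon>) + (?K + ?K)"
    by (intro add_mono order_refl sum_of_bool_le words_bound_nonneg)
  finally have *: "norm (\<Sum>a<N. (EVN N (contract (?T a) l m a i) + of_bool (re \<or> i = a) * EVN N (contract (?T a) l m i a) - ?Q))
     \<le> real N * (2 * \<epsilon>) + (?K + ?K)" .
  have "(\<Sum>a<N. EVN N (contract (?T a) l m a i) + of_bool (re \<or> i = a) * EVN N (contract (?T a) l m i a)) / of_nat N - ?Q =
     (\<Sum>a<N. (EVN N (contract (?T a) l m a i) + of_bool (re \<or> i = a) * EVN N (contract (?T a) l m i a) - ?Q)) / of_nat N"
    using Npos unfolding sum_subtractf[of _ "\<lambda>_. ?Q"] sum_constant card_lessThan
    by (simp only: diff_divide_distrib nonzero_mult_div_cancel_left of_nat_eq_0_iff not_gr_zero)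
  also have "norm \<dots> \<le> (real N * (2 * \<epsilon>) + (?K + ?K)) / real N"
    using * Npos by (simp only: norm_divide norm_of_nat) (rule divide_right_mono, simp_all)
  also have "\<dots> = 2 * \<epsilon> + 2 * ?K / real N"
    using Npos by (simp add: add_divide_distrib)
  finally show ?thesis .
qed

text \<open>The recursion averages over a new index that runs through all N values, so convergence
  for fixed indices could not be passed through the induction. The error sequence therefore depends
  on the words alone, and the induction is on the number of letters and items.\<close>

theorem EV_uniform_limit:
  "\<exists>e. e \<longlonglongrightarrow> 0 \<and> (\<forall>N\<ge>N0. \<forall>T. map fst T = ws \<and> (\<forall>t\<in>set T. ok_item k N t) \<longrightarrow>
     norm (EVN N T - items_limit free_moment T) \<le> e N)"
proof (induction "words_size ws" arbitrary: ws rule: less_induct)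
  case less
  show ?case
  proof (cases ws)
    case Nil
    have "norm (EVN N T - items_limit free_moment T) \<le> 0" if "N \<ge> N0" "map fst T = ws" for N T
    proof -
      interpret gauss_model "M N" "X N" k N re by (rule model[OF that(1)])
      show ?thesis using that Nil by simp
    qed
    then show ?thesis by (intro exI[of _ "\<lambda>_. 0"]) auto
  next
    case (Cons w1 ws')
    show ?thesis
    proof (cases w1)
      case Nil
      have "words_size ws' < words_size ws" by (simp add: Cons words_size_def)
      from less[OF this] obtain e where e: "e \<longlonglongrightarrow> 0"
        "\<And>N T. N \<ge> N0 \<Longrightarrow> map fst T = ws' \<Longrightarrow> (\<forall>t\<in>set T. ok_item k N t) \<Longrightarrow>
          norm (EVN N T - items_limit free_moment T) \<le> e N" by blast
      have "norm (EVN N T - items_limit free_moment T) \<le> e N"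
        if le: "N \<ge> N0" and "map fst T = ws" and ok: "\<forall>t\<in>set T. ok_item k N t" for N T
      proof -
        interpret gauss_model "M N" "X N" k N re by (rule model[OF le])
        obtain i j T' where T: "T = ([], i, j) # T'" "map fst T' = ws'"
          using \<open>map fst T = ws\<close> by (auto simp: Cons Nil)
        have "norm (of_bool (i = j) * (EVN N T' - items_limit free_moment T')) \<le> norm (EVN N T' - items_limit free_moment T')"
          by simp
        also have "\<dots> \<le> e N" by (rule e(2)[OF le T(2)]) (use ok T in simp)
        finally show ?thesis by (simp add: T EV_empty_word items_limit_Cons right_diff_distrib)
      qed
      with e(1) show ?thesis by blast
    next
      case (Cons x w)
      note ws = \<open>ws = w1 # ws'\<close>[unfolded Cons]
      define vs where "vs = w # ws'"
      have "\<exists>e. l < length vs \<and> m < length (vs ! l) \<longrightarrow> e \<longlonglongrightarrow> 0 \<and>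
        (\<forall>N\<ge>N0. \<forall>T. map fst T = contract_words vs l m \<and> (\<forall>t\<in>set T. ok_item k N t) \<longrightarrow>
           norm (EVN N T - items_limit free_moment T) \<le> e N)" for l m
      proof (cases "l < length vs \<and> m < length (vs ! l)")
        case True
        then have "words_size (contract_words vs l m) < words_size ws"
          using words_size_contract[of l vs m] by (simp add: vs_def ws words_size_def)
        from less[OF this] show ?thesis by blast
      qed blast
      then obtain e where e: "\<And>l m. l < length vs \<Longrightarrow> m < length (vs ! l) \<Longrightarrow> e l m \<longlonglongrightarrow> 0"
        "\<And>l m N T. l < length vs \<Longrightarrow> m < length (vs ! l) \<Longrightarrow> N \<ge> N0 \<Longrightarrow> map fst T = contract_words vs l m \<Longrightarrow>
          (\<forall>t\<in>set T. ok_item k N t) \<Longrightarrow> norm (EVN N T - items_limit free_moment T) \<le> e l m N"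
        by metis
      \<comment> \<open>The number of pairs \<open>(l, m)\<close> depends on the words only, so the
        errors of the single averages add up to a null sequence.\<close>
      define E where "E = (\<lambda>N. \<Sum>l<length vs. \<Sum>m<length (vs ! l).
        2 * e l m N + 2 * words_bound free_moment (contract_words vs l m) / real N)"
      have "E \<longlonglongrightarrow> (\<Sum>l<length vs. \<Sum>m<length (vs ! l). 2 * 0 + 0)"
        unfolding E_def
        by (intro tendsto_sum tendsto_add tendsto_mult tendsto_const e(1)
            real_tendsto_divide_at_top[OF tendsto_const filterlim_real_sequentially]) simp_all
      then have E0: "E \<longlonglongrightarrow> 0" by simp
      have bound: "norm (EVN N T - items_limit free_moment T) \<le> E N"
        if le: "N \<ge> N0" and "map fst T = ws" and ok: "\<forall>t\<in>set T. ok_item k N t" for N T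
      proof -
        interpret gauss_model "M N" "X N" k N re by (rule model[OF le])
        obtain i j T' where T: "T = (x # w, i, j) # T'" "map fst T' = ws'"
          using \<open>map fst T = ws\<close> by (auto simp: ws)
        have ok': "ok_item k N t" if "t \<in> set ((x # w, i, j) # T')" for t
          using ok that unfolding T by blast
        let ?P = "\<lambda>l m. (\<Sum>a<N. EVN N (contract ((w, a, j) # T') l m a i) +
             of_bool (re \<or> i = a) * EVN N (contract ((w, a, j) # T') l m i a)) / of_nat N"
        let ?Q = "\<lambda>(l :: nat) m. if l = 0 then of_bool (i = j) * (free_moment (take m w) * free_moment (drop (Suc m) w)) *
             items_limit free_moment T' else 0"
        have vs: "fst (((w, i, j) # T') ! l) = vs ! l" if "l < length vs" for l
          using that T(2) by (cases l) (auto simp: vs_def)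
        have len: "length ((w, i, j) # T') = length vs"
          using T(2) by (auto simp: vs_def)
        have "EVN N T = (\<Sum>l<length ((w, i, j) # T'). \<Sum>m<length (fst (((w, i, j) # T') ! l)).
            of_bool (fst (((w, i, j) # T') ! l) ! m = x) * ?P l m)"
          unfolding T(1) by (rule EV_rec[OF ok'])
        also have "\<dots> = (\<Sum>l<length vs. \<Sum>m<length (vs ! l). of_bool (vs ! l ! m = x) * ?P l m)"
          unfolding len by (rule sum.cong[OF refl]) (simp only: vs lessThan_iff)
        finally have 1: "EVN N T = (\<Sum>l<length vs. \<Sum>m<length (vs ! l). of_bool (vs ! l ! m = x) * ?P l m)" .
        \<comment> \<open>The recursion of \<open>free_moment\<close> pairs the first letter within
          its own word. It is brought into the shape of Wick's recursion by adding the later items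
          with value 0.\<close>
        have "items_limit free_moment T = (\<Sum>m<length w. of_bool (w ! m = x) * ?Q 0 m)"
          unfolding T(1) items_limit_Cons free_moment.simps
          by (simp only: sum_distrib_left sum_distrib_right if_True mult_ac simp_thms)
        also have "\<dots> = (\<Sum>l<length vs. \<Sum>m<length (vs ! l). of_bool (vs ! l ! m = x) * ?Q l m)"
          unfolding vs_def sum_nth_Cons by (simp del: sum_of_bool_mult_eq)
        finally have 2: "items_limit free_moment T =
            (\<Sum>l<length vs. \<Sum>m<length (vs ! l). of_bool (vs ! l ! m = x) * ?Q l m)" .
        have 3: "EVN N T - items_limit free_moment T =
            (\<Sum>l<length vs. \<Sum>m<length (vs ! l). of_bool (vs ! l ! m = x) * (?P l m - ?Q l m))"
          unfolding 1 2 by (simp only: sum_subtractf right_diff_distrib)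
        show ?thesis unfolding 3 E_def
        proof (intro sum_norm_le)
          fix l m assume "l \<in> {..<length vs}" "m \<in> {..<length (vs ! l)}"
          then have lm: "l < length vs" "m < length (vs ! l)" by simp_all
          have "norm (of_bool (vs ! l ! m = x) * (?P l m - ?Q l m)) \<le> norm (?P l m - ?Q l m)"
            by (rule norm_of_bool_mult_le)
          also have "\<dots> \<le> 2 * e l m N + 2 * words_bound free_moment (contract_words vs l m) / real N"
          proof -
            have vs': "vs = w # map fst T'" by (simp only: T(2) vs_def)
            have E: "norm (EVN N S - items_limit free_moment S) \<le> e l m N"
              if "map fst S = contract_words (w # map fst T') l m" "\<And>t. t \<in> set S \<Longrightarrow> ok_item k N t" for S
            proof (rule e(2)[OF lm le])
              show "map fst S = contract_words vs l m" unfolding vs' by (rule that(1))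
              show "\<forall>t\<in>set S. ok_item k N t" using that(2) ..
            qed
            show ?thesis unfolding vs'
              by (rule average_contract[OF le ok']) (assumption | rule lm[unfolded vs'] E)+
          qed
          finally show "norm (of_bool (vs ! l ! m = x) * (?P l m - ?Q l m)) \<le>
            2 * e l m N + 2 * words_bound free_moment (contract_words vs l m) / real N" .
        qed
      qed
      have "E \<longlonglongrightarrow> 0 \<and> (\<forall>N\<ge>N0. \<forall>T. map fst T = ws \<and> (\<forall>t\<in>set T. ok_item k N t) \<longrightarrow>
        norm (EVN N T - items_limit free_moment T) \<le> E N)"
      proof (rule conjI[OF E0], intro allI impI)
        fix N T assume le: "N \<ge> N0" and *: "map fst T = ws \<and> (\<forall>t\<in>set T. ok_item k N t)"
        show "norm (EVN N T - items_limit free_moment T) \<le> E N"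
          by (rule bound[OF le *[THEN conjunct1] *[THEN conjunct2]])
      qed
      then show ?thesis by (rule exI[where x=E])
    qed
  qed
qed

end

section \<open>Expansions in the matrix size\<close>

lemma power_quotient_tendsto:
  assumes "i \<le> n"
  shows "(\<lambda>N. of_nat N ^ i / of_nat N ^ n) \<longlonglongrightarrow> (of_bool (i = n) :: complex)"
proof -
  have "(\<lambda>N. (inverse (of_nat N) :: complex) ^ (n - i)) \<longlonglongrightarrow> 0 ^ (n - i)"
    by (intro tendsto_power lim_inverse_n)
  also have "(0 :: complex) ^ (n - i) = of_bool (i = n)"
    using assms by (simp add: power_0_left)
  finally show ?thesis
  proof (rule Lim_transform_eventually)
    show "\<forall>\<^sub>F N in sequentially. (inverse (of_nat N) :: complex) ^ (n - i) = of_nat N ^ i / of_nat N ^ n"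
      using eventually_gt_at_top[of 0]
    proof eventually_elim
      case (elim N)
      have "(of_nat N :: complex) ^ n = of_nat N ^ i * of_nat N ^ (n - i)"
        using assms by (simp flip: power_add)
      then show ?case using elim by (simp add: field_simps power_inverse)
    qed
  qed
qed

lemma poly_quotient_tendsto:
  fixes p :: "complex poly"
  assumes "degree p \<le> n"
  shows "(\<lambda>N. poly p (of_nat N) / of_nat N ^ n) \<longlonglongrightarrow> coeff p n"
proof -
  have "(\<lambda>N. \<Sum>i\<le>n. coeff p i * (of_nat N ^ i / of_nat N ^ n)) \<longlonglongrightarrow> (\<Sum>i\<le>n. coeff p i * of_bool (i = n))"
    by (intro tendsto_sum tendsto_mult tendsto_const power_quotient_tendsto) simp
  moreover have "(\<Sum>i\<le>n. coeff p i * of_bool (i = n)) = coeff p n"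
    by (subst sum.remove[of _ n]) auto
  moreover have "poly p (of_nat N) / of_nat N ^ n = (\<Sum>i\<le>n. coeff p i * (of_nat N ^ i / of_nat N ^ n))" for N
  proof -
    have "poly p (of_nat N) = (\<Sum>i\<le>n. coeff p i * of_nat N ^ i)"
      unfolding poly_altdef using assms
      by (intro sum.mono_neutral_left) (auto simp: coeff_eq_0)
    then show ?thesis by (simp add: sum_divide_distrib)
  qed
  ultimately show ?thesis by simp
qed

text \<open>If the degree exceeded \<open>n\<close>, dividing by the power of N with exponent
  \<open>degree p\<close> would give the limit 0 by comparison with the assumed limit, but this
  limit is the leading coefficient.\<close>

lemma poly_quotient_convergent_imp_degree_le:
  fixes p :: "complex poly"
  assumes "(\<lambda>N. poly p (of_nat N) / of_nat N ^ n) \<longlonglongrightarrow> L"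
  shows "degree p \<le> n"
proof (rule ccontr)
  assume "\<not> degree p \<le> n"
  then have d: "n < degree p" by simp
  have "(\<lambda>N. poly p (of_nat N) / of_nat N ^ n * (of_nat N ^ n / of_nat N ^ degree p)) \<longlonglongrightarrow> L * of_bool (n = degree p)"
    by (intro tendsto_mult assms power_quotient_tendsto) (use d in simp)
  then have "(\<lambda>N. poly p (of_nat N) / of_nat N ^ degree p) \<longlonglongrightarrow> L * of_bool (n = degree p)"
  proof (rule Lim_transform_eventually)
    show "\<forall>\<^sub>F N in sequentially. poly p (of_nat N) / of_nat N ^ n * (of_nat N ^ n / of_nat N ^ degree p) =
        poly p (of_nat N) / of_nat N ^ degree p"
      using eventually_gt_at_top[of 0] by eventually_elim simp
  qed
  then have "coeff p (degree p) = 0"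
    using d LIMSEQ_unique[OF poly_quotient_tendsto[OF order_refl, of p]] by auto
  with d show False by simp
qed

text \<open>A Laurent polynomial is a quotient of a polynomial by some N^D. Convergence of
  \<open>F N / N\<close> bounds the degree by D + 1 and identifies the coefficient of that degree
  with \<open>L0\<close>; subtracting N times \<open>L0\<close> cancels it, and the remaining
  quotient has numerator of degree at most D.\<close>

lemma laurent_convergent:
  fixes F :: "nat \<Rightarrow> complex"
  assumes F: "\<And>N. N \<ge> N0 \<Longrightarrow> F N = (\<Sum>(c, z)\<leftarrow>L. c * of_nat N powi z)"
    and L0: "(\<lambda>N. F N / of_nat N) \<longlonglongrightarrow> L0"
  shows "convergent (\<lambda>N. F N - of_nat N * L0)"
proof -
  have "\<exists>p D. \<forall>N>0. (\<Sum>(c, z)\<leftarrow>L. c * (of_nat N :: complex) powi z) = poly p (of_nat N) / of_nat N ^ D"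
  proof (induction L)
    case Nil
    show ?case by (rule exI[of _ 0]) simp
  next
    case (Cons a L)
    obtain c z where a: "a = (c, z)" by (cases a)
    from Cons obtain p D where pD: "\<And>N. N > 0 \<Longrightarrow> (\<Sum>(c, z)\<leftarrow>L. c * (of_nat N :: complex) powi z) = poly p (of_nat N) / of_nat N ^ D"
      by blast
    \<comment> \<open>Only one of \<open>nat z\<close> and \<open>nat (- z)\<close> is nonzero: a
      positive exponent goes into the numerator, a negative one enlarges the common
      denominator.\<close>
    let ?q = "monom c (nat z + D) + p * monom 1 (nat (- z))" and ?E = "D + nat (- z)"
    have "(\<Sum>(c, z)\<leftarrow>a # L. c * (of_nat N :: complex) powi z) = poly ?q (of_nat N) / of_nat N ^ ?E" if "N > 0" for N
    proof -
      have "c * (of_nat N :: complex) powi z = c * of_nat N ^ nat z / of_nat N ^ nat (- z)"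
        by (cases "z \<ge> 0") (simp_all add: power_int_def power_inverse divide_inverse)
      then have "(\<Sum>(c, z)\<leftarrow>a # L. c * (of_nat N :: complex) powi z) =
          c * of_nat N ^ nat z / of_nat N ^ nat (- z) + poly p (of_nat N) / of_nat N ^ D"
        using pD[OF that] by (simp add: a)
      then show ?thesis using that by (simp add: poly_monom field_simps power_add)
    qed
    then show ?case by blast
  qed
  then obtain p D where p: "\<And>N. N > 0 \<Longrightarrow> (\<Sum>(c, z)\<leftarrow>L. c * (of_nat N :: complex) powi z) = poly p (of_nat N) / of_nat N ^ D"
    by blast
  have ev: "\<forall>\<^sub>F N in sequentially. N > 0 \<and> F N = poly p (of_nat N) / of_nat N ^ D"
    using eventually_gt_at_top[of 0] eventually_ge_at_top[of N0]
    by eventually_elim (simp add: F p)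
  from L0 have lim: "(\<lambda>N. poly p (of_nat N) / of_nat N ^ Suc D) \<longlonglongrightarrow> L0"
    by (rule Lim_transform_eventually) (use ev in eventually_elim, simp add: mult.commute)
  then have deg: "degree p \<le> Suc D" by (rule poly_quotient_convergent_imp_degree_le)
  have c: "coeff p (Suc D) = L0"
    by (rule LIMSEQ_unique[OF poly_quotient_tendsto[OF deg] lim])
  define q where "q = p - monom L0 (Suc D)"
  have "degree q \<le> Suc D"
    unfolding q_def by (intro degree_diff_le deg degree_monom_le)
  moreover have "coeff q (Suc D) = 0" by (simp add: q_def c)
  ultimately have "degree q \<le> D"
    by (metis degree_0 eq_zero_or_degree_less less_Suc_eq_le zero_le)
  then have "(\<lambda>N. poly q (of_nat N) / of_nat N ^ D) \<longlonglongrightarrow> coeff q D"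
    by (rule poly_quotient_tendsto)
  then have "(\<lambda>N. F N - of_nat N * L0) \<longlonglongrightarrow> coeff q D"
  proof (rule Lim_transform_eventually)
    show "\<forall>\<^sub>F N in sequentially. poly q (of_nat N) / of_nat N ^ D = F N - of_nat N * L0"
      using ev by eventually_elim (simp add: q_def poly_monom field_simps)
  qed
  then show ?thesis by (rule convergentI)
qed

section \<open>Symbolic sums of Kronecker deltas\<close>

text \<open>Matrix indices are represented by labels, and \<open>f\<close> gives their values. A
  list of pairs of labels is a product of Kronecker deltas that can be written down once for all
  sizes N.\<close>

definition deltas :: "(nat \<times> nat) list \<Rightarrow> (nat \<Rightarrow> nat) \<Rightarrow> complex" where
  "deltas P f = (\<Prod>(s, t)\<leftarrow>P. of_bool (f s = f t))"

lemma deltas_simps [simp]: "deltas [] f = 1" "deltas ((s, t) # P) f = of_bool (f s = f t) * deltas P f"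
  by (simp_all add: deltas_def)

lemma deltas_append: "deltas (P @ Q) f = deltas P f * deltas Q f"
  by (simp add: deltas_def)

inductive laurent_sum :: "(nat \<Rightarrow> (nat \<Rightarrow> nat) \<Rightarrow> complex) \<Rightarrow> bool" where
  laurent_sum_mono: "laurent_sum (\<lambda>N f. c * of_nat N powi z * deltas P f)"
| laurent_sum_add: "laurent_sum g \<Longrightarrow> laurent_sum h \<Longrightarrow> laurent_sum (\<lambda>N f. g N f + h N f)"

text \<open>For large N, one fixed combination of Kronecker deltas with Laurent monomials in N as
  coefficients. The values of the labels lie below N, so that a sum over all values of one label
  meets the values of all others.\<close>

definition laurent_deltas :: "(nat \<Rightarrow> (nat \<Rightarrow> nat) \<Rightarrow> complex) \<Rightarrow> bool" where
  "laurent_deltas g \<longleftrightarrow> (\<exists>N1 h. laurent_sum h \<and> (\<forall>N\<ge>N1. \<forall>f. (\<forall>x. f x < N) \<longrightarrow> g N f = h N f))"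

lemma deltas_fun_upd: "deltas P (f(a := f b)) = deltas (map (\<lambda>(s, t). (if s = a then b else s, if t = a then b else t)) P) f"
  by (induction P) auto

lemma deltas_unrelated:
  assumes "\<forall>(s, t)\<in>set P. s = a \<longleftrightarrow> t = a"
  shows "deltas P (f(a := x)) = deltas P f"
  using assms by (induction P) auto

lemma deltas_pair: "(s, t) \<in> set P \<Longrightarrow> f s \<noteq> f t \<Longrightarrow> deltas P f = 0"
  by (induction P) auto

text \<open>A delta ties \<open>a\<close> to another label \<open>b\<close>, so the sum over the
  values of \<open>a\<close> has a single nonzero term, and its effect is to substitute
  \<open>b\<close> for \<open>a\<close>.\<close>

lemma sum_deltas:
  assumes f: "\<And>x. f x < N" and b: "b \<noteq> a" "(a, b) \<in> set P \<or> (b, a) \<in> set P"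
  shows "(\<Sum>x<N. deltas P (f(a := x))) =
    deltas (map (\<lambda>(s, t). (if s = a then b else s, if t = a then b else t)) P) f"
proof -
  have z: "deltas P (f(a := x)) = 0" if "x \<noteq> f b" for x
    using b deltas_pair[of a b P "f(a := x)"] deltas_pair[of b a P "f(a := x)"] that by auto
  have "(\<Sum>x<N. deltas P (f(a := x))) = deltas P (f(a := f b))"
    using f[of b] z by (subst sum.remove[of _ "f b"]) (auto intro!: sum.neutral)
  then show ?thesis by (simp only: deltas_fun_upd)
qed

lemma laurent_deltas_mono: "laurent_deltas (\<lambda>N f. c * of_nat N powi z * deltas P f)"
  unfolding laurent_deltas_def using laurent_sum_mono by blast

lemma laurent_deltas_add:
  assumes "laurent_deltas g" "laurent_deltas h"
  shows "laurent_deltas (\<lambda>N f. g N f + h N f)"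
proof -
  from assms obtain N1 g' N2 h' where "laurent_sum g'" "laurent_sum h'"
    and g: "\<And>N f. N \<ge> N1 \<Longrightarrow> \<forall>x. f x < N \<Longrightarrow> g N f = g' N f"
    and h: "\<And>N f. N \<ge> N2 \<Longrightarrow> \<forall>x. f x < N \<Longrightarrow> h N f = h' N f"
    unfolding laurent_deltas_def by metis
  then have "laurent_sum (\<lambda>N f. g' N f + h' N f)" by (intro laurent_sum_add)
  then show ?thesis unfolding laurent_deltas_def
    by (intro exI[of _ "max N1 N2"] exI[of _ "\<lambda>N f. g' N f + h' N f"]) (auto simp: g h)
qed

lemma laurent_deltas_zero: "laurent_deltas (\<lambda>N f. 0)"
  using laurent_deltas_mono[of 0 0 "[]"] by simp

lemma laurent_deltas_sum:
  assumes "\<And>i. i \<in> I \<Longrightarrow> laurent_deltas (g i)"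
  shows "laurent_deltas (\<lambda>N f. \<Sum>i\<in>I. g i N f)"
  using assms
proof (induction I rule: infinite_finite_induct)
  case (insert x F)
  then have "laurent_deltas (\<lambda>N f. g x N f + (\<Sum>i\<in>F. g i N f))" by (intro laurent_deltas_add) auto
  with insert show ?case by simp
qed (simp_all add: laurent_deltas_zero)

lemma laurent_deltas_cong:
  assumes "laurent_deltas g" "\<And>N f. N \<ge> N1 \<Longrightarrow> (\<And>x. f x < N) \<Longrightarrow> h N f = g N f"
  shows "laurent_deltas h"
proof -
  from assms(1) obtain N2 g' where "laurent_sum g'"
    and g: "\<And>N f. N \<ge> N2 \<Longrightarrow> \<forall>x. f x < N \<Longrightarrow> g N f = g' N f"
    unfolding laurent_deltas_def by metis
  then show ?thesis unfolding laurent_deltas_def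
    by (intro exI[of _ "max N1 N2"] exI[of _ g']) (auto simp: assms(2))
qed

lemma laurent_deltas_mult_mono:
  assumes "laurent_deltas g"
  shows "laurent_deltas (\<lambda>N f. c * of_nat N powi z * deltas P f * g N f)"
proof -
  from assms obtain N1 g' where g': "laurent_sum g'"
    and g: "\<And>N f. N \<ge> N1 \<Longrightarrow> \<forall>x. f x < N \<Longrightarrow> g N f = g' N f"
    unfolding laurent_deltas_def by metis
  from g' have "laurent_deltas (\<lambda>N f. c * of_nat N powi z * deltas P f * g' N f)"
  proof induction
    case (laurent_sum_mono c' z' P')
    have "laurent_deltas (\<lambda>N f. (c * c') * of_nat N powi (z + z') * deltas (P @ P') f)"
      by (rule laurent_deltas_mono)
    then show ?case
      by (rule laurent_deltas_cong[where ?N1.0=1]) (simp add: power_int_add deltas_append mult_ac)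
  next
    case (laurent_sum_add g h)
    from laurent_deltas_add[OF laurent_sum_add.IH] show ?case by (simp add: distrib_left)
  qed
  then show ?thesis by (rule laurent_deltas_cong[where ?N1.0=N1]) (simp add: g)
qed

text \<open>Either the label \<open>a\<close> occurs in no pair with a different label, and the sum
  contributes a factor N, or it is tied to another label and gets replaced by it. In both cases a
  Laurent monomial times deltas results.\<close>

lemma laurent_deltas_sum_label:
  assumes "laurent_deltas g"
  shows "laurent_deltas (\<lambda>N f. \<Sum>x<N. g N (f(a := x)))"
proof -
  from assms obtain N1 g' where g': "laurent_sum g'"
    and g: "\<And>N f. N \<ge> N1 \<Longrightarrow> \<forall>x. f x < N \<Longrightarrow> g N f = g' N f"
    unfolding laurent_deltas_def by metis
  from g' have "laurent_deltas (\<lambda>N f. \<Sum>x<N. g' N (f(a := x)))"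
  proof induction
    case (laurent_sum_mono c z P)
    show ?case
    proof (cases "\<forall>(s, t)\<in>set P. s = a \<longleftrightarrow> t = a")
      case True
      have "laurent_deltas (\<lambda>N f. c * of_nat N powi (z + 1) * deltas P f)" by (rule laurent_deltas_mono)
      then show ?thesis
        by (rule laurent_deltas_cong[where ?N1.0=1])
          (simp only: deltas_unrelated[OF True], simp add: power_int_add)
    next
      case False
      then obtain b where b: "b \<noteq> a" "(a, b) \<in> set P \<or> (b, a) \<in> set P" by auto
      have "laurent_deltas (\<lambda>N f. c * of_nat N powi z *
          deltas (map (\<lambda>(s, t). (if s = a then b else s, if t = a then b else t)) P) f)"
        by (rule laurent_deltas_mono)
      then show ?thesis
        by (rule laurent_deltas_cong[where ?N1.0=1])
          (simp only: sum_distrib_left[symmetric] sum_deltas[OF _ b])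
    qed
  next
    case (laurent_sum_add g h)
    from laurent_deltas_add[OF laurent_sum_add.IH] show ?case by (simp add: sum.distrib)
  qed
  then show ?thesis by (rule laurent_deltas_cong[where ?N1.0=N1]) (auto intro!: sum.cong g)
qed

lemma laurent_deltas_const:
  assumes "laurent_deltas g"
  shows "\<exists>L N1. \<forall>N\<ge>N1. g N (\<lambda>_. 0) = (\<Sum>(c, z)\<leftarrow>L. c * of_nat N powi z)"
proof -
  from assms obtain N1 g' where g': "laurent_sum g'"
    and g: "\<And>N f. N \<ge> N1 \<Longrightarrow> \<forall>x. f x < N \<Longrightarrow> g N f = g' N f"
    unfolding laurent_deltas_def by metis
  from g' have "\<exists>L. \<forall>N. g' N (\<lambda>_. 0) = (\<Sum>(c, z)\<leftarrow>L. c * of_nat N powi z)"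
  proof induction
    case (laurent_sum_mono c z P)
    have "deltas P (\<lambda>_. 0) = 1" by (induction P) auto
    then show ?case by (intro exI[of _ "[(c, z)]"]) simp
  next
    case (laurent_sum_add g h)
    then obtain L1 L2 where "\<forall>N. g N (\<lambda>_. 0) = (\<Sum>(c, z)\<leftarrow>L1. c * of_nat N powi z)"
      "\<forall>N. h N (\<lambda>_. 0) = (\<Sum>(c, z)\<leftarrow>L2. c * of_nat N powi z)" by blast
    then show ?case by (intro exI[of _ "L1 @ L2"]) simp
  qed
  then obtain L where L: "\<And>N. g' N (\<lambda>_. 0) = (\<Sum>(c, z)\<leftarrow>L. c * of_nat N powi z)" by blast
  \<comment> \<open>The constant valuation 0 makes every delta equal to 1; it takes values below N
    only from \<open>N = 1\<close> on.\<close>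
  show ?thesis
    by (rule exI[where x=L], rule exI[where x="max 1 N1"]) (simp add: g L)
qed

section \<open>Gaussian expectations as Laurent polynomials in the matrix size\<close>

definition label_items :: "(nat \<Rightarrow> nat) \<Rightarrow> item list \<Rightarrow> item list" where
  "label_items f = map (\<lambda>(w, s, t). (w, f s, f t))"

lemma contract_label_items:
  assumes "l < length T"
  shows "contract (label_items f T) l m (f b) (f c) = label_items f (contract T l m b c)"
  using assms by (cases "T ! l") (simp add: contract_def label_items_def map_remove_nth)

lemma fst_nth_label_items: "l < length T \<Longrightarrow> fst (label_items f T ! l) = fst (T ! l)"
  by (simp add: label_items_def case_prod_unfold)

context gauss_models
begin

text \<open>Wick's recursion is carried out on labels instead of index values: the factor 1/N is a
  Laurent monomial, the restriction of the twisted orientation is a delta, and the new summation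
  index is a label that is summed out.\<close>

theorem laurent_deltas_EV:
  assumes "\<And>w. w \<in> set (map fst T) \<Longrightarrow> set w \<subseteq> {..<k}"
  shows "laurent_deltas (\<lambda>N f. EVN N (label_items f T))"
  using assms
proof (induction "words_size (map fst T)" arbitrary: T rule: less_induct)
  case less
  show ?case
  proof (cases T)
    case Nil
    show ?thesis
    proof (rule laurent_deltas_cong[OF laurent_deltas_mono[of 1 0 "[]"], where ?N1.0=N0])
      fix N and f :: "nat \<Rightarrow> nat" assume "N \<ge> N0"
      then interpret gauss_model "M N" "X N" k N re by (rule model)
      show "EVN N (label_items f T) = 1 * of_nat N powi 0 * deltas [] f" by (simp add: label_items_def Nil)
    qed
  next
    case (Cons t1 T')
    obtain w1 s t where t1: "t1 = (w1, s, t)" by (cases t1)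
    show ?thesis
    proof (cases w1)
      case Nil
      have "words_size (map fst T') < words_size (map fst T)" by (simp add: Cons words_size_def)
      then have "laurent_deltas (\<lambda>N f. EVN N (label_items f T'))"
        by (rule less.hyps) (use less.prems in \<open>simp add: Cons\<close>)
      from laurent_deltas_mult_mono[OF this, of 1 0 "[(s, t)]"]
      show ?thesis
      proof (rule laurent_deltas_cong[where ?N1.0=N0])
        fix N and f :: "nat \<Rightarrow> nat" assume "N \<ge> N0"
        then interpret gauss_model "M N" "X N" k N re by (rule model)
        show "EVN N (label_items f T) = 1 * of_nat N powi 0 * deltas [(s, t)] f * EVN N (label_items f T')"
          by (simp add: label_items_def Cons t1 Nil EV_empty_word)
      qed
    next
      case (Cons x w)
      note T = \<open>T = t1 # T'\<close>[unfolded t1 Cons]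
      \<comment> \<open>A label occurring in no item names the new summation index, so changing its
        value leaves the indices of all given items unchanged.\<close>
      obtain a where a: "a \<notin> {s, t} \<union> (\<Union>(w, s, t)\<in>set T'. {s, t})"
        using ex_new_if_finite[of "{s, t} \<union> (\<Union>(w, s, t)\<in>set T'. {s, t})"] by (auto simp: case_prod_unfold)
      let ?V = "(w, a, t) # T'"
      have lab: "label_items (f(a := x)) T' = label_items f T'" for f x
        unfolding label_items_def by (rule map_cong) (use a in auto)
      have ok: "set u \<subseteq> {..<k}" if "u \<in> set (map fst T)" for u using less.prems that .
      have IH: "laurent_deltas (\<lambda>N f. EVN N (label_items f (contract ?V l m b c)))"
        if lm: "l < length ?V" "m < length (fst (?V ! l))" for l m b c
      proof (rule less.hyps)
        have 1: "map fst (contract ?V l m b c) = contract_words (map fst ?V) l m" by (rule map_fst_contract[OF lm(1)])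
        have "l < length (map fst ?V)" "m < length (map fst ?V ! l)"
          using lm by (simp_all only: length_map nth_map)
        from words_size_contract[OF this] show "words_size (map fst (contract ?V l m b c)) < words_size (map fst T)"
          unfolding 1 by (simp add: T words_size_def)
        obtain u p q where e: "?V ! l = (u, p, q)" by (cases "?V ! l")
        have V: "set v \<subseteq> {..<k}" if "v \<in> set (map fst ?V)" for v
          using that ok[of v] ok[of "x # w"] by (auto simp: T)
        have "u \<in> set (map fst ?V)" using nth_mem[OF lm(1)] unfolding e by force
        then have u: "set u \<subseteq> {..<k}" by (rule V)
        fix v assume "v \<in> set (map fst (contract ?V l m b c))"
        then have "v = take m u \<or> v = drop (Suc m) u \<or> v \<in> set (remove_nth l (map fst ?V))"
          unfolding contract_def e by (simp add: map_remove_nth)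
        then show "set v \<subseteq> {..<k}"
          using u V[of v] set_remove_nth[of l "map fst ?V"] set_take_subset[of m u] set_drop_subset[of "Suc m" u]
          by (elim disjE) blast+
      qed
      let ?G = "\<lambda>l m N f. \<Sum>y<N. EVN N (label_items (f(a := y)) (contract ?V l m a s))"
      let ?H = "\<lambda>l m N f. \<Sum>y<N. deltas (if re then [] else [(s, a)]) (f(a := y)) * EVN N (label_items (f(a := y)) (contract ?V l m s a))"
      have "laurent_deltas (\<lambda>N f. \<Sum>l<length ?V. \<Sum>m<length (fst (?V ! l)).
          of_bool (fst (?V ! l) ! m = x) * of_nat N powi (-1) * deltas [] f * (?G l m N f + ?H l m N f))"
      proof (intro laurent_deltas_sum laurent_deltas_mult_mono laurent_deltas_add)
        fix l m assume "l \<in> {..<length ?V}" "m \<in> {..<length (fst (?V ! l))}"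
        then have lm: "l < length ?V" "m < length (fst (?V ! l))" by simp_all
        show "laurent_deltas (?G l m)" by (rule laurent_deltas_sum_label[OF IH[OF lm]])
        from laurent_deltas_mult_mono[OF IH[OF lm, of s a], of 1 0 "if re then [] else [(s, a)]"]
        have "laurent_deltas (\<lambda>N f. deltas (if re then [] else [(s, a)]) f * EVN N (label_items f (contract ?V l m s a)))"
          by simp
        then show "laurent_deltas (?H l m)" by (rule laurent_deltas_sum_label)
      qed
      then show ?thesis
      proof (rule laurent_deltas_cong[where ?N1.0=N0])
        fix N and f :: "nat \<Rightarrow> nat" assume le: "N \<ge> N0" and f: "\<And>x. f x < N"
        interpret gauss_model "M N" "X N" k N re by (rule model[OF le])
        let ?W = "\<lambda>y. (w, y, f t) # label_items f T'"
        have okT: "ok_item k N u" if u: "u \<in> set ((x # w, f s, f t) # label_items f T')" for u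
        proof -
          have "u \<in> (\<lambda>(w, s, t). (w, f s, f t)) ` set T" using u by (simp add: T label_items_def)
          then obtain v p q where "(v, p, q) \<in> set T" "u = (v, f p, f q)" by force
          moreover from this(1) have "set v \<subseteq> {..<k}" by (intro ok) force
          ultimately show ?thesis using f by (simp add: ok_item_def)
        qed
        have W: "?W y = label_items (f(a := y)) ?V" for y
          using a lab[of f y] by (simp add: label_items_def)
        have len: "length (?W y) = length ?V" for y by (simp add: label_items_def)
        have fstW: "fst (?W y ! l) = fst (?V ! l)" if "l < length ?V" for y l
          unfolding W by (rule fst_nth_label_items[OF that])
        have as: "a \<noteq> s" using a by simp
        have c1: "contract (?W y) l m y (f s) = label_items (f(a := y)) (contract ?V l m a s)" if "l < length ?V" for y l m
          unfolding W using contract_label_items[OF that, of "f(a := y)" m a s] as by simp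
        have c2: "contract (?W y) l m (f s) y = label_items (f(a := y)) (contract ?V l m s a)" if "l < length ?V" for y l m
          unfolding W using contract_label_items[OF that, of "f(a := y)" m s a] as by simp
        \<comment> \<open>In the real case the twisted orientation is always present; in the complex
          case it occurs only on the diagonal, which is a delta between \<open>s\<close> and the new
          label.\<close>
        have d: "of_bool (re \<or> f s = y) = deltas (if re then [] else [(s, a)]) (f(a := y))" for y
          using as by simp
        have "EVN N (label_items f T) = EVN N ((x # w, f s, f t) # label_items f T')"
          by (simp add: T label_items_def)
        also have "\<dots> = (\<Sum>l<length (?W (f s)). \<Sum>m<length (fst (?W (f s) ! l)). of_bool (fst (?W (f s) ! l) ! m = x) *
            ((\<Sum>y<N. EVN N (contract (?W y) l m y (f s)) + of_bool (re \<or> f s = y) * EVN N (contract (?W y) l m (f s) y)) / of_nat N))"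
          by (rule EV_rec[OF okT])
        also have "\<dots> = (\<Sum>l<length ?V. \<Sum>m<length (fst (?V ! l)).
          of_bool (fst (?V ! l) ! m = x) * of_nat N powi (-1) * deltas [] f * (?G l m N f + ?H l m N f))"
          unfolding len
        proof (rule sum.cong[OF refl])
          fix l assume "l \<in> {..<length ?V}"
          then have l: "l < length ?V" by simp
          show "(\<Sum>m<length (fst (?W (f s) ! l)). of_bool (fst (?W (f s) ! l) ! m = x) *
            ((\<Sum>y<N. EVN N (contract (?W y) l m y (f s)) + of_bool (re \<or> f s = y) * EVN N (contract (?W y) l m (f s) y)) / of_nat N)) =
            (\<Sum>m<length (fst (?V ! l)).
              of_bool (fst (?V ! l) ! m = x) * of_nat N powi (-1) * deltas [] f * (?G l m N f + ?H l m N f))"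
            unfolding fstW[OF l] c1[OF l] c2[OF l] d sum.distrib deltas_simps power_int_minus power_int_1_right
              mult_1_right divide_inverse
            by (simp only: mult_ac)
        qed
        finally show "EVN N (label_items f T) = (\<Sum>l<length ?V. \<Sum>m<length (fst (?V ! l)).
          of_bool (fst (?V ! l) ! m = x) * of_nat N powi (-1) * deltas [] f * (?G l m N f + ?H l m N f))" .
      qed
    qed
  qed
qed

text \<open>Each diagonal entry has expectation within \<open>e N\<close> of
  \<open>free_moment w\<close>, with an error independent of the index, so the average over the
  diagonal inherits the error.\<close>

theorem trace_moment_limit:
  assumes w: "set w \<subseteq> {..<k}"
  shows "(\<lambda>N. (\<Sum>i<N. EVN N [(w, i, i)]) / of_nat N) \<longlonglongrightarrow> free_moment w"
proof -
  obtain e where *: "e \<longlonglongrightarrow> 0 \<and> (\<forall>N\<ge>N0. \<forall>T'. map fst T' = [w] \<and> (\<forall>t\<in>set T'. ok_item k N t) \<longrightarrow>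
     norm (EVN N T' - items_limit free_moment T') \<le> e N)"
    using EV_uniform_limit[of "[w]"] by (rule exE)
  note e0 = *[THEN conjunct1] and e = *[THEN conjunct2, THEN spec, THEN mp, THEN spec, THEN mp, OF _ conjI]
  have "(\<lambda>N. (\<Sum>i<N. EVN N [(w, i, i)]) / of_nat N - free_moment w) \<longlonglongrightarrow> 0"
  proof (rule Lim_null_comparison[OF _ e0])
    show "\<forall>\<^sub>F N in sequentially. norm ((\<Sum>i<N. EVN N [(w, i, i)]) / of_nat N - free_moment w) \<le> e N"
      using eventually_ge_at_top[of N0]
    proof eventually_elim
      case (elim N)
      then have N: "N > 0" using N0 by simp
      have "norm (\<Sum>i<N. EVN N [(w, i, i)] - free_moment w) \<le> (\<Sum>i<N. e N)"
      proof (rule sum_norm_le)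
        fix i assume "i \<in> {..<N}"
        then show "norm (EVN N [(w, i, i)] - free_moment w) \<le> e N"
          using e[OF elim, of "[(w, i, i)]"] w by (simp add: ok_item_def items_limit_Cons)
      qed
      then have "norm (\<Sum>i<N. EVN N [(w, i, i)] - free_moment w) / real N \<le> e N"
        using N by (simp add: divide_le_eq mult.commute)
      moreover have "(\<Sum>i<N. EVN N [(w, i, i)]) / of_nat N - free_moment w =
          (\<Sum>i<N. EVN N [(w, i, i)] - free_moment w) / of_nat N"
        using N by (simp add: sum_subtractf diff_divide_distrib)
      ultimately show ?case by (simp add: norm_divide)
    qed
  qed
  then show ?thesis by (simp add: Lim_null[symmetric])
qed

text \<open>Using one label for both indices of the entry and summing it out leaves no free index.
  The expected trace is then a Laurent polynomial, and its growth is known from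
  \<open>trace_moment_limit\<close>.\<close>

theorem trace_moment_correction:
  assumes w: "set w \<subseteq> {..<k}"
  shows "convergent (\<lambda>N. (\<Sum>i<N. EVN N [(w, i, i)]) - of_nat N * free_moment w)"
proof -
  have "laurent_deltas (\<lambda>N f. EVN N (label_items f [(w, 0, 0)]))"
    by (rule laurent_deltas_EV) (use w in simp)
  then have "laurent_deltas (\<lambda>N f. \<Sum>i<N. EVN N (label_items (f(0 := i)) [(w, 0, 0)]))"
    by (rule laurent_deltas_sum_label)
  from laurent_deltas_const[OF this] obtain L N1 where "\<forall>N\<ge>N1.
      (\<Sum>i<N. EVN N (label_items ((\<lambda>_. 0)(0 := i)) [(w, 0, 0)])) = (\<Sum>(c, z)\<leftarrow>L. c * of_nat N powi z)"
    by (elim exE)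
  then have "\<And>N. N \<ge> N1 \<Longrightarrow> (\<Sum>i<N. EVN N [(w, i, i)]) = (\<Sum>(c, z)\<leftarrow>L. c * of_nat N powi z)"
    by (simp add: label_items_def)
  from laurent_convergent[OF this trace_moment_limit[OF w]] show ?thesis .
qed

theorem EV_fixed_limit:
  assumes "\<And>w i j. (w, i, j) \<in> set T \<Longrightarrow> set w \<subseteq> {..<k} \<and> i < N0 \<and> j < N0"
  shows "(\<lambda>N. EVN N T) \<longlonglongrightarrow> items_limit free_moment T"
proof -
  obtain e where *: "e \<longlonglongrightarrow> 0 \<and> (\<forall>N\<ge>N0. \<forall>T'. map fst T' = map fst T \<and> (\<forall>t\<in>set T'. ok_item k N t) \<longrightarrow>
     norm (EVN N T' - items_limit free_moment T') \<le> e N)"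
    using EV_uniform_limit[of "map fst T"] by (rule exE)
  note e0 = *[THEN conjunct1] and e = *[THEN conjunct2, THEN spec, THEN mp, THEN spec, THEN mp, OF _ conjI]
  have "(\<lambda>N. EVN N T - items_limit free_moment T) \<longlonglongrightarrow> 0"
  proof (rule Lim_null_comparison[OF _ e0])
    show "\<forall>\<^sub>F N in sequentially. norm (EVN N T - items_limit free_moment T) \<le> e N"
      using eventually_ge_at_top[of N0]
    proof eventually_elim
      case (elim N)
      have "ok_item k N t" if "t \<in> set T" for t
        using assms[of "fst t" "fst (snd t)" "snd (snd t)"] that elim by (auto simp: ok_item_def)
      then show ?case by (intro e elim) auto
    qed
  qed
  then show ?thesis by (simp add: Lim_null[symmetric])
qed

end

section \<open>Conjugation by a Haar unitary\<close>

definition word_mat :: "nat \<Rightarrow> ('x \<Rightarrow> complex mat) \<Rightarrow> 'x list \<Rightarrow> complex mat" where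
  "word_mat N F w = foldr (\<lambda>x B. F x * B) w (1\<^sub>m N)"

lemma word_mat_simps [simp]:
  "word_mat N F [] = 1\<^sub>m N" "word_mat N F (x # w) = F x * word_mat N F w"
  by (simp_all add: word_mat_def)

lemma word_mat_carrier:
  assumes "\<And>x. x \<in> set w \<Longrightarrow> F x \<in> carrier_mat N N"
  shows "word_mat N F w \<in> carrier_mat N N"
  using assms by (induction w) (auto intro!: mult_carrier_mat)

lemma mat_mult_index:
  assumes "A \<in> carrier_mat N N" "B \<in> carrier_mat N N" "i < N" "j < N"
  shows "(A * B) $$ (i, j) = (\<Sum>a<N. A $$ (i, a) * B $$ (a, j))"
  using assms by (simp add: scalar_prod_def lessThan_atLeast0)

lemma word_mat_index:
  assumes "\<And>x. x \<in> set w \<Longrightarrow> F x \<in> carrier_mat N N" "i < N" "j < N"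
  shows "word_mat N F w $$ (i, j) = word_entry (\<lambda>x i j. F x $$ (i, j)) N w i j"
  using assms
proof (induction w arbitrary: i)
  case (Cons x w)
  have "word_mat N F (x # w) $$ (i, j) = (\<Sum>a<N. F x $$ (i, a) * word_mat N F w $$ (a, j))"
    unfolding word_mat_simps
    by (rule mat_mult_index) (use Cons.prems word_mat_carrier[of w F N] in auto)
  then show ?case using Cons by simp
qed simp

lemma mat_adjoint_carrier: "A \<in> carrier_mat N N \<Longrightarrow> mat_adjoint A \<in> carrier_mat N N"
  by (simp add: mat_adjoint_def mat_of_rows_def)

text \<open>The same unitary conjugates every letter, so the inner products of its adjoint with
  itself cancel.\<close>

lemma word_mat_conjugate:
  assumes U: "U \<in> unitary_group N" and L: "\<And>x. x \<in> set w \<Longrightarrow> L x \<in> carrier_mat N N"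
    and F: "\<And>x. x \<in> set w \<Longrightarrow> F x = U * L x * mat_adjoint U"
  shows "word_mat N F w = U * word_mat N L w * mat_adjoint U"
  using L F
proof (induction w)
  case Nil
  then show ?case using U right_mult_one_mat[of U N N] by (simp add: unitary_group_def)
next
  case (Cons x w)
  let ?U' = "mat_adjoint U" and ?B = "word_mat N L w"
  have c: "U \<in> carrier_mat N N" "?U' \<in> carrier_mat N N" "L x \<in> carrier_mat N N" "?B \<in> carrier_mat N N"
    using U Cons.prems word_mat_carrier[of w L N] by (auto simp: unitary_group_def mat_adjoint_carrier)
  have "word_mat N F (x # w) = (U * L x * ?U') * (U * ?B * ?U')"
    using Cons by simp
  also have "\<dots> = U * L x * (?U' * (U * ?B * ?U'))"
    by (rule assoc_mult_mat[of _ N N _ N _ N]) (use c in auto)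
  also have "?U' * (U * ?B * ?U') = ?U' * (U * (?B * ?U'))"
    using c by (simp add: assoc_mult_mat[of U N N ?B N ?U' N])
  also have "\<dots> = (?U' * U) * (?B * ?U')"
    by (rule assoc_mult_mat[of _ N N _ N _ N, symmetric]) (use c in auto)
  also have "\<dots> = ?B * ?U'"
    using U c by (simp add: unitary_group_def)
  also have "U * L x * (?B * ?U') = U * L x * ?B * ?U'"
    by (rule assoc_mult_mat[of _ N N _ N _ N, symmetric]) (use c in auto)
  also have "U * L x * ?B = U * (L x * ?B)"
    by (rule assoc_mult_mat[of _ N N _ N _ N]) (use c in auto)
  finally show ?case by simp
qed

text \<open>The entries of \<open>U B U\<^sup>*\<close> are the values of a sesquilinear form at the rows of \<open>U\<close>.\<close>

definition row_form :: "nat \<Rightarrow> complex mat \<Rightarrow> (nat \<Rightarrow> complex) \<Rightarrow> (nat \<Rightarrow> complex) \<Rightarrow> complex" where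
  "row_form N B r s = (\<Sum>b<N. (\<Sum>a<N. r a * B $$ (a, b)) * cnj (s b))"

lemma row_form_linear:
  "row_form N B (\<lambda>a. p * r a + q * r' a) s = p * row_form N B r s + q * row_form N B r' s"
  by (simp add: row_form_def sum.distrib sum_distrib_left sum_distrib_right algebra_simps)

lemma row_form_antilinear:
  "row_form N B r (\<lambda>a. p * s a + q * s' a) = cnj p * row_form N B r s + cnj q * row_form N B r s'"
  by (simp add: row_form_def sum.distrib sum_distrib_left algebra_simps)

lemma row_form_cong:
  assumes "\<And>a. a < N \<Longrightarrow> r a = r' a" "\<And>a. a < N \<Longrightarrow> s a = s' a"
  shows "row_form N B r s = row_form N B r' s'"
  using assms by (simp add: row_form_def)

lemma conjugate_index:
  assumes "U \<in> carrier_mat N N" "B \<in> carrier_mat N N" "i < N" "j < N"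
  shows "(U * B * mat_adjoint U) $$ (i, j) = row_form N B (\<lambda>a. U $$ (i, a)) (\<lambda>a. U $$ (j, a))"
proof -
  have "(U * B * mat_adjoint U) $$ (i, j) = (\<Sum>b<N. (U * B) $$ (i, b) * mat_adjoint U $$ (b, j))"
    by (rule mat_mult_index) (use assms mat_adjoint_carrier in auto)
  also have "\<dots> = (\<Sum>b<N. (\<Sum>a<N. U $$ (i, a) * B $$ (a, b)) * cnj (U $$ (j, b)))"
    using assms by (intro sum.cong refl arg_cong2[where f="(*)"] mat_mult_index mat_adjoint_index) auto
  finally show ?thesis by (simp only: row_form_def)
qed

section \<open>Reflections in a coordinate plane\<close>

text \<open>The block with rows \<open>(p, q)\<close> and \<open>(q, - p)\<close> in the coordinates
  \<open>i\<close>, \<open>j\<close>, and the identity elsewhere. Being real symmetric, it is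
  unitary as soon as its square is the identity. The values 0, 1 exchange the two coordinates;
  \<open>p = q\<close> equal to 1 over sqrt 2 mixes them evenly.\<close>

definition plane_reflection :: "nat \<Rightarrow> nat \<Rightarrow> nat \<Rightarrow> real \<Rightarrow> real \<Rightarrow> complex mat" where
  "plane_reflection N i j p q = mat N N (\<lambda>(x, c).
     if x = i then p * of_bool (c = i) + q * of_bool (c = j)
     else if x = j then q * of_bool (c = i) - p * of_bool (c = j)
     else of_bool (c = x))"

lemma plane_reflection_carrier: "plane_reflection N i j p q \<in> carrier_mat N N"
  by (simp add: plane_reflection_def)

lemma plane_reflection_mult_index:
  assumes U: "U \<in> carrier_mat N N" and x: "x < N" "a < N" "i < N" "j < N"
  shows "(plane_reflection N i j p q * U) $$ (x, a) =
     (if x = i then p * U $$ (i, a) + q * U $$ (j, a)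
      else if x = j then q * U $$ (i, a) - p * U $$ (j, a) else U $$ (x, a))"
proof -
  have "(plane_reflection N i j p q * U) $$ (x, a) = (\<Sum>c<N. plane_reflection N i j p q $$ (x, c) * U $$ (c, a))"
    by (rule mat_mult_index[OF plane_reflection_carrier U x(1,2)])
  also have "\<dots> = (\<Sum>c<N. (if x = i then p * (of_bool (c = i) * U $$ (c, a)) + q * (of_bool (c = j) * U $$ (c, a))
     else if x = j then q * (of_bool (c = i) * U $$ (c, a)) - p * (of_bool (c = j) * U $$ (c, a))
     else of_bool (c = x) * U $$ (c, a)))"
    using x by (intro sum.cong refl) (simp add: plane_reflection_def algebra_simps)
  also have "\<dots> = (if x = i then p * U $$ (i, a) + q * U $$ (j, a)
      else if x = j then q * U $$ (i, a) - p * U $$ (j, a) else U $$ (x, a))"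
  proof -
    note S = sum.distrib sum_subtractf sum_distrib_left[symmetric]
      sum_of_bool_eq[OF finite_lessThan, of i N] sum_of_bool_eq[OF finite_lessThan, of j N]
      sum_of_bool_eq[OF finite_lessThan, of x N]
    consider "x = i" | "x \<noteq> i" "x = j" | "x \<noteq> i" "x \<noteq> j" by blast
    then show ?thesis
      by cases (simp_all only: if_True if_False simp_thms S lessThan_iff x)
  qed
  finally show ?thesis .
qed

lemma plane_reflection_unitary:
  assumes ij: "i < N" "j < N" "i \<noteq> j" and pq: "p\<^sup>2 + q\<^sup>2 = 1"
  shows "plane_reflection N i j p q \<in> unitary_group N"
proof -
  let ?V = "plane_reflection N i j p q"
  have V: "?V \<in> carrier_mat N N" by (rule plane_reflection_carrier)
  have adj: "mat_adjoint ?V = ?V"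
  proof (rule eq_matI)
    fix x c assume "x < dim_row ?V" "c < dim_col ?V"
    then have xc: "x < N" "c < N" using V by auto
    show "mat_adjoint ?V $$ (x, c) = ?V $$ (x, c)"
      unfolding mat_adjoint_index[OF V xc] using xc ij(3)
      by (cases "x = i"; cases "x = j"; cases "c = i"; cases "c = j")
        (simp_all add: plane_reflection_def)
  qed (use V mat_adjoint_carrier[OF V] in auto)
  have pq': "complex_of_real p * p + complex_of_real q * q = 1"
    using pq by (simp add: power2_eq_square flip: of_real_mult of_real_add)
  have "?V * ?V = 1\<^sub>m N"
  proof (rule eq_matI)
    fix x c assume "x < dim_row (1\<^sub>m N :: complex mat)" "c < dim_col (1\<^sub>m N :: complex mat)"
    then have xc: "x < N" "c < N" by auto
    show "(?V * ?V) $$ (x, c) = 1\<^sub>m N $$ (x, c)"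
      unfolding plane_reflection_mult_index[OF V xc ij(1,2)] using xc ij pq'
      by (cases "x = i"; cases "x = j"; cases "c = i"; cases "c = j")
        (simp_all add: plane_reflection_def mult.commute add.commute)
  qed (use V in auto)
  then show ?thesis using V adj by (simp add: unitary_group_def)
qed

lemma measurable_entry:
  assumes "i < N" "j < N"
  shows "(\<lambda>X. X $$ (i, j)) \<in> borel_measurable (borel_mat N)"
proof -
  have "(\<lambda>X. \<lambda>ij\<in>{..<N} \<times> {..<N}. X $$ ij) \<in> borel_mat N \<rightarrow>\<^sub>M (\<Pi>\<^sub>M ij\<in>{..<N} \<times> {..<N}. borel :: complex measure)"
    unfolding borel_mat_def by (rule measurable_vimage_algebra1) (auto simp: space_PiM)
  from measurable_compose[OF this measurable_component_singleton[of "(i, j)"]]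
  show ?thesis using assms by simp
qed

section \<open>Concentration of the entries of a conjugated matrix\<close>

text \<open>The deterministic matrix \<open>B\<close> will be a word in the diagonal-free data
  Lambda_r, that is, in the matrices before conjugation. The bound \<open>K\<close> on the squared
  norm of a column is the form in which the operator norm enters the second moment
  estimates.\<close>

locale haar_conjugate = prob_space M for M :: "'w measure" +
  fixes N :: nat and U :: "'w \<Rightarrow> complex mat" and B :: "complex mat" and K :: real
  assumes haar: "haar_unitary M N U" and B: "B \<in> carrier_mat N N" and N: "N > 0"
    and column_bound: "\<And>\<omega> j. \<omega> \<in> space M \<Longrightarrow> j < N \<Longrightarrow>
      (\<Sum>i<N. (cmod ((U \<omega> * B * mat_adjoint (U \<omega>)) $$ (i, j)))\<^sup>2) \<le> K"
begin

definition Y :: "nat \<Rightarrow> nat \<Rightarrow> 'w \<Rightarrow> complex" where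
  "Y i j \<omega> = (U \<omega> * B * mat_adjoint (U \<omega>)) $$ (i, j)"

lemma U_unitary: "\<omega> \<in> space M \<Longrightarrow> U \<omega> \<in> unitary_group N"
  using haar by (simp add: haar_unitary_def)

lemma U_carrier: "\<omega> \<in> space M \<Longrightarrow> U \<omega> \<in> carrier_mat N N"
  using U_unitary by (simp add: unitary_group_def)

lemma U_measurable: "U \<in> M \<rightarrow>\<^sub>M borel_mat N"
  using haar by (simp add: haar_unitary_def)

lemma Y_row_form:
  "\<omega> \<in> space M \<Longrightarrow> i < N \<Longrightarrow> j < N \<Longrightarrow> Y i j \<omega> = row_form N B (\<lambda>a. U \<omega> $$ (i, a)) (\<lambda>a. U \<omega> $$ (j, a))"
  unfolding Y_def by (intro conjugate_index U_carrier B)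

lemma row_form_measurable:
  assumes "i < N" "j < N"
  shows "(\<lambda>X. row_form N B (\<lambda>a. X $$ (i, a)) (\<lambda>a. X $$ (j, a))) \<in> borel_measurable (borel_mat N)"
  unfolding row_form_def using assms
  by (intro borel_measurable_sum borel_measurable_times borel_measurable_const measurable_entry
      measurable_compose[OF measurable_entry borel_measurable_continuous_onI[of cnj]] continuous_intros) auto

lemma Y_measurable: "i < N \<Longrightarrow> j < N \<Longrightarrow> Y i j \<in> borel_measurable M"
  by (subst measurable_cong[OF Y_row_form], assumption+)
    (rule measurable_compose[OF U_measurable row_form_measurable])

lemma Y_bound: "\<omega> \<in> space M \<Longrightarrow> i < N \<Longrightarrow> j < N \<Longrightarrow> (cmod (Y i j \<omega>))\<^sup>2 \<le> K"
  using member_le_sum[of i "{..<N}" "\<lambda>i. (cmod (Y i j \<omega>))\<^sup>2"] column_bound[of \<omega> j]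
  by (simp add: Y_def)

lemma Y_bound': "\<omega> \<in> space M \<Longrightarrow> i < N \<Longrightarrow> j < N \<Longrightarrow> cmod (Y i j \<omega>) \<le> sqrt K"
  using Y_bound by (intro real_le_rsqrt)

lemma Y_norm_measurable: "i < N \<Longrightarrow> j < N \<Longrightarrow> (\<lambda>\<omega>. cmod (Y i j \<omega>)) \<in> borel_measurable M"
  by (rule measurable_compose[OF Y_measurable borel_measurable_norm])

lemma Y_integrable: "i < N \<Longrightarrow> j < N \<Longrightarrow> integrable M (\<lambda>\<omega>. cmod (Y i j \<omega>))"
  by (rule integrable_const_bound[where B="sqrt K"])
    (auto intro: Y_bound' Y_norm_measurable)

lemma Y_square_integrable: "i < N \<Longrightarrow> j < N \<Longrightarrow> integrable M (\<lambda>\<omega>. (cmod (Y i j \<omega>))\<^sup>2)"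
  by (rule integrable_const_bound[where B=K])
    (auto intro: Y_bound borel_measurable_power Y_norm_measurable)

lemma expectation_invariant:
  fixes h :: "complex mat \<Rightarrow> real"
  assumes V: "V \<in> unitary_group N" and h: "h \<in> borel_measurable (borel_mat N)"
  shows "expectation (\<lambda>\<omega>. h (V * U \<omega>)) = expectation (\<lambda>\<omega>. h (U \<omega>))"
proof -
  have d: "distr M (borel_mat N) (\<lambda>\<omega>. V * U \<omega>) = distr M (borel_mat N) U"
    using haar V by (simp add: haar_unitary_def)
  have Vc: "V \<in> carrier_mat N N" using V by (simp add: unitary_group_def)
  have "(\<lambda>\<omega>. V * U \<omega>) \<in> M \<rightarrow>\<^sub>M borel_mat N"
    unfolding borel_mat_def
  proof (rule measurable_vimage_algebra2)
    show "(\<lambda>\<omega>. V * U \<omega>) \<in> space M \<rightarrow> carrier_mat N N" using Vc U_carrier by auto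
    show "(\<lambda>\<omega>. \<lambda>ij\<in>{..<N} \<times> {..<N}. (V * U \<omega>) $$ ij) \<in> M \<rightarrow>\<^sub>M (\<Pi>\<^sub>M ij\<in>{..<N} \<times> {..<N}. borel)"
    proof (rule measurable_restrict)
      fix ij assume ij: "ij \<in> {..<N} \<times> {..<N}"
      obtain i j where e: "ij = (i, j)" "i < N" "j < N" using ij by auto
      have "(\<lambda>\<omega>. \<Sum>a<N. V $$ (i, a) * U \<omega> $$ (a, j)) \<in> borel_measurable M"
        using e by (intro borel_measurable_sum borel_measurable_times borel_measurable_const
            measurable_compose[OF U_measurable measurable_entry]) auto
      then show "(\<lambda>\<omega>. (V * U \<omega>) $$ ij) \<in> borel_measurable M"
        unfolding e(1)
        by (rule measurable_cong[THEN iffD1, rotated]) (rule mat_mult_index[OF Vc U_carrier e(2,3), symmetric])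
    qed
  qed
  then have "expectation (\<lambda>\<omega>. h (V * U \<omega>)) = integral\<^sup>L (distr M (borel_mat N) (\<lambda>\<omega>. V * U \<omega>)) h"
    by (rule integral_distr[symmetric]) (rule h)
  also have "\<dots> = expectation (\<lambda>\<omega>. h (U \<omega>))"
    unfolding d by (rule integral_distr[OF U_measurable h])
  finally show ?thesis .
qed

text \<open>Multiplying \<open>U\<close> from the left by a reflection conjugates the matrix
  \<open>Y\<close> by it, and Haar measure does not see this: every function of an entry keeps its
  expectation.\<close>

lemma expectation_reflection:
  assumes V: "i < N" "j < N" "i \<noteq> j" "p\<^sup>2 + q\<^sup>2 = 1" and x: "x < N" "y < N"
    and g: "g \<in> borel_measurable borel"
  shows "expectation (\<lambda>\<omega>. g (row_form N B (\<lambda>a. (plane_reflection N i j p q * U \<omega>) $$ (x, a))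
      (\<lambda>a. (plane_reflection N i j p q * U \<omega>) $$ (y, a)))) = expectation (\<lambda>\<omega>. g (Y x y \<omega>) :: real)"
proof -
  have "expectation (\<lambda>\<omega>. g (row_form N B (\<lambda>a. (plane_reflection N i j p q * U \<omega>) $$ (x, a))
      (\<lambda>a. (plane_reflection N i j p q * U \<omega>) $$ (y, a)))) =
      expectation (\<lambda>\<omega>. g (row_form N B (\<lambda>a. U \<omega> $$ (x, a)) (\<lambda>a. U \<omega> $$ (y, a))))"
    by (rule expectation_invariant[OF plane_reflection_unitary[OF V]])
      (rule measurable_compose[OF row_form_measurable[OF x] g])
  also have "\<dots> = expectation (\<lambda>\<omega>. g (Y x y \<omega>))"
    by (rule Bochner_Integration.integral_cong) (simp_all only: Y_row_form x)
  finally show ?thesis .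
qed

text \<open>The reflection with parameters 0 and 1 exchanges the rows \<open>i\<close> and
  \<open>i'\<close> of \<open>U\<close> and, as \<open>j\<close> differs from both, keeps row
  \<open>j\<close>.\<close>

lemma expectation_swap:
  assumes "i < N" "i' < N" "j < N" "i \<noteq> j" "i' \<noteq> j"
  shows "expectation (\<lambda>\<omega>. (cmod (Y i' j \<omega>))\<^sup>2) = expectation (\<lambda>\<omega>. (cmod (Y i j \<omega>))\<^sup>2)"
proof (cases "i = i'")
  case False
  have "expectation (\<lambda>\<omega>. (cmod (Y i' j \<omega>))\<^sup>2) =
     expectation (\<lambda>\<omega>. (cmod (row_form N B (\<lambda>a. (plane_reflection N i i' 0 1 * U \<omega>) $$ (i, a))
      (\<lambda>a. (plane_reflection N i i' 0 1 * U \<omega>) $$ (j, a))))\<^sup>2)"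
  proof (rule Bochner_Integration.integral_cong[OF refl])
    fix \<omega> assume \<omega>: "\<omega> \<in> space M"
    have "row_form N B (\<lambda>a. (plane_reflection N i i' 0 1 * U \<omega>) $$ (i, a))
      (\<lambda>a. (plane_reflection N i i' 0 1 * U \<omega>) $$ (j, a)) =
      row_form N B (\<lambda>a. U \<omega> $$ (i', a)) (\<lambda>a. U \<omega> $$ (j, a))"
      by (rule row_form_cong) (use assms in \<open>simp_all add: plane_reflection_mult_index[OF U_carrier[OF \<omega>]]\<close>)
    then show "(cmod (Y i' j \<omega>))\<^sup>2 = (cmod (row_form N B (\<lambda>a. (plane_reflection N i i' 0 1 * U \<omega>) $$ (i, a))
      (\<lambda>a. (plane_reflection N i i' 0 1 * U \<omega>) $$ (j, a))))\<^sup>2"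
      by (simp only: Y_row_form[OF \<omega> assms(2,3)])
  qed
  also have "\<dots> = expectation (\<lambda>\<omega>. (cmod (Y i j \<omega>))\<^sup>2)"
    by (rule expectation_reflection[where g="\<lambda>z. (cmod z)\<^sup>2"]) (use assms False in \<open>auto intro!: borel_measurable_power borel_measurable_norm\<close>)
  finally show ?thesis .
qed simp

text \<open>The column has N - 1 entries off the diagonal with the same second moment, and together
  they amount to at most \<open>K\<close>.\<close>

lemma off_diagonal_square:
  assumes ij: "i < N" "j < N" "i \<noteq> j"
  shows "expectation (\<lambda>\<omega>. (cmod (Y i j \<omega>))\<^sup>2) \<le> K / (real N - 1)"
proof -
  have "real (N - 1) * expectation (\<lambda>\<omega>. (cmod (Y i j \<omega>))\<^sup>2) =
      (\<Sum>x\<in>{..<N} - {j}. expectation (\<lambda>\<omega>. (cmod (Y i j \<omega>))\<^sup>2))"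
    using ij by simp
  also have "\<dots> = (\<Sum>x\<in>{..<N} - {j}. expectation (\<lambda>\<omega>. (cmod (Y x j \<omega>))\<^sup>2))"
    using ij by (intro sum.cong refl expectation_swap[symmetric]) auto
  also have "\<dots> \<le> (\<Sum>x<N. expectation (\<lambda>\<omega>. (cmod (Y x j \<omega>))\<^sup>2))"
    by (rule sum_mono2) auto
  also have "\<dots> = expectation (\<lambda>\<omega>. \<Sum>x<N. (cmod (Y x j \<omega>))\<^sup>2)"
    using ij by (intro Bochner_Integration.integral_sum[symmetric] Y_square_integrable) auto
  also have "\<dots> \<le> expectation (\<lambda>\<omega>. K)"
    using ij by (intro integral_mono Bochner_Integration.integrable_sum Y_square_integrable)
      (auto simp: Y_def intro: column_bound)
  also have "\<dots> = K" by (simp add: prob_space)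
  finally show ?thesis using ij by (simp add: field_simps of_nat_diff)
qed

text \<open>Nonnegativity of the variance of \<open>f\<close>.\<close>

lemma expectation_le_sqrt:
  fixes f :: "'w \<Rightarrow> real"
  assumes f: "integrable M f" "integrable M (\<lambda>\<omega>. (f \<omega>)\<^sup>2)"
    and "expectation (\<lambda>\<omega>. (f \<omega>)\<^sup>2) \<le> c"
  shows "expectation f \<le> sqrt c"
proof (rule real_le_rsqrt)
  have "0 \<le> expectation (\<lambda>\<omega>. (f \<omega>)\<^sup>2) - (expectation f)\<^sup>2"
    using variance_positive[of f] variance_eq[OF f] by simp
  then show "(expectation f)\<^sup>2 \<le> c" using assms(3) by simp
qed

text \<open>The mean size allowed for an off-diagonal entry. For \<open>N = 1\<close> the
  denominator is 0 and so is the value, in agreement with the absence of such entries.\<close>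

definition deviation :: real where
  "deviation = sqrt (K / (real N - 1))"

lemma deviation_nonneg: "0 \<le> deviation"
proof -
  obtain \<omega> where "\<omega> \<in> space M" using not_empty by blast
  from column_bound[OF this N] have "0 \<le> K"
    by (rule order_trans[OF sum_nonneg[OF zero_le_power2]])
  then show ?thesis using N by (simp add: deviation_def)
qed

lemma off_diagonal:
  "i < N \<Longrightarrow> j < N \<Longrightarrow> i \<noteq> j \<Longrightarrow> expectation (\<lambda>\<omega>. cmod (Y i j \<omega>)) \<le> deviation"
  unfolding deviation_def by (intro expectation_le_sqrt Y_integrable Y_square_integrable off_diagonal_square)

text \<open>Conjugation by the reflection with both parameters 1 over sqrt 2 turns the entry
  \<open>(i, j)\<close> into \<open>H\<close>, which has the law of \<open>Y i j\<close>. Solving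
  for the difference gives 2 H + Y i j - Y j i, and the constant 4 is 2 + 1 + 1.\<close>

lemma diagonal_difference:
  assumes ij: "i < N" "j < N" "i \<noteq> j"
  shows "expectation (\<lambda>\<omega>. cmod (Y i i \<omega> - Y j j \<omega>)) \<le> 4 * deviation"
proof -
  define H where "H = (\<lambda>\<omega>. (Y i i \<omega> - Y i j \<omega> + Y j i \<omega> - Y j j \<omega>) / 2)"
  define s where "s = 1 / sqrt 2"
  have s: "s\<^sup>2 + s\<^sup>2 = 1" by (simp add: s_def power_divide)
  have s': "complex_of_real s * complex_of_real s = 1 / 2"
    by (simp add: s_def flip: of_real_mult)
  have "expectation (\<lambda>\<omega>. cmod (H \<omega>)) =
      expectation (\<lambda>\<omega>. cmod (row_form N B (\<lambda>a. (plane_reflection N i j s s * U \<omega>) $$ (i, a))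
      (\<lambda>a. (plane_reflection N i j s s * U \<omega>) $$ (j, a))))"
  proof (rule Bochner_Integration.integral_cong[OF refl])
    fix \<omega> assume \<omega>: "\<omega> \<in> space M"
    let ?u = "\<lambda>x a. U \<omega> $$ (x, a)"
    have "row_form N B (\<lambda>a. (plane_reflection N i j s s * U \<omega>) $$ (i, a))
      (\<lambda>a. (plane_reflection N i j s s * U \<omega>) $$ (j, a)) =
      row_form N B (\<lambda>a. s * ?u i a + s * ?u j a) (\<lambda>a. s * ?u i a + (- s) * ?u j a)"
      by (rule row_form_cong) (use ij in \<open>simp_all add: plane_reflection_mult_index[OF U_carrier[OF \<omega>]]\<close>)
    also have "\<dots> = complex_of_real s * complex_of_real s * (Y i i \<omega> - Y i j \<omega> + Y j i \<omega> - Y j j \<omega>)"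
      unfolding row_form_linear row_form_antilinear Y_row_form[OF \<omega> ij(1) ij(1)] Y_row_form[OF \<omega> ij(1,2)]
        Y_row_form[OF \<omega> ij(2,1)] Y_row_form[OF \<omega> ij(2) ij(2)]
      by (simp add: algebra_simps)
    also have "\<dots> = H \<omega>" unfolding H_def s' by simp
    finally show "cmod (H \<omega>) = cmod (row_form N B (\<lambda>a. (plane_reflection N i j s s * U \<omega>) $$ (i, a))
      (\<lambda>a. (plane_reflection N i j s s * U \<omega>) $$ (j, a)))" by simp
  qed
  also have "\<dots> = expectation (\<lambda>\<omega>. cmod (Y i j \<omega>))"
    by (rule expectation_reflection[OF ij s ij(1,2)]) simp
  finally have H: "expectation (\<lambda>\<omega>. cmod (H \<omega>)) \<le> deviation" using off_diagonal[OF ij] by simp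
  have iY: "integrable M (Y x y)" if "x < N" "y < N" for x y
    using Y_integrable[OF that] Y_measurable[OF that] by (simp add: integrable_norm_iff)
  have iH: "integrable M (\<lambda>\<omega>. cmod (H \<omega>))"
    unfolding H_def using ij by (intro integrable_norm integrable_divide Bochner_Integration.integrable_add
        Bochner_Integration.integrable_diff iY)
  have "expectation (\<lambda>\<omega>. cmod (Y i i \<omega> - Y j j \<omega>)) \<le>
      expectation (\<lambda>\<omega>. 2 * cmod (H \<omega>) + cmod (Y i j \<omega>) + cmod (Y j i \<omega>))"
  proof (rule integral_mono)
    show "integrable M (\<lambda>\<omega>. cmod (Y i i \<omega> - Y j j \<omega>))"
      using ij by (intro integrable_norm Bochner_Integration.integrable_diff iY)
    show "integrable M (\<lambda>\<omega>. 2 * cmod (H \<omega>) + cmod (Y i j \<omega>) + cmod (Y j i \<omega>))"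
      using ij by (intro Bochner_Integration.integrable_add integrable_mult_right iH Y_integrable)
    fix \<omega>
    have "Y i i \<omega> - Y j j \<omega> = 2 * H \<omega> + Y i j \<omega> + - Y j i \<omega>" by (simp add: H_def field_simps)
    also have "cmod \<dots> \<le> cmod (2 * H \<omega>) + cmod (Y i j \<omega>) + cmod (- Y j i \<omega>)"
      by (intro norm_triangle_mono order_refl)
    finally show "cmod (Y i i \<omega> - Y j j \<omega>) \<le> 2 * cmod (H \<omega>) + cmod (Y i j \<omega>) + cmod (Y j i \<omega>)"
      by (simp add: norm_mult)
  qed
  also have "\<dots> = 2 * expectation (\<lambda>\<omega>. cmod (H \<omega>)) + expectation (\<lambda>\<omega>. cmod (Y i j \<omega>)) + expectation (\<lambda>\<omega>. cmod (Y j i \<omega>))"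
    using ij iH by (simp add: Y_integrable)
  also have "\<dots> \<le> 4 * deviation"
    using H off_diagonal[OF ij] off_diagonal[OF ij(2,1)] ij(3) by auto
  finally show ?thesis .
qed

text \<open>The columns of \<open>U\<close> are orthonormal, so conjugation preserves the trace;
  hence the sum of the random diagonal entries is deterministic.\<close>

lemma sum_diagonal:
  assumes \<omega>: "\<omega> \<in> space M"
  shows "(\<Sum>i<N. Y i i \<omega>) = mat_tr B"
proof -
  note u = U_carrier[OF \<omega>]
  have 1: "(\<Sum>i<N. U \<omega> $$ (i, a) * cnj (U \<omega> $$ (i, b))) = of_bool (b = a)" if ab: "a < N" "b < N" for a b
  proof -
    have "(\<Sum>i<N. mat_adjoint (U \<omega>) $$ (b, i) * U \<omega> $$ (i, a)) = (mat_adjoint (U \<omega>) * U \<omega>) $$ (b, a)"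
      by (rule mat_mult_index[symmetric]) (use u ab mat_adjoint_carrier in auto)
    also have "\<dots> = of_bool (b = a)"
      using U_unitary[OF \<omega>] ab by (simp add: unitary_group_def)
    finally show ?thesis using u ab by (simp add: mat_adjoint_index[of _ N N] mult.commute)
  qed
  have "(\<Sum>i<N. Y i i \<omega>) = (\<Sum>i<N. \<Sum>b<N. \<Sum>a<N. B $$ (a, b) * (U \<omega> $$ (i, a) * cnj (U \<omega> $$ (i, b))))"
    by (rule sum.cong[OF refl]) (simp add: Y_row_form \<omega> row_form_def sum_distrib_right sum_distrib_left mult_ac)
  also have "\<dots> = (\<Sum>b<N. \<Sum>i<N. \<Sum>a<N. B $$ (a, b) * (U \<omega> $$ (i, a) * cnj (U \<omega> $$ (i, b))))"
    by (rule sum.swap)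
  also have "\<dots> = (\<Sum>b<N. \<Sum>a<N. \<Sum>i<N. B $$ (a, b) * (U \<omega> $$ (i, a) * cnj (U \<omega> $$ (i, b))))"
    by (intro sum.cong refl sum.swap)
  also have "\<dots> = (\<Sum>b<N. \<Sum>a<N. of_bool (a = b) * B $$ (a, b))"
    by (intro sum.cong refl) (simp add: sum_distrib_left[symmetric] 1 mult.commute eq_commute[of _ "_::nat"])
  also have "\<dots> = (\<Sum>b<N. B $$ (b, b))"
    by (intro sum.cong refl sum_of_bool_eq) auto
  finally show ?thesis using B by (simp add: mat_tr_def)
qed

text \<open>The normalised trace is the average of the diagonal entries, so the distance of one
  diagonal entry from it is at most the average of its distances to the others.\<close>

theorem concentration:
  assumes ij: "i < N" "j < N"
  shows "expectation (\<lambda>\<omega>. cmod (Y i j \<omega> - of_bool (i = j) * (mat_tr B / of_nat N))) \<le> 4 * deviation"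
proof (cases "i = j")
  case False
  have "0 \<le> expectation (\<lambda>\<omega>. cmod (Y i j \<omega>))" by simp
  then have "expectation (\<lambda>\<omega>. cmod (Y i j \<omega>)) \<le> 4 * deviation"
    using off_diagonal[OF ij False] by linarith
  then show ?thesis using False by simp
next
  case True
  have iY: "integrable M (Y x y)" if "x < N" "y < N" for x y
    using Y_integrable[OF that] Y_measurable[OF that] by (simp add: integrable_norm_iff)
  have int: "integrable M (\<lambda>\<omega>. cmod (Y i i \<omega> - Y x x \<omega>))" if "x < N" for x
    using ij that by (intro integrable_norm Bochner_Integration.integrable_diff iY)
  have "expectation (\<lambda>\<omega>. cmod (Y i i \<omega> - mat_tr B / of_nat N)) \<le>
      expectation (\<lambda>\<omega>. (\<Sum>x<N. cmod (Y i i \<omega> - Y x x \<omega>)) / real N)"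
  proof (rule integral_mono)
    show "integrable M (\<lambda>\<omega>. cmod (Y i i \<omega> - mat_tr B / of_nat N))"
      using ij by (intro integrable_norm Bochner_Integration.integrable_diff iY integrable_const)
    show "integrable M (\<lambda>\<omega>. (\<Sum>x<N. cmod (Y i i \<omega> - Y x x \<omega>)) / real N)"
      by (intro integrable_divide Bochner_Integration.integrable_sum int) simp
    fix \<omega> assume \<omega>: "\<omega> \<in> space M"
    have "Y i i \<omega> - mat_tr B / of_nat N = (\<Sum>x<N. Y i i \<omega> - Y x x \<omega>) / of_nat N"
      using N by (simp add: sum_subtractf sum_diagonal[OF \<omega>] diff_divide_distrib)
    then show "cmod (Y i i \<omega> - mat_tr B / of_nat N) \<le> (\<Sum>x<N. cmod (Y i i \<omega> - Y x x \<omega>)) / real N"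
      by (simp add: norm_divide divide_right_mono norm_sum)
  qed
  also have "\<dots> = (\<Sum>x<N. expectation (\<lambda>\<omega>. cmod (Y i i \<omega> - Y x x \<omega>))) / real N"
    by (subst integral_divide_zero, subst Bochner_Integration.integral_sum) (simp_all add: int)
  also have "\<dots> \<le> (\<Sum>x<N. 4 * deviation) / real N"
  proof (intro divide_right_mono sum_mono)
    fix x assume "x \<in> {..<N}"
    then have x: "x < N" by simp
    show "expectation (\<lambda>\<omega>. cmod (Y i i \<omega> - Y x x \<omega>)) \<le> 4 * deviation"
      using diagonal_difference[OF ij(1) x] deviation_nonneg by (cases "i = x") simp_all
  qed simp
  also have "\<dots> = 4 * deviation" using N by simp
  finally show ?thesis using True by simp
qed

end

section \<open>The two ensembles\<close>

abbreviation mat_entries :: "(nat \<Rightarrow> 'w \<Rightarrow> complex mat) \<Rightarrow> nat \<times> nat \<times> nat \<Rightarrow> 'w \<Rightarrow> complex" where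
  "mat_entries A \<equiv> (\<lambda>(r, i, j) \<omega>. A r \<omega> $$ (i, j))"

text \<open>\<open>t w\<close> is the value of \<open>\<tau>\<close> at the word \<open>w\<close> in the \<open>a\<^sub>r\<close>.\<close>

locale moment_model =
  fixes M :: "nat \<Rightarrow> 'w measure" and A :: "nat \<Rightarrow> nat \<Rightarrow> 'w \<Rightarrow> complex mat"
    and k N0 :: nat and t :: "nat list \<Rightarrow> complex"
  assumes prob: "N \<ge> N0 \<Longrightarrow> prob_space (M N)"
    and carrier: "N \<ge> N0 \<Longrightarrow> r < k \<Longrightarrow> \<omega> \<in> space (M N) \<Longrightarrow> A N r \<omega> \<in> carrier_mat N N"
    and integrable_items: "N \<ge> N0 \<Longrightarrow> (\<And>x. x \<in> set T \<Longrightarrow> ok_item k N x) \<Longrightarrow>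
      integrable (M N) (items_prod (mat_entries (A N)) N T)"
    and items_tendsto: "(\<And>x. x \<in> set T \<Longrightarrow> ok_item k N0 x) \<Longrightarrow>
      (\<lambda>N. \<integral>\<omega>. items_prod (mat_entries (A N)) N T \<omega> \<partial>M N) \<longlonglongrightarrow> items_limit t T"
    and trace_tendsto: "set w \<subseteq> {..<k} \<Longrightarrow>
      (\<lambda>N. (\<Sum>i<N. \<integral>\<omega>. items_prod (mat_entries (A N)) N [(w, i, i)] \<omega> \<partial>M N) / of_nat N) \<longlonglongrightarrow> t w"

theorem moment_model_gaussian:
  assumes G: "gaussian_ensemble (if re then real_gaussian else complex_gaussian) k N0 M A" and N0: "N0 \<ge> 1"
  shows "moment_model M A k N0 free_moment"
    and "set w \<subseteq> {..<k} \<Longrightarrow>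
      convergent (\<lambda>N. (\<Sum>i<N. \<integral>\<omega>. items_prod (mat_entries (A N)) N [(w, i, i)] \<omega> \<partial>M N) - of_nat N * free_moment w)"
proof -
  note G' = G[unfolded gaussian_ensemble_def, THEN spec, THEN mp]
  have gm: "gauss_models M (\<lambda>N. mat_entries (A N)) k N0 re"
  proof (rule gauss_models.intro)
    fix N assume N: "N0 \<le> N"
    show "gauss_model (M N) (mat_entries (A N)) k N re"
    proof (rule gauss_model.intro)
      show "prob_space (M N)" using G'[OF N] by (rule conjunct1)
      show "N > 0" using N N0 by simp
      then show "wick (M N) (mat_entries (A N)) (entry_labels k N) (gauss_cov re N)"
        by (rule wick_gaussian_ensemble[OF G N])
    qed
  qed (rule N0)
  interpret gauss_models M "\<lambda>N. mat_entries (A N)" k N0 re by (rule gm)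
  have EV: "EVN N T = (\<integral>\<omega>. items_prod (mat_entries (A N)) N T \<omega> \<partial>M N)" if "N \<ge> N0" for N T
    by (rule gauss_model.EV_def[OF model[OF that]])
  have ev: "eventually (\<lambda>N. N \<ge> N0) sequentially" by (rule eventually_ge_at_top)
  show "moment_model M A k N0 free_moment"
  proof (rule moment_model.intro)
    fix N assume N: "N \<ge> N0"
    then interpret gauss_model "M N" "mat_entries (A N)" k N re by (rule model)
    show "prob_space (M N)" by (rule M)
    show "A N r \<omega> \<in> carrier_mat N N" if "r < k" "\<omega> \<in> space (M N)" for r \<omega>
      using G'[OF \<open>N \<ge> N0\<close>, THEN conjunct2, THEN conjunct1] that by (simp add: self_adjoint_mats_def)
    show "integrable (M N) (items_prod (mat_entries (A N)) N T)"
      if "\<And>x. x \<in> set T \<Longrightarrow> ok_item k N x" for T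
      by (rule integrable_items_prod[OF that])
  next
    fix T assume T: "\<And>x. x \<in> set T \<Longrightarrow> ok_item k N0 x"
    have "(\<lambda>N. EVN N T) \<longlonglongrightarrow> items_limit free_moment T"
      by (rule EV_fixed_limit) (use T in \<open>auto simp: ok_item_def\<close>)
    then show "(\<lambda>N. \<integral>\<omega>. items_prod (mat_entries (A N)) N T \<omega> \<partial>M N) \<longlonglongrightarrow> items_limit free_moment T"
      by (rule Lim_transform_eventually) (use ev in eventually_elim, rule EV)
  next
    fix w :: "nat list" assume w: "set w \<subseteq> {..<k}"
    show "(\<lambda>N. (\<Sum>i<N. \<integral>\<omega>. items_prod (mat_entries (A N)) N [(w, i, i)] \<omega> \<partial>M N) / of_nat N) \<longlonglongrightarrow> free_moment w"
      by (rule Lim_transform_eventually[OF trace_moment_limit[OF w]])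
        (use ev in eventually_elim, simp only: EV)
  qed
  assume w: "set w \<subseteq> {..<k}"
  from trace_moment_correction[OF w]
  obtain L where L: "(\<lambda>N. (\<Sum>i<N. EVN N [(w, i, i)]) - of_nat N * free_moment w) \<longlonglongrightarrow> L"
    by (auto simp: convergent_def)
  have "(\<lambda>N. (\<Sum>i<N. \<integral>\<omega>. items_prod (mat_entries (A N)) N [(w, i, i)] \<omega> \<partial>M N) - of_nat N * free_moment w) \<longlonglongrightarrow> L"
    by (rule Lim_transform_eventually[OF L]) (use ev in eventually_elim, simp only: EV)
  then show "convergent (\<lambda>N. (\<Sum>i<N. \<integral>\<omega>. items_prod (mat_entries (A N)) N [(w, i, i)] \<omega> \<partial>M N) - of_nat N * free_moment w)"
    by (rule convergentI)
qed

section \<open>Products of entries in the unitary ensemble\<close>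

text \<open>A supremum of reals bounds its members only if the set is bounded above, which is shown
  first; rescaling \<open>g\<close> to a unit vector then gives the inequality. The zero vector is
  treated apart.\<close>

lemma mat_op_norm_le:
  assumes X: "X \<in> carrier_mat N N" and C: "mat_op_norm X \<le> C"
  shows "(\<Sum>i<N. (cmod (\<Sum>a<N. X $$ (i, a) * g a))\<^sup>2) \<le> C\<^sup>2 * (\<Sum>a<N. (cmod (g a))\<^sup>2)"
proof -
  let ?S = "{v \<in> carrier_vec (dim_col X). l2_norm_vec v \<le> 1}"
  have Xv: "vec_index (X *\<^sub>v v) i = (\<Sum>a<N. X $$ (i, a) * vec_index v a)" if "v \<in> carrier_vec N" "i < N" for v i
    using X that by (simp add: scalar_prod_def lessThan_atLeast0)
  have l2: "l2_norm_vec (X *\<^sub>v v) = sqrt (\<Sum>i<N. (cmod (\<Sum>a<N. X $$ (i, a) * vec_index v a))\<^sup>2)"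
    if "v \<in> carrier_vec N" for v
  proof -
    have "dim_vec (X *\<^sub>v v) = N" using X by simp
    then show ?thesis unfolding l2_norm_vec_def
      by (intro arg_cong[where f=sqrt] sum.cong) (simp_all only: Xv[OF that] lessThan_iff)
  qed
  \<comment> \<open>A crude bound suffices: the coordinates of a vector in the unit ball have
    modulus at most 1.\<close>
  have bdd: "bdd_above ((\<lambda>v. l2_norm_vec (X *\<^sub>v v)) ` ?S)"
  proof (rule bdd_aboveI2)
    fix v assume "v \<in> ?S"
    then have v: "v \<in> carrier_vec N" "l2_norm_vec v \<le> 1" using X by auto
    have v1: "cmod (vec_index v a) \<le> 1" if "a < N" for a
    proof -
      have "(cmod (vec_index v a))\<^sup>2 \<le> (\<Sum>i<dim_vec v. (cmod (vec_index v i))\<^sup>2)"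
        by (rule member_le_sum) (use v that in auto)
      then have "cmod (vec_index v a) \<le> l2_norm_vec v"
        unfolding l2_norm_vec_def by (rule real_le_rsqrt)
      then show ?thesis using v(2) by simp
    qed
    show "l2_norm_vec (X *\<^sub>v v) \<le> sqrt (\<Sum>i<N. (\<Sum>a<N. cmod (X $$ (i, a)))\<^sup>2)"
      unfolding l2[OF v(1)]
    proof (intro real_sqrt_le_mono sum_mono power_mono norm_ge_zero)
      fix i
      have "cmod (\<Sum>a<N. X $$ (i, a) * vec_index v a) \<le> (\<Sum>a<N. cmod (X $$ (i, a) * vec_index v a))"
        by (rule norm_sum)
      also have "\<dots> \<le> (\<Sum>a<N. cmod (X $$ (i, a)))"
        by (intro sum_mono) (simp add: norm_mult mult_left_le v1)
      finally show "cmod (\<Sum>a<N. X $$ (i, a) * vec_index v a) \<le> (\<Sum>a<N. cmod (X $$ (i, a)))" .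
    qed
  qed
  define n where "n = (\<Sum>a<N. (cmod (g a))\<^sup>2)"
  have n0: "n \<ge> 0" unfolding n_def by (rule sum_nonneg) simp
  show ?thesis
  proof (cases "n = 0")
    case True
    then have "g a = 0" if "a < N" for a
      using that unfolding n_def by (simp add: sum_nonneg_eq_0_iff)
    then show ?thesis using True by (simp add: n_def)
  next
    case False
    then have n: "n > 0" using n0 by simp
    define v where "v = vec N (\<lambda>a. g a / complex_of_real (sqrt n))"
    have vc: "v \<in> carrier_vec N" by (simp add: v_def)
    have "l2_norm_vec v = sqrt ((\<Sum>a<N. (cmod (g a))\<^sup>2) / n)"
      unfolding l2_norm_vec_def using n
      by (simp add: v_def norm_divide power_divide sum_divide_distrib)
    then have "l2_norm_vec v = 1" using n by (simp add: n_def)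
    then have "v \<in> ?S" using X vc by simp
    then have "l2_norm_vec (X *\<^sub>v v) \<le> mat_op_norm X"
      unfolding mat_op_norm_def by (rule cSUP_upper[OF _ bdd])
    then have le: "l2_norm_vec (X *\<^sub>v v) \<le> C" using C by simp
    have "0 \<le> l2_norm_vec (X *\<^sub>v v)" unfolding l2_norm_vec_def by (simp add: sum_nonneg)
    then have "(l2_norm_vec (X *\<^sub>v v))\<^sup>2 \<le> C\<^sup>2" using le by (intro power_mono)
    also have "(l2_norm_vec (X *\<^sub>v v))\<^sup>2 = (\<Sum>i<N. (cmod (\<Sum>a<N. X $$ (i, a) * vec_index v a))\<^sup>2)"
      unfolding l2[OF vc] by (simp add: sum_nonneg)
    also have "\<dots> = (\<Sum>i<N. (cmod (\<Sum>a<N. X $$ (i, a) * g a))\<^sup>2) / n"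
      unfolding sum_divide_distrib
    proof (rule sum.cong[OF refl])
      fix i
      have "(\<Sum>a<N. X $$ (i, a) * vec_index v a) = (\<Sum>a<N. X $$ (i, a) * g a) / complex_of_real (sqrt n)"
        by (simp add: v_def sum_divide_distrib)
      then show "(cmod (\<Sum>a<N. X $$ (i, a) * vec_index v a))\<^sup>2 = (cmod (\<Sum>a<N. X $$ (i, a) * g a))\<^sup>2 / n"
        using n by (simp add: norm_divide power_divide)
    qed
    finally show ?thesis using n by (simp add: divide_le_eq n_def)
  qed
qed

text \<open>Column \<open>j\<close> of a word is the word applied to a unit basis vector, and every
  letter enlarges the squared norm at most by the factor \<open>C\<^sup>2\<close>.\<close>

lemma word_entry_column_bound:
  assumes "\<And>x. x \<in> set w \<Longrightarrow> F x \<in> carrier_mat N N \<and> mat_op_norm (F x) \<le> C" and "j < N"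
  shows "(\<Sum>i<N. (cmod (word_entry (\<lambda>x i j. F x $$ (i, j)) N w i j))\<^sup>2) \<le> (C\<^sup>2) ^ length w"
  using assms(1)
proof (induction w)
  case Nil
  have "(\<Sum>i<N. (cmod (of_bool (i = j)))\<^sup>2) = (\<Sum>i<N. of_bool (i = j) * (1 :: real))"
    by (rule sum.cong) auto
  also have "\<dots> = 1" by (rule sum_of_bool_eq) (use \<open>j < N\<close> in auto)
  finally show ?case by simp
next
  case (Cons x w)
  have "(\<Sum>i<N. (cmod (word_entry (\<lambda>x i j. F x $$ (i, j)) N (x # w) i j))\<^sup>2) \<le>
     C\<^sup>2 * (\<Sum>a<N. (cmod (word_entry (\<lambda>x i j. F x $$ (i, j)) N w a j))\<^sup>2)"
    unfolding word_entry.simps by (rule mat_op_norm_le) (use Cons.prems in auto)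
  also have "\<dots> \<le> C\<^sup>2 * (C\<^sup>2) ^ length w"
    using Cons by (intro mult_left_mono) auto
  finally show ?case by simp
qed

locale unitary_models =
  fixes M :: "nat \<Rightarrow> 'w measure" and A :: "nat \<Rightarrow> nat \<Rightarrow> 'w \<Rightarrow> complex mat"
    and U :: "nat \<Rightarrow> 'w \<Rightarrow> complex mat" and \<Lambda> :: "nat \<Rightarrow> nat \<Rightarrow> complex mat"
    and k N0 :: nat and C :: real
  assumes prob: "N \<ge> N0 \<Longrightarrow> prob_space (M N)"
    and haar: "N \<ge> N0 \<Longrightarrow> haar_unitary (M N) N (U N)"
    and \<Lambda>: "N \<ge> N0 \<Longrightarrow> r < k \<Longrightarrow> \<Lambda> N r \<in> carrier_mat N N"
    and A: "N \<ge> N0 \<Longrightarrow> r < k \<Longrightarrow> \<omega> \<in> space (M N) \<Longrightarrow> A N r \<omega> = U N \<omega> * \<Lambda> N r * mat_adjoint (U N \<omega>)"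
    and C: "N \<ge> N0 \<Longrightarrow> r < k \<Longrightarrow> \<omega> \<in> space (M N) \<Longrightarrow> mat_op_norm (A N r \<omega>) \<le> C"
begin

lemma A_carrier:
  assumes "N \<ge> N0" "r < k" "\<omega> \<in> space (M N)"
  shows "A N r \<omega> \<in> carrier_mat N N"
proof -
  have "U N \<omega> \<in> carrier_mat N N"
    using haar[OF assms(1)] assms(3) by (auto simp: haar_unitary_def unitary_group_def)
  then show ?thesis
    unfolding A[OF assms]
    by (intro mult_carrier_mat[of _ N N] mat_adjoint_carrier \<Lambda>[OF assms(1,2)])
qed

abbreviation "B N w \<equiv> word_mat N (\<Lambda> N) w"

definition E :: "nat \<Rightarrow> nat list \<Rightarrow> nat \<Rightarrow> nat \<Rightarrow> 'w \<Rightarrow> complex" where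
  "E N w i j \<omega> = word_entry (\<lambda>r i j. A N r \<omega> $$ (i, j)) N w i j"

text \<open>This exhibits an entry of a random word as an entry of one conjugated deterministic
  matrix, so concentration for a single matrix covers all words.\<close>

lemma E_conjugate:
  assumes N: "N \<ge> N0" and w: "set w \<subseteq> {..<k}" and \<omega>: "\<omega> \<in> space (M N)" and ij: "i < N" "j < N"
  shows "E N w i j \<omega> = (U N \<omega> * B N w * mat_adjoint (U N \<omega>)) $$ (i, j)"
proof -
  have wk: "x < k" if "x \<in> set w" for x using that w by auto
  have U: "U N \<omega> \<in> unitary_group N" using haar[OF N] \<omega> by (simp add: haar_unitary_def)
  have "E N w i j \<omega> = word_mat N (\<lambda>r. A N r \<omega>) w $$ (i, j)"
    unfolding E_def by (rule word_mat_index[symmetric]) (use A_carrier[OF N wk \<omega>] ij in auto)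
  also have "word_mat N (\<lambda>r. A N r \<omega>) w = U N \<omega> * B N w * mat_adjoint (U N \<omega>)"
    by (rule word_mat_conjugate[OF U]) (use \<Lambda>[OF N wk] A[OF N wk \<omega>] in auto)
  finally show ?thesis .
qed

lemma haar_conjugate:
  assumes N: "N \<ge> N0" "N > 0" and w: "set w \<subseteq> {..<k}"
  shows "haar_conjugate (M N) N (U N) (B N w) ((C\<^sup>2) ^ length w)"
proof -
  have wk: "x < k" if "x \<in> set w" for x using that w by auto
  interpret prob_space "M N" by (rule prob[OF N(1)])
  show ?thesis
  proof
    show "haar_unitary (M N) N (U N)" by (rule haar[OF N(1)])
    show "B N w \<in> carrier_mat N N" by (rule word_mat_carrier) (use \<Lambda>[OF N(1) wk] in auto)
    fix \<omega> j assume \<omega>: "\<omega> \<in> space (M N)" and j: "j < N"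
    have "(\<Sum>i<N. (cmod ((U N \<omega> * B N w * mat_adjoint (U N \<omega>)) $$ (i, j)))\<^sup>2) =
      (\<Sum>i<N. (cmod (word_entry (\<lambda>r i j. A N r \<omega> $$ (i, j)) N w i j))\<^sup>2)"
      using E_conjugate[OF N(1) w \<omega> _ j] by (intro sum.cong) (auto simp: E_def)
    also have "\<dots> \<le> (C\<^sup>2) ^ length w"
      by (rule word_entry_column_bound[where F="\<lambda>r. A N r \<omega>"])
        (use A_carrier[OF N(1) wk \<omega>] C[OF N(1) wk \<omega>] j in auto)
    finally show "(\<Sum>i<N. (cmod ((U N \<omega> * B N w * mat_adjoint (U N \<omega>)) $$ (i, j)))\<^sup>2) \<le> (C\<^sup>2) ^ length w" .
  qed fact
qed

end

locale unitary_limit = unitary_models +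
  fixes t :: "nat list \<Rightarrow> complex"
  assumes trace_tendsto: "set w \<subseteq> {..<k} \<Longrightarrow>
      (\<lambda>N. (\<Sum>i<N. \<integral>\<omega>. items_prod (mat_entries (A N)) N [(w, i, i)] \<omega> \<partial>M N) / of_nat N) \<longlonglongrightarrow> t w"
    and N0: "N0 \<ge> 1"
begin

text \<open>The normalised trace of a word at size N. Conjugation preserves the trace, so it is a
  number rather than a random variable, around which the diagonal entries of the word
  concentrate.\<close>

definition c :: "nat \<Rightarrow> nat list \<Rightarrow> complex" where
  "c N w = mat_tr (B N w) / of_nat N"

definition P :: "nat \<Rightarrow> item list \<Rightarrow> 'a \<Rightarrow> complex" where
  "P N T \<omega> = items_prod (mat_entries (A N)) N T \<omega>"

lemma P_Cons: "P N ((w, i, j) # T) \<omega> = E N w i j \<omega> * P N T \<omega>"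
  by (simp add: P_def items_prod_Cons E_def)

lemma P_Nil [simp]: "P N [] \<omega> = 1"
  by (simp add: P_def items_prod_def)

lemma haar_E:
  assumes N: "N \<ge> N0" and w: "set w \<subseteq> {..<k}"
  shows "haar_conjugate (M N) N (U N) (B N w) ((C\<^sup>2) ^ length w)"
  by (rule haar_conjugate[OF N _ w]) (use N N0 in simp)

lemma E_eq_Y:
  assumes N: "N \<ge> N0" and w: "set w \<subseteq> {..<k}" and \<omega>: "\<omega> \<in> space (M N)" and ij: "i < N" "j < N"
  shows "E N w i j \<omega> = haar_conjugate.Y (U N) (B N w) i j \<omega>"
  unfolding E_conjugate[OF N w \<omega> ij] haar_conjugate.Y_def[OF haar_E[OF N w]] ..

lemma E_measurable:
  assumes N: "N \<ge> N0" and w: "set w \<subseteq> {..<k}" and ij: "i < N" "j < N"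
  shows "E N w i j \<in> borel_measurable (M N)"
  using haar_conjugate.Y_measurable[OF haar_E[OF N w] ij]
  by (rule measurable_cong[THEN iffD1, rotated]) (rule E_eq_Y[OF N w _ ij, symmetric])

lemma E_bound:
  assumes N: "N \<ge> N0" and w: "set w \<subseteq> {..<k}" and ij: "i < N" "j < N" and \<omega>: "\<omega> \<in> space (M N)"
  shows "cmod (E N w i j \<omega>) \<le> sqrt ((C\<^sup>2) ^ length w)"
  unfolding E_eq_Y[OF N w \<omega> ij] by (rule haar_conjugate.Y_bound'[OF haar_E[OF N w] \<omega> ij])

lemma E_concentration:
  assumes N: "N \<ge> N0" and w: "set w \<subseteq> {..<k}" and ij: "i < N" "j < N"
  shows "(\<integral>\<omega>. cmod (E N w i j \<omega> - of_bool (i = j) * c N w) \<partial>M N) \<le> 4 * sqrt ((C\<^sup>2) ^ length w / (real N - 1))"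
proof -
  have "(\<integral>\<omega>. cmod (E N w i j \<omega> - of_bool (i = j) * c N w) \<partial>M N) =
    (\<integral>\<omega>. cmod (haar_conjugate.Y (U N) (B N w) i j \<omega> - of_bool (i = j) * (mat_tr (B N w) / of_nat N)) \<partial>M N)"
    by (rule Bochner_Integration.integral_cong[OF refl]) (simp only: E_eq_Y[OF N w _ ij] c_def)
  also have "\<dots> \<le> 4 * sqrt ((C\<^sup>2) ^ length w / (real N - 1))"
    using haar_conjugate.concentration[OF haar_E[OF N w] ij]
    unfolding haar_conjugate.deviation_def[OF haar_E[OF N w]] .
  finally show ?thesis .
qed

lemma c_tendsto:
  assumes w: "set w \<subseteq> {..<k}"
  shows "(\<lambda>N. c N w) \<longlonglongrightarrow> t w"
proof (rule Lim_transform_eventually[OF trace_tendsto[OF w]])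
  show "\<forall>\<^sub>F N in sequentially. (\<Sum>i<N. \<integral>\<omega>. items_prod (mat_entries (A N)) N [(w, i, i)] \<omega> \<partial>M N) / of_nat N = c N w"
    using eventually_ge_at_top[of N0]
  proof eventually_elim
    case (elim N)
    interpret prob_space "M N" by (rule prob[OF elim])
    have int: "integrable (M N) (E N w i i)" if "i < N" for i
      by (rule integrable_const_bound[OF _ E_measurable[OF elim w that that]])
        (auto intro: E_bound[OF elim w that that])
    have "(\<Sum>i<N. \<integral>\<omega>. items_prod (mat_entries (A N)) N [(w, i, i)] \<omega> \<partial>M N) = (\<Sum>i<N. \<integral>\<omega>. E N w i i \<omega> \<partial>M N)"
      by (simp add: items_prod_def E_def)
    also have "\<dots> = (\<integral>\<omega>. (\<Sum>i<N. E N w i i \<omega>) \<partial>M N)"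
      by (rule Bochner_Integration.integral_sum[symmetric]) (simp add: int)
    also have "\<dots> = (\<integral>\<omega>. mat_tr (B N w) \<partial>M N)"
    proof (rule Bochner_Integration.integral_cong[OF refl])
      fix \<omega> assume \<omega>: "\<omega> \<in> space (M N)"
      have "(\<Sum>i<N. E N w i i \<omega>) = (\<Sum>i<N. haar_conjugate.Y (U N) (B N w) i i \<omega>)"
        by (rule sum.cong[OF refl]) (simp only: E_eq_Y[OF elim w \<omega>] lessThan_iff)
      then show "(\<Sum>i<N. E N w i i \<omega>) = mat_tr (B N w)"
        unfolding haar_conjugate.sum_diagonal[OF haar_E[OF elim w] \<omega>] .
    qed
    also have "\<dots> = mat_tr (B N w)" by (simp add: prob_space)
    finally show ?case by (simp only: c_def)
  qed
qed

definition P_bound :: "item list \<Rightarrow> real" where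
  "P_bound T = (\<Prod>(w, i, j)\<leftarrow>T. sqrt ((C\<^sup>2) ^ length w))"

lemma P_bound_Cons: "P_bound ((w, i, j) # T) = sqrt ((C\<^sup>2) ^ length w) * P_bound T"
  by (simp add: P_bound_def)

lemma P_bound_nonneg: "0 \<le> P_bound T"
  by (induction T) (auto simp: P_bound_def)

lemma P_le:
  assumes "N \<ge> N0" "\<omega> \<in> space (M N)" "\<And>x. x \<in> set T \<Longrightarrow> ok_item k N x"
  shows "cmod (P N T \<omega>) \<le> P_bound T"
  using assms(3)
proof (induction T)
  case (Cons x T)
  obtain w i j where x: "x = (w, i, j)" by (cases x)
  have ok: "set w \<subseteq> {..<k}" "i < N" "j < N" using Cons.prems[of x] by (auto simp: x ok_item_def)
  show ?case
    unfolding x P_Cons P_bound_Cons norm_mult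
    by (intro mult_mono E_bound[OF assms(1) ok assms(2)] Cons.IH Cons.prems) (auto intro: P_bound_nonneg)
qed (simp add: P_bound_def)

lemma P_measurable:
  assumes "N \<ge> N0" "\<And>x. x \<in> set T \<Longrightarrow> ok_item k N x"
  shows "P N T \<in> borel_measurable (M N)"
  using assms(2)
proof (induction T)
  case Nil
  have "P N [] = (\<lambda>_. 1)" by (simp add: fun_eq_iff)
  then show ?case by simp
next
  case (Cons x T)
  obtain w i j where x: "x = (w, i, j)" by (cases x)
  have ok: "set w \<subseteq> {..<k}" "i < N" "j < N" using Cons.prems[of x] by (auto simp: x ok_item_def)
  have "(\<lambda>\<omega>. E N w i j \<omega> * P N T \<omega>) \<in> borel_measurable (M N)"
    by (intro borel_measurable_times E_measurable[OF assms(1) ok] Cons.IH Cons.prems) auto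
  then show ?case unfolding x P_Cons[abs_def] .
qed

lemma P_integrable:
  assumes "N \<ge> N0" "\<And>x. x \<in> set T \<Longrightarrow> ok_item k N x"
  shows "integrable (M N) (P N T)"
proof -
  interpret prob_space "M N" by (rule prob[OF assms(1)])
  show ?thesis
    by (rule integrable_const_bound[OF _ P_measurable[OF assms]])
      (auto intro: P_le[OF assms(1) _ assms(2)])
qed

text \<open>Convergence in mean survives products of bounded variables: one factor is replaced at a
  time, while the others stay bounded by a constant independent of N.\<close>

lemma P_concentration:
  assumes "\<And>x. x \<in> set T \<Longrightarrow> ok_item k N0 x"
  shows "(\<lambda>N. \<integral>\<omega>. cmod (P N T \<omega> - items_limit (c N) T) \<partial>M N) \<longlonglongrightarrow> 0"
  using assms
proof (induction T)
  case Nil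
  then show ?case by simp
next
  case (Cons x T)
  obtain w i j where x: "x = (w, i, j)" by (cases x)
  have ok0: "set w \<subseteq> {..<k}" "i < N0" "j < N0" using Cons.prems[of x] by (auto simp: x ok_item_def)
  define K where "K = (C\<^sup>2) ^ length w"
  let ?e = "\<lambda>N. \<integral>\<omega>. cmod (P N T \<omega> - items_limit (c N) T) \<partial>M N"
  have IH: "?e \<longlonglongrightarrow> 0" using Cons by auto
  have sq: "(\<lambda>N. sqrt (K / (real N - 1))) \<longlonglongrightarrow> sqrt 0"
    by (intro tendsto_real_sqrt real_tendsto_divide_at_top[OF tendsto_const]) real_asymp
  have "(\<lambda>N. P_bound T * (4 * sqrt (K / (real N - 1))) + cmod (c N w) * ?e N) \<longlonglongrightarrow>
      P_bound T * (4 * sqrt 0) + cmod (t w) * 0"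
    by (intro tendsto_add tendsto_mult tendsto_const tendsto_norm sq c_tendsto[OF ok0(1)] IH)
  then have lim: "(\<lambda>N. P_bound T * (4 * sqrt (K / (real N - 1))) + cmod (c N w) * ?e N) \<longlonglongrightarrow> 0"
    by (simp only: real_sqrt_zero mult_zero_right add_0_right)
  show ?case
  proof (rule Lim_null_comparison[OF _ lim])
    show "\<forall>\<^sub>F N in sequentially. norm (\<integral>\<omega>. cmod (P N (x # T) \<omega> - items_limit (c N) (x # T)) \<partial>M N) \<le>
       P_bound T * (4 * sqrt (K / (real N - 1))) + cmod (c N w) * ?e N"
      using eventually_ge_at_top[of N0]
    proof eventually_elim
      case (elim N)
      interpret prob_space "M N" by (rule prob[OF elim])
      have ok: "i < N" "j < N" using ok0 elim by simp_all
      have okN: "ok_item k N y" if "y \<in> set (x # T)" for y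
        using Cons.prems[OF that] elim by (auto simp: ok_item_def)
      have okT: "ok_item k N y" if "y \<in> set T" for y using okN that by simp
      let ?d = "of_bool (i = j) * c N w"
      have iE: "integrable (M N) (E N w i j)"
        by (rule integrable_const_bound[OF _ E_measurable[OF elim ok0(1) ok]])
          (auto intro: E_bound[OF elim ok0(1) ok])
      have i1: "integrable (M N) (\<lambda>\<omega>. cmod (E N w i j \<omega> - ?d))"
        by (intro integrable_norm Bochner_Integration.integrable_diff iE integrable_const)
      have i2: "integrable (M N) (\<lambda>\<omega>. cmod (P N T \<omega> - items_limit (c N) T))"
        by (intro integrable_norm Bochner_Integration.integrable_diff P_integrable[OF elim okT] integrable_const)
      have i3: "integrable (M N) (\<lambda>\<omega>. cmod (P N (x # T) \<omega> - items_limit (c N) (x # T)))"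
        by (intro integrable_norm Bochner_Integration.integrable_diff P_integrable[OF elim okN] integrable_const)
      have "(\<integral>\<omega>. cmod (P N (x # T) \<omega> - items_limit (c N) (x # T)) \<partial>M N) \<le>
        (\<integral>\<omega>. P_bound T * cmod (E N w i j \<omega> - ?d) + cmod (c N w) * cmod (P N T \<omega> - items_limit (c N) T) \<partial>M N)"
      proof (rule integral_mono[OF i3])
        show "integrable (M N) (\<lambda>\<omega>. P_bound T * cmod (E N w i j \<omega> - ?d) + cmod (c N w) * cmod (P N T \<omega> - items_limit (c N) T))"
          by (intro Bochner_Integration.integrable_add integrable_mult_right i1 i2)
        fix \<omega> assume \<omega>: "\<omega> \<in> space (M N)"
        have a: "cmod (P N T \<omega>) \<le> P_bound T" by (rule P_le[OF elim \<omega>]) (rule okT)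
        have b: "cmod ?d \<le> cmod (c N w)" by (rule norm_of_bool_mult_le)
        \<comment> \<open>The first term contains the error of the new entry and a bounded product,
          the second the error of the old product and a deterministic convergent factor.\<close>
        have eq: "P N (x # T) \<omega> - items_limit (c N) (x # T) =
          P N T \<omega> * (E N w i j \<omega> - ?d) + ?d * (P N T \<omega> - items_limit (c N) T)"
          unfolding x P_Cons items_limit_Cons by (simp add: algebra_simps)
        have "cmod (P N (x # T) \<omega> - items_limit (c N) (x # T)) \<le> cmod (P N T \<omega> * (E N w i j \<omega> - ?d)) + cmod (?d * (P N T \<omega> - items_limit (c N) T))"
          unfolding eq by (rule norm_triangle_ineq)
        also have "\<dots> \<le> P_bound T * cmod (E N w i j \<omega> - ?d) + cmod (c N w) * cmod (P N T \<omega> - items_limit (c N) T)"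
          unfolding norm_mult[of "P N T \<omega>"] norm_mult[of ?d]
          by (rule add_mono[OF mult_right_mono[OF a norm_ge_zero] mult_right_mono[OF b norm_ge_zero]])
        finally show "cmod (P N (x # T) \<omega> - items_limit (c N) (x # T)) \<le>
          P_bound T * cmod (E N w i j \<omega> - ?d) + cmod (c N w) * cmod (P N T \<omega> - items_limit (c N) T)" .
      qed
      also have "\<dots> = P_bound T * (\<integral>\<omega>. cmod (E N w i j \<omega> - ?d) \<partial>M N) + cmod (c N w) * ?e N"
        by (subst Bochner_Integration.integral_add) (use i1 i2 in simp_all)
      also have "\<dots> \<le> P_bound T * (4 * sqrt (K / (real N - 1))) + cmod (c N w) * ?e N"
        unfolding K_def
        by (intro add_mono mult_left_mono E_concentration[OF elim ok0(1) ok] P_bound_nonneg order_refl)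
      finally show ?case by simp
    qed
  qed
qed

theorem moment_model: "moment_model M A k N0 t"
proof (rule moment_model.intro)
  fix N assume N: "N \<ge> N0"
  show "prob_space (M N)" by (rule prob[OF N])
  show "A N r \<omega> \<in> carrier_mat N N" if "r < k" "\<omega> \<in> space (M N)" for r \<omega>
    by (rule A_carrier[OF N that])
  show "integrable (M N) (items_prod (mat_entries (A N)) N T)"
    if "\<And>x. x \<in> set T \<Longrightarrow> ok_item k N x" for T
    using P_integrable[OF N that] unfolding P_def[abs_def] .
next
  fix T assume T: "\<And>x. x \<in> set T \<Longrightarrow> ok_item k N0 x"
  have lim: "(\<lambda>N. items_limit (c N) T) \<longlonglongrightarrow> items_limit t T"
    using T
  proof (induction T)
    case (Cons x T)
    obtain w i j where x: "x = (w, i, j)" by (cases x)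
    have "set w \<subseteq> {..<k}" using Cons.prems[of x] by (auto simp: x ok_item_def)
    then show ?case unfolding x items_limit_Cons
      by (intro tendsto_mult tendsto_const c_tendsto Cons.IH Cons.prems) auto
  qed simp
  have "(\<lambda>N. (\<integral>\<omega>. P N T \<omega> \<partial>M N) - items_limit (c N) T) \<longlonglongrightarrow> 0"
  proof (rule Lim_null_comparison[OF _ P_concentration[OF T]])
    show "\<forall>\<^sub>F N in sequentially. norm ((\<integral>\<omega>. P N T \<omega> \<partial>M N) - items_limit (c N) T) \<le>
        (\<integral>\<omega>. cmod (P N T \<omega> - items_limit (c N) T) \<partial>M N)"
      using eventually_ge_at_top[of N0]
    proof eventually_elim
      case (elim N)
      interpret prob_space "M N" by (rule prob[OF elim])
      have okN: "ok_item k N y" if "y \<in> set T" for y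
        using T[OF that] elim by (auto simp: ok_item_def)
      have "(\<integral>\<omega>. P N T \<omega> \<partial>M N) - items_limit (c N) T = (\<integral>\<omega>. P N T \<omega> - items_limit (c N) T \<partial>M N)"
        by (subst Bochner_Integration.integral_diff[OF P_integrable[OF elim okN]]) (simp_all add: prob_space)
      then show ?case by (simp only: integral_norm_bound)
    qed
  qed
  from tendsto_add[OF this lim] show "(\<lambda>N. \<integral>\<omega>. items_prod (mat_entries (A N)) N T \<omega> \<partial>M N) \<longlonglongrightarrow> items_limit t T"
    by (simp add: P_def)
qed (rule trace_tendsto)

end

section \<open>Functionals on non-commutative polynomials\<close>

definition lin_ext :: "('x list \<Rightarrow> complex) \<Rightarrow> 'x ncpoly \<Rightarrow> complex" where
  "lin_ext g p = (\<Sum>w\<in>Poly_Mapping.keys p. Poly_Mapping.lookup p w * g (letters w))"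

lemma lin_ext_superset:
  assumes "finite S" "Poly_Mapping.keys p \<subseteq> S"
  shows "lin_ext g p = (\<Sum>w\<in>S. Poly_Mapping.lookup p w * g (letters w))"
  unfolding lin_ext_def using assms by (intro sum.mono_neutral_left) (auto simp: in_keys_iff)

lemma lin_ext_zero [simp]: "lin_ext g 0 = 0"
  by (simp add: lin_ext_def)

lemma lin_ext_add: "lin_ext g (p + q) = lin_ext g p + lin_ext g q"
proof -
  let ?S = "Poly_Mapping.keys p \<union> Poly_Mapping.keys q"
  have "Poly_Mapping.keys (p + q) \<subseteq> ?S" by (rule Poly_Mapping.keys_add)
  then show ?thesis
    using lin_ext_superset[of ?S "p + q" g] lin_ext_superset[of ?S p g] lin_ext_superset[of ?S q g]
    by (simp add: lookup_add distrib_right sum.distrib)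
qed

lemma lin_ext_sum: "lin_ext g (\<Sum>i\<in>I. f i) = (\<Sum>i\<in>I. lin_ext g (f i))"
  by (induction I rule: infinite_finite_induct) (simp_all add: lin_ext_add)

lemma lin_ext_single [simp]: "lin_ext g (Poly_Mapping.single w c) = c * g (letters w)"
  using lin_ext_superset[of "{w}" "Poly_Mapping.single w c" g] by (simp split: if_splits)

lemma lin_ext_one: "lin_ext g 1 = g []"
  unfolding single_one[symmetric] by (simp add: zero_ncword_def)

lemma lin_ext_cong:
  assumes "\<And>w. w \<in> Poly_Mapping.keys p \<Longrightarrow> g (letters w) = h (letters w)"
  shows "lin_ext g p = lin_ext h p"
  unfolding lin_ext_def using assms by (intro sum.cong) auto

lemma lin_ext_mult_left: "lin_ext (\<lambda>w. z * g w) p = z * lin_ext g p"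
  unfolding lin_ext_def sum_distrib_left by (simp only: mult_ac)

lemma lin_ext_mult_right: "lin_ext (\<lambda>w. g w * z) p = lin_ext g p * z"
  unfolding lin_ext_def sum_distrib_right by (simp only: mult_ac)

lemma ncpoly_sum_singles: "p = (\<Sum>w\<in>Poly_Mapping.keys p. Poly_Mapping.single w (Poly_Mapping.lookup p w))"
proof (rule poly_mapping_eqI)
  fix v
  show "Poly_Mapping.lookup p v =
      Poly_Mapping.lookup (\<Sum>w\<in>Poly_Mapping.keys p. Poly_Mapping.single w (Poly_Mapping.lookup p w)) v"
    by (cases "v \<in> Poly_Mapping.keys p")
      (simp_all add: lookup_sum lookup_single when_def in_keys_iff)
qed

lemma ncpoly_mult_singles:
  "p * q = (\<Sum>u\<in>Poly_Mapping.keys p. \<Sum>v\<in>Poly_Mapping.keys q.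
     Poly_Mapping.single (u + v) (Poly_Mapping.lookup p u * Poly_Mapping.lookup q v))"
proof -
  have "p * q = (\<Sum>u\<in>Poly_Mapping.keys p. Poly_Mapping.single u (Poly_Mapping.lookup p u)) *
      (\<Sum>v\<in>Poly_Mapping.keys q. Poly_Mapping.single v (Poly_Mapping.lookup q v))"
    by (simp only: ncpoly_sum_singles[symmetric])
  then show ?thesis by (simp only: sum_product mult_single)
qed

text \<open>The nested form lets an identity between values at words pass to polynomials by
  \<open>lin_ext_cong\<close>, one factor of the product at a time.\<close>

lemma lin_ext_mult: "lin_ext g (p * q) = lin_ext (\<lambda>u. lin_ext (\<lambda>v. g (u @ v)) q) p"
  unfolding ncpoly_mult_singles[of p q] lin_ext_sum lin_ext_single
  by (simp add: lin_ext_def plus_ncword_def sum_distrib_left mult.assoc)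

lemma lookup_nc_scale [simp]: "Poly_Mapping.lookup (nc_scale c p) w = c * Poly_Mapping.lookup p w"
  unfolding nc_scale_def by (simp add: Poly_Mapping.map.rep_eq when_def)

lemma nc_scale_eq_mult: "nc_scale c p = Poly_Mapping.single 0 c * p"
  unfolding nc_scale_def by (rule mult_map_scale_conv_mult)

lemma keys_nc_scale: "Poly_Mapping.keys (nc_scale c p) \<subseteq> Poly_Mapping.keys p"
  by (auto simp: in_keys_iff)

lemma lin_ext_scale: "lin_ext g (nc_scale c p) = c * lin_ext g p"
  unfolding nc_scale_eq_mult lin_ext_mult by (simp add: zero_ncword_def)

lemma nc_scale_mult_left: "nc_scale c x * y = nc_scale c (x * y)"
  by (simp only: nc_scale_eq_mult mult.assoc)

lemma nc_scale_mult_right: "x * nc_scale c y = nc_scale c (x * y)"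
proof -
  \<comment> \<open>Multiples of the empty word are central.\<close>
  have "x * Poly_Mapping.single 0 c = Poly_Mapping.single 0 c * x"
    unfolding ncpoly_mult_singles[of x] ncpoly_mult_singles[of _ x]
    by (cases "c = 0") (simp_all add: mult.commute)
  then show ?thesis by (simp only: nc_scale_eq_mult mult.assoc[symmetric])
qed

lemma vector_space_nc_scale: "vector_space nc_scale"
  by unfold_locales (auto intro!: poly_mapping_eqI simp: lookup_add algebra_simps)

lemma ncpolysI: "(\<And>w. w \<in> Poly_Mapping.keys p \<Longrightarrow> set (letters w) \<subseteq> S) \<Longrightarrow> p \<in> ncpolys S"
  by (simp add: ncpolys_def)

lemma ncpolysD: "p \<in> ncpolys S \<Longrightarrow> w \<in> Poly_Mapping.keys p \<Longrightarrow> set (letters w) \<subseteq> S"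
  by (auto simp: ncpolys_def)

lemma unital_subalgebra_ncpolys: "unital_subalgebra nc_scale (ncpolys S)"
  unfolding unital_subalgebra_def
proof (intro conjI ballI allI)
  show "1 \<in> ncpolys S"
    by (rule ncpolysI) (simp add: zero_ncword_def)
next
  fix x y assume x: "x \<in> ncpolys S" and y: "y \<in> ncpolys S"
  show "x + y \<in> ncpolys S"
    using Poly_Mapping.keys_add[of x y] ncpolysD[OF x] ncpolysD[OF y] by (intro ncpolysI) blast
  show "x * y \<in> ncpolys S"
  proof (rule ncpolysI)
    fix w assume "w \<in> Poly_Mapping.keys (x * y)"
    then obtain u v where "u \<in> Poly_Mapping.keys x" "v \<in> Poly_Mapping.keys y" "w = u + v"
      using Poly_Mapping.keys_mult[of x y] by blast
    then show "set (letters w) \<subseteq> S"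
      using ncpolysD[OF x, of u] ncpolysD[OF y, of v] by (simp add: plus_ncword_def)
  qed
next
  fix c x assume "x \<in> ncpolys S"
  then show "nc_scale c x \<in> ncpolys S"
    using keys_nc_scale[of c x] ncpolysD by (intro ncpolysI) blast
qed

lemma ncpolys_mono: "S \<subseteq> T \<Longrightarrow> ncpolys S \<subseteq> ncpolys T"
  by (auto simp: ncpolys_def)

text \<open>Freeness passes to smaller sets, so through this inclusion it is inherited by the
  generated unital algebras from the polynomials in the respective indeterminates.\<close>

lemma hull_nc_var_subset: "unital_subalgebra nc_scale hull (nc_var ` S) \<subseteq> ncpolys S"
proof (rule hull_minimal)
  show "nc_var ` S \<subseteq> ncpolys S" by (auto simp: nc_var_def ncpolys_def)
qed (rule unital_subalgebra_ncpolys)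

section \<open>The involution on polynomials\<close>

definition rev_word :: "('x \<Rightarrow> 'x) \<Rightarrow> 'x ncword \<Rightarrow> 'x ncword" where
  "rev_word s w = NCWord (rev (map s (letters w)))"

context
  fixes s :: "'x \<Rightarrow> 'x"
  assumes s: "\<And>x. s (s x) = x"
begin

lemma rev_word_rev_word: "rev_word s (rev_word s w) = w"
  by (cases w) (simp add: rev_word_def rev_map s comp_def)

text \<open>Reversal of words is an involution, so exactly one word can contribute to a given
  coefficient. The additive and involutive laws then hold coefficient by coefficient.\<close>

lemma lookup_nc_star: "Poly_Mapping.lookup (nc_star s p) w = cnj (Poly_Mapping.lookup p (rev_word s w))"
proof -
  have eq: "rev_word s v = w \<longleftrightarrow> v = rev_word s w" for v
    using rev_word_rev_word by metis
  have "Poly_Mapping.lookup (nc_star s p) w =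
      (\<Sum>v\<in>Poly_Mapping.keys p. if v = rev_word s w then cnj (Poly_Mapping.lookup p v) else 0)"
    unfolding nc_star_def rev_word_def[symmetric] lookup_sum lookup_single
    by (rule sum.cong) (simp_all add: when_def eq)
  then show ?thesis by (simp add: in_keys_iff)
qed

lemma nc_star_nc_star: "nc_star s (nc_star s p) = p"
  by (rule poly_mapping_eqI) (simp add: lookup_nc_star rev_word_rev_word)

lemma nc_star_add: "nc_star s (p + q) = nc_star s p + nc_star s q"
  by (rule poly_mapping_eqI) (simp add: lookup_nc_star lookup_add)

lemma nc_star_scale: "nc_star s (nc_scale c p) = nc_scale (cnj c) (nc_star s p)"
  by (rule poly_mapping_eqI) (simp add: lookup_nc_star)

lemma nc_star_sum: "nc_star s (\<Sum>i\<in>I. f i) = (\<Sum>i\<in>I. nc_star s (f i))"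
  by (rule poly_mapping_eqI) (simp add: lookup_nc_star lookup_sum)

lemma nc_star_single: "nc_star s (Poly_Mapping.single w c) = Poly_Mapping.single (rev_word s w) (cnj c)"
proof (rule poly_mapping_eqI)
  fix v
  have "w = rev_word s v \<longleftrightarrow> rev_word s w = v" using rev_word_rev_word by metis
  then show "Poly_Mapping.lookup (nc_star s (Poly_Mapping.single w c)) v =
      Poly_Mapping.lookup (Poly_Mapping.single (rev_word s w) (cnj c)) v"
    by (simp add: lookup_nc_star lookup_single when_def)
qed

lemma nc_star_mult: "nc_star s (p * q) = nc_star s q * nc_star s p"
proof -
  have r: "rev_word s (u + v) = rev_word s v + rev_word s u" for u v
    by (simp add: rev_word_def plus_ncword_def)
  have star: "nc_star s p = (\<Sum>w\<in>Poly_Mapping.keys p. Poly_Mapping.single (rev_word s w) (cnj (Poly_Mapping.lookup p w)))" for p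
    by (simp add: nc_star_def rev_word_def)
  have "nc_star s (p * q) = (\<Sum>u\<in>Poly_Mapping.keys p. \<Sum>v\<in>Poly_Mapping.keys q.
     Poly_Mapping.single (rev_word s v + rev_word s u) (cnj (Poly_Mapping.lookup p u) * cnj (Poly_Mapping.lookup q v)))"
    unfolding ncpoly_mult_singles[of p q] nc_star_sum nc_star_single r by simp
  also have "\<dots> = (\<Sum>v\<in>Poly_Mapping.keys q. \<Sum>u\<in>Poly_Mapping.keys p.
     Poly_Mapping.single (rev_word s v + rev_word s u) (cnj (Poly_Mapping.lookup q v) * cnj (Poly_Mapping.lookup p u)))"
    by (subst sum.swap) (simp only: mult.commute)
  also have "\<dots> = nc_star s q * nc_star s p"
    unfolding star[of p] star[of q] sum_product mult_single ..
  finally show ?thesis .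
qed

lemma nc_star_ncpolys:
  assumes p: "p \<in> ncpolys S" and S: "s ` S \<subseteq> S"
  shows "nc_star s p \<in> ncpolys S"
proof (rule ncpolysI)
  fix w assume "w \<in> Poly_Mapping.keys (nc_star s p)"
  then have "rev_word s w \<in> Poly_Mapping.keys p" by (simp add: in_keys_iff lookup_nc_star)
  from ncpolysD[OF p this] have "s ` set (letters w) \<subseteq> S" by (simp add: rev_word_def)
  then have "s ` s ` set (letters w) \<subseteq> S" using S by blast
  then show "set (letters w) \<subseteq> S" by (simp add: image_image s)
qed

end

lemma infinitesimal_ncps_lin_ext:
  assumes s: "\<And>x. s (s x) = x" and S: "s ` S \<subseteq> S" and "g [] = 1" "h [] = 0"
  shows "infinitesimal_ncps nc_scale (ncpolys S) (nc_star s) (lin_ext g) (lin_ext h)"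
proof -
  interpret vector_space nc_scale by (rule vector_space_nc_scale)
  show ?thesis
    by unfold_locales
      (simp_all add: nc_scale_mult_left nc_scale_mult_right unital_subalgebra_ncpolys
        nc_star_ncpolys[OF s _ S] nc_star_nc_star[OF s] nc_star_add[OF s] nc_star_mult[OF s]
        nc_star_scale[OF s] lin_ext_add lin_ext_scale lin_ext_one assms)
qed

lemma inf_free_subalgebras_mono:
  assumes "inf_free_subalgebras \<phi> \<phi>' C1 C2" "B1 \<subseteq> C1" "B2 \<subseteq> C2"
  shows "inf_free_subalgebras \<phi> \<phi>' B1 B2"
  unfolding inf_free_subalgebras_def
proof (intro allI impI)
  fix xs :: "'a list" and ind :: "nat \<Rightarrow> nat"
  assume *: "xs \<noteq> [] \<and> (\<forall>m<length xs. ind m \<in> {1, 2} \<and> xs ! m \<in> (if ind m = 1 then B1 else B2)) \<and>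
        (\<forall>m. Suc m < length xs \<longrightarrow> ind m \<noteq> ind (Suc m)) \<and> (\<forall>m<length xs. \<phi> (xs ! m) = 0)"
  have "\<forall>m<length xs. ind m \<in> {1, 2} \<and> xs ! m \<in> (if ind m = 1 then C1 else C2)"
    using * assms(2,3) by (auto split: if_splits)
  with * assms(1) show "\<phi> (prod_list xs) = 0 \<and>
        \<phi>' (prod_list xs) =
          (\<Sum>j<length xs. \<phi>' (xs ! j) * \<phi> (prod_list (take j xs @ drop (Suc j) xs)))"
    unfolding inf_free_subalgebras_def by blast
qed

section \<open>Words with matrix units\<close>

lemma word_entry_append:
  "i < N \<Longrightarrow> word_entry F N (u @ v) i j = (\<Sum>a<N. word_entry F N u i a * word_entry F N v a j)"
proof (induction u arbitrary: i)
  case Nil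
  have "(\<Sum>a<N. word_entry F N [] i a * word_entry F N v a j) = (\<Sum>a<N. of_bool (a = i) * word_entry F N v a j)"
    by (rule sum.cong) auto
  then show ?case using Nil sum_of_bool_eq[of "{..<N}" i "\<lambda>a. word_entry F N v a j"] by simp
next
  case (Cons x u)
  have "word_entry F N ((x # u) @ v) i j = (\<Sum>b<N. F x i b * (\<Sum>a<N. word_entry F N u b a * word_entry F N v a j))"
    unfolding append_Cons word_entry.simps by (rule sum.cong[OF refl]) (simp only: Cons.IH lessThan_iff)
  also have "\<dots> = (\<Sum>a<N. (\<Sum>b<N. F x i b * word_entry F N u b a) * word_entry F N v a j)"
    unfolding sum_distrib_left sum_distrib_right by (subst sum.swap) (simp only: mult.assoc)
  finally show ?case by simp
qed

lemma word_entry_trace_cyclic: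
  "(\<Sum>i<N. word_entry F N (u @ v) i i) = (\<Sum>i<N. word_entry F N (v @ u) i i)"
proof -
  have "(\<Sum>i<N. word_entry F N (u @ v) i i) = (\<Sum>i<N. \<Sum>a<N. word_entry F N u i a * word_entry F N v a i)"
    by (rule sum.cong) (simp_all only: word_entry_append lessThan_iff)
  also have "\<dots> = (\<Sum>a<N. \<Sum>i<N. word_entry F N v a i * word_entry F N u i a)"
    by (subst sum.swap) (simp only: mult.commute)
  also have "\<dots> = (\<Sum>i<N. word_entry F N (v @ u) i i)"
    by (rule sum.cong) (simp_all only: word_entry_append lessThan_iff)
  finally show ?thesis .
qed

lemma word_entry_map: "word_entry F N (map g w) i j = word_entry (\<lambda>x. F (g x)) N w i j"
  by (induction w arbitrary: i) simp_all

text \<open>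
  Cutting a word at the matrix units: the \<open>(j, i)\<close> entry of \<open>q w\<close> is the product of the entries
  listed in \<open>segments j q w i\<close>, which only involve words in the \<open>a\<^sub>r\<close>.
\<close>

fun segments :: "nat \<Rightarrow> nat list \<Rightarrow> indet list \<Rightarrow> nat \<Rightarrow> item list" where
  "segments j q [] i = [(q, j, i)]"
| "segments j q (Ind_a r # w) i = segments j (q @ [r]) w i"
| "segments j q (Ind_e a b # w) i = (q, j, a) # segments b [] w i"

lemma segments_append_e:
  "segments j q (u @ Ind_e a b # v) i = segments j q u a @ segments b [] v i"
  by (induction j q u a rule: segments.induct) simp_all

lemma segments_a: "segments j q (map Ind_a x @ w) i = segments j (q @ x) w i"
  by (induction x arbitrary: q) simp_all

lemma segments_a': "segments j q (map Ind_a x) i = [(q @ x, j, i)]"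
  using segments_a[of j q x "[]"] by simp

lemma ok_segments:
  assumes "set q \<subseteq> {..<k}" "set w \<subseteq> a_indets k \<union> e_indets n" "j < n" "i < n" "t \<in> set (segments j q w i)"
  shows "ok_item k n t"
  using assms
  by (induction j q w i rule: segments.induct) (auto simp: ok_item_def a_indets_def e_indets_def)

definition indet_entry :: "nat \<Rightarrow> (nat \<Rightarrow> complex mat) \<Rightarrow> indet \<Rightarrow> nat \<Rightarrow> nat \<Rightarrow> complex" where
  "indet_entry N X x i j = assign N X x $$ (i, j)"

lemma word_entry_segments:
  assumes "set w \<subseteq> a_indets k \<union> e_indets N" "j < N" "i < N"
  shows "word_entry (indet_entry N X) N (map Ind_a q @ w) j i =
    (\<Prod>(v, x, y)\<leftarrow>segments j q w i. word_entry (\<lambda>r i j. X r $$ (i, j)) N v x y)"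
  using assms
proof (induction j q w i rule: segments.induct)
  case (1 j q i)
  have "(\<lambda>x. indet_entry N X (Ind_a x)) = (\<lambda>r i j. X r $$ (i, j))"
    by (simp add: indet_entry_def fun_eq_iff)
  then show ?case by (simp add: word_entry_map)
next
  case (2 j q r w i)
  then show ?case by simp
next
  case (3 j q a b w i)
  have ab: "a < N" "b < N" using 3(2) by (auto simp: a_indets_def e_indets_def)
  have F: "(\<lambda>x. indet_entry N X (Ind_a x)) = (\<lambda>r i j. X r $$ (i, j))"
    by (simp add: indet_entry_def fun_eq_iff)
  \<comment> \<open>A leading matrix unit forces the row index to be \<open>a\<close> and restarts
    the word at row \<open>b\<close>; the sum over the index in front of it thus collapses and the
    product of entries splits there.\<close>
  have e: "word_entry (indet_entry N X) N (Ind_e a b # w) c i = of_bool (c = a) * word_entry (indet_entry N X) N w b i"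
    if c: "c < N" for c
  proof -
    have "word_entry (indet_entry N X) N (Ind_e a b # w) c i =
      (\<Sum>d<N. of_bool (d = b) * (of_bool (c = a) * word_entry (indet_entry N X) N w d i))"
      unfolding word_entry.simps
      by (rule sum.cong) (use c in \<open>auto simp: indet_entry_def matrix_unit_def\<close>)
    also have "\<dots> = of_bool (c = a) * word_entry (indet_entry N X) N w b i"
      by (rule sum_of_bool_eq) (use ab in auto)
    finally show ?thesis .
  qed
  have "word_entry (indet_entry N X) N (map Ind_a q @ Ind_e a b # w) j i =
     (\<Sum>c<N. word_entry (indet_entry N X) N (map Ind_a q) j c * word_entry (indet_entry N X) N (Ind_e a b # w) c i)"
    by (rule word_entry_append[OF 3(3)])
  also have "\<dots> = (\<Sum>c<N. of_bool (c = a) *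
      (word_entry (\<lambda>r i j. X r $$ (i, j)) N q j c * word_entry (indet_entry N X) N w b i))"
    unfolding word_entry_map F
    by (rule sum.cong[OF refl]) (simp only: e lessThan_iff mult.left_commute)
  also have "\<dots> = word_entry (\<lambda>r i j. X r $$ (i, j)) N q j a * word_entry (indet_entry N X) N w b i"
    by (rule sum_of_bool_eq) (use ab in auto)
  finally show ?case using 3 ab by simp
qed

definition is_e :: "indet \<Rightarrow> bool" where
  "is_e x \<longleftrightarrow> (\<exists>a b. x = Ind_e a b)"

lemma indet_list_cases:
  obtains (pure) x where "w = map Ind_a x"
  | (e) x a b v where "w = map Ind_a x @ Ind_e a b # v"
proof -
  have "(\<exists>x. w = map Ind_a x) \<or> (\<exists>x a b v. w = map Ind_a x @ Ind_e a b # v)"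
  proof (induction w)
    case (Cons y w)
    show ?case
    proof (cases y)
      case (Ind_a r)
      from Cons consider x where "w = map Ind_a x" | x a b v where "w = map Ind_a x @ Ind_e a b # v" by blast
      then show ?thesis
      proof cases
        case 1
        then have "y # w = map Ind_a (r # x)" by (simp add: Ind_a)
        then show ?thesis by (intro disjI1 exI)
      next
        case 2
        then have "y # w = map Ind_a (r # x) @ Ind_e a b # v" by (simp add: Ind_a)
        then show ?thesis by (intro disjI2 exI)
      qed
    next
      case (Ind_e a b)
      then have "y # w = map Ind_a [] @ Ind_e a b # w" by simp
      then show ?thesis by (intro disjI2 exI)
    qed
  qed simp
  then show thesis using pure e by blast
qed

lemma set_map_Ind_a: "set (map Ind_a x) \<subseteq> a_indets k \<union> e_indets n \<longleftrightarrow> set x \<subseteq> {..<k}"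
  by (auto simp: a_indets_def e_indets_def)

lemma set_a_indets:
  assumes "set w \<subseteq> a_indets k"
  obtains x where "w = map Ind_a x" "set x \<subseteq> {..<k}"
proof (cases w rule: indet_list_cases)
  case (pure x)
  have "set x \<subseteq> {..<k}" using assms unfolding pure by (auto simp: a_indets_def)
  with pure show ?thesis by (rule that)
next
  case (e x a b v)
  then show ?thesis using assms by (auto simp: a_indets_def)
qed

section \<open>The limit functionals on words\<close>

text \<open>
  The values of \<open>\<tau>\<close> and \<open>\<tau>'\<close> at the word \<open>q w\<close>; \<open>q\<close> accumulates the letters before the first matrix
  unit.
\<close>

fun leading :: "(nat list \<Rightarrow> complex) \<Rightarrow> nat list \<Rightarrow> indet list \<Rightarrow> complex" where
  "leading t q [] = t q"
| "leading t q (Ind_a r # w) = leading t (q @ [r]) w"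
| "leading t q (Ind_e a b # w) = 0"

fun correction :: "(nat list \<Rightarrow> complex) \<Rightarrow> (nat list \<Rightarrow> complex) \<Rightarrow> nat list \<Rightarrow> indet list \<Rightarrow> complex" where
  "correction t t' q [] = t' q"
| "correction t t' q (Ind_a r # w) = correction t t' (q @ [r]) w"
| "correction t t' q (Ind_e a b # w) = items_limit t (segments b [] (w @ map Ind_a q) a)"

lemma leading_a: "leading t q (map Ind_a x) = t (q @ x)"
  by (induction x arbitrary: q) simp_all

lemma leading_e: "leading t q (u @ Ind_e a b # v) = 0"
  by (induction t q u rule: leading.induct) simp_all

lemma correction_a: "correction t t' q (map Ind_a x) = t' (q @ x)"
  by (induction x arbitrary: q) simp_all

lemma items_limit_append: "items_limit t (S @ T) = items_limit t S * items_limit t T"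
  by (simp add: items_limit_def)

text \<open>The definition cuts the cyclic word at its first matrix unit. Cutting at another one
  produces the same segments in a different order, and the product over the segments is
  commutative.\<close>

lemma correction_e:
  "correction t t' q (u @ Ind_e a b # v) = items_limit t (segments b [] (v @ map Ind_a q @ u) a)"
proof (induction u arbitrary: q)
  case (Cons x u)
  show ?case
  proof (cases x)
    case (Ind_a r)
    then show ?thesis using Cons[of "q @ [r]"] by simp
  next
    case (Ind_e c d)
    have "correction t t' q ((x # u) @ Ind_e a b # v) =
        items_limit t (segments d [] (u @ Ind_e a b # (v @ map Ind_a q)) c)"
      by (simp add: Ind_e)
    also have "\<dots> = items_limit t (segments b [] ((v @ map Ind_a q) @ Ind_e c d # u) a)"
      unfolding segments_append_e items_limit_append by (rule mult.commute)
    finally show ?thesis by (simp add: Ind_e)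
  qed
qed simp

text \<open>The word \<open>x\<close> between the two matrix units is one segment from index
  \<open>b\<close> to index \<open>c\<close>. Its limit is a delta times \<open>t x\<close>;
  removing \<open>x\<close> leaves the empty segment with the same delta, whose value is
  \<open>t [] = 1\<close>.\<close>

lemma correction_between:
  assumes t: "t [] = 1"
  shows "correction t t' [] (u @ Ind_e a b # map Ind_a x @ Ind_e c d # v) =
    t x * correction t t' [] (u @ Ind_e a b # Ind_e c d # v)"
  unfolding correction_e
  by (simp add: segments_append_e segments_a' items_limit_append items_limit_Cons t)

text \<open>Cyclically, the last word \<open>v\<close> is followed by the first word
  \<open>u\<close>, and together they form the segment between the last and the first matrix unit of
  \<open>w\<close>. If \<open>w\<close> is a single unit, that segment is the only one.\<close>

lemma correction_around:
  assumes t: "t [] = 1" and w: "w \<noteq> []" "\<And>x. x \<in> set w \<Longrightarrow> is_e x"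
  shows "correction t t' [] (map Ind_a u @ w @ map Ind_a v) = t (v @ u) * correction t t' [] w"
proof -
  obtain x0 w' where "w = x0 # w'" using w(1) by (meson neq_Nil_conv)
  moreover from this obtain a b where "x0 = Ind_e a b" using w(2)[of x0] by (auto simp: is_e_def)
  ultimately have w': "w = Ind_e a b # w'" by simp
  show ?thesis
  proof (cases w' rule: rev_cases)
    case Nil
    have "segments b [] (map Ind_a (v @ u)) a = [(v @ u, b, a)]"
      by (simp only: segments_a' append_Nil)
    then show ?thesis using correction_e[of t t' "[]" "map Ind_a u" a b "map Ind_a v"] t
      by (simp add: w' Nil items_limit_Cons)
  next
    case (snoc w'' x)
    then obtain c d where x: "x = Ind_e c d" using w(2)[of x] by (auto simp: w' is_e_def)
    have "segments d [] (map Ind_a (v @ u)) a = [(v @ u, d, a)]"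
      by (simp only: segments_a' append_Nil)
    then show ?thesis using correction_e[of t t' "[]" "map Ind_a u" a b "w' @ map Ind_a v"] t
      by (simp add: w' snoc x segments_append_e items_limit_append items_limit_Cons)
  qed
qed

lemma mat_tr_nc_eval:
  assumes "\<And>w x. w \<in> Poly_Mapping.keys p \<Longrightarrow> x \<in> set (letters w) \<Longrightarrow> f x \<in> carrier_mat N N"
  shows "mat_tr (nc_eval N f p) = lin_ext (\<lambda>w. \<Sum>i<N. word_entry (\<lambda>x i j. f x $$ (i, j)) N w i i) p"
proof -
  have "mat_tr (nc_eval N f p) = (\<Sum>i<N. \<Sum>w\<in>Poly_Mapping.keys p.
      Poly_Mapping.lookup p w * word_mat N f (letters w) $$ (i, i))"
    by (simp add: mat_tr_def nc_eval_def word_mat_def)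
  also have "\<dots> = (\<Sum>w\<in>Poly_Mapping.keys p. \<Sum>i<N. Poly_Mapping.lookup p w * word_mat N f (letters w) $$ (i, i))"
    by (rule sum.swap)
  also have "\<dots> = (\<Sum>w\<in>Poly_Mapping.keys p. \<Sum>i<N. Poly_Mapping.lookup p w * word_entry (\<lambda>x i j. f x $$ (i, j)) N (letters w) i i)"
  proof (intro sum.cong refl)
    fix w i assume w: "w \<in> Poly_Mapping.keys p" and "i \<in> {..<N}"
    then have "word_mat N f (letters w) $$ (i, i) = word_entry (\<lambda>x i j. f x $$ (i, j)) N (letters w) i i"
      by (intro word_mat_index assms[OF w]) auto
    then show "Poly_Mapping.lookup p w * word_mat N f (letters w) $$ (i, i) =
        Poly_Mapping.lookup p w * word_entry (\<lambda>x i j. f x $$ (i, j)) N (letters w) i i" by simp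
  qed
  finally show ?thesis by (simp only: lin_ext_def sum_distrib_left)
qed

lemma assign_carrier:
  assumes "x \<in> a_indets k \<union> e_indets n" "\<And>r. r < k \<Longrightarrow> X r \<in> carrier_mat N N"
  shows "assign N X x \<in> carrier_mat N N"
  using assms by (auto simp: a_indets_def e_indets_def matrix_unit_def)

section \<open>Expected traces of polynomials and their limits\<close>

context moment_model
begin

definition word_trace :: "nat \<Rightarrow> indet list \<Rightarrow> complex" where
  "word_trace N w = (\<integral>\<omega>. (\<Sum>i<N. word_entry (indet_entry N (\<lambda>r. A N r \<omega>)) N w i i) \<partial>M N)"

lemma word_entry_items:
  assumes "set w \<subseteq> a_indets k \<union> e_indets N" "j < N" "i < N"
  shows "word_entry (indet_entry N (\<lambda>r. A N r \<omega>)) N w j i = items_prod (mat_entries (A N)) N (segments j [] w i) \<omega>"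
  using word_entry_segments[OF assms, of "\<lambda>r. A N r \<omega>" "[]"] by (simp add: items_prod_def)

lemma indets_mono: "n \<le> N \<Longrightarrow> a_indets k \<union> e_indets n \<subseteq> a_indets k \<union> e_indets N"
  by (auto simp: e_indets_def)

lemma integrable_word_entry:
  assumes N: "N \<ge> N0" and w: "set w \<subseteq> a_indets k \<union> e_indets N0" and ij: "j < N" "i < N"
  shows "integrable (M N) (\<lambda>\<omega>. word_entry (indet_entry N (\<lambda>r. A N r \<omega>)) N w j i)"
proof -
  have w': "set w \<subseteq> a_indets k \<union> e_indets N" using w indets_mono[OF N] by blast
  have "integrable (M N) (items_prod (mat_entries (A N)) N (segments j [] w i))"
    by (rule integrable_items[OF N ok_segments[OF _ w' ij]]) simp_all
  then show ?thesis unfolding word_entry_items[OF w' ij] .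
qed

lemma expected_trace_eq:
  assumes N: "N \<ge> N0" and p: "p \<in> ncpolys (a_indets k \<union> e_indets N0)"
  shows "expected_trace M A N p = lin_ext (word_trace N) p"
proof -
  have w: "set (letters w) \<subseteq> a_indets k \<union> e_indets N0" if "w \<in> Poly_Mapping.keys p" for w
    by (rule ncpolysD[OF p that])
  have "expected_trace M A N p =
      (\<integral>\<omega>. lin_ext (\<lambda>w. \<Sum>i<N. word_entry (indet_entry N (\<lambda>r. A N r \<omega>)) N w i i) p \<partial>M N)"
    unfolding expected_trace_def
  proof (rule Bochner_Integration.integral_cong[OF refl])
    fix \<omega> assume \<omega>: "\<omega> \<in> space (M N)"
    show "mat_tr (nc_eval N (assign N (\<lambda>j. A N j \<omega>)) p) =
        lin_ext (\<lambda>w. \<Sum>i<N. word_entry (indet_entry N (\<lambda>r. A N r \<omega>)) N w i i) p"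
      unfolding indet_entry_def
      by (rule mat_tr_nc_eval, rule assign_carrier) (use w carrier[OF N _ \<omega>] in blast)+
  qed
  also have "\<dots> = lin_ext (word_trace N) p"
    unfolding lin_ext_def word_trace_def integral_mult_right_zero[symmetric]
    by (intro Bochner_Integration.integral_sum integrable_mult_right Bochner_Integration.integrable_sum
        integrable_word_entry[OF N w]) auto
  finally show ?thesis .
qed

lemma word_trace_pure:
  assumes "N \<ge> N0" "set x \<subseteq> {..<k}"
  shows "word_trace N (map Ind_a x) = (\<Sum>i<N. \<integral>\<omega>. items_prod (mat_entries (A N)) N [(x, i, i)] \<omega> \<partial>M N)"
proof -
  have x: "set (map Ind_a x) \<subseteq> a_indets k \<union> e_indets n" for n using assms(2) by (auto simp: a_indets_def)
  have "word_trace N (map Ind_a x) = (\<Sum>i<N. \<integral>\<omega>. word_entry (indet_entry N (\<lambda>r. A N r \<omega>)) N (map Ind_a x) i i \<partial>M N)"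
    unfolding word_trace_def
    by (rule Bochner_Integration.integral_sum) (simp add: integrable_word_entry[OF assms(1) x])
  also have "\<dots> = (\<Sum>i<N. \<integral>\<omega>. items_prod (mat_entries (A N)) N [(x, i, i)] \<omega> \<partial>M N)"
    by (rule sum.cong[OF refl]) (simp only: word_entry_items[OF x] lessThan_iff segments_a' append_Nil)
  finally show ?thesis .
qed

text \<open>Rotated to the front, the matrix unit \<open>(a, b)\<close> annihilates every diagonal
  term except the one at \<open>a\<close>, where the entry \<open>(b, a)\<close> of the remaining
  word is left. The trace becomes a single product of entries, without a sum over N indices.\<close>

lemma word_trace_e:
  assumes N: "N \<ge> N0" and w: "set (u @ Ind_e a b # v) \<subseteq> a_indets k \<union> e_indets N0"
  shows "word_trace N (u @ Ind_e a b # v) = (\<integral>\<omega>. items_prod (mat_entries (A N)) N (segments b [] (v @ u) a) \<omega> \<partial>M N)"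
  unfolding word_trace_def
proof (rule Bochner_Integration.integral_cong[OF refl])
  fix \<omega>
  let ?F = "indet_entry N (\<lambda>r. A N r \<omega>)"
  have ab: "a < N" "b < N" using w N by (auto simp: a_indets_def e_indets_def)
  have w': "set (v @ u) \<subseteq> a_indets k \<union> e_indets N" using w indets_mono[OF N] by auto
  have "(\<Sum>i<N. word_entry ?F N (u @ Ind_e a b # v) i i) = (\<Sum>i<N. word_entry ?F N (Ind_e a b # (v @ u)) i i)"
    using word_entry_trace_cyclic[of ?F N u "Ind_e a b # v"] by simp
  also have "\<dots> = (\<Sum>i<N. of_bool (i = a) * word_entry ?F N (v @ u) b i)"
  proof (rule sum.cong[OF refl])
    fix i assume "i \<in> {..<N}"
    then have i: "i < N" by simp
    have "word_entry ?F N (Ind_e a b # (v @ u)) i i = (\<Sum>d<N. of_bool (d = b) * (of_bool (i = a) * word_entry ?F N (v @ u) d i))"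
      unfolding word_entry.simps
      by (rule sum.cong) (use i in \<open>auto simp: indet_entry_def matrix_unit_def\<close>)
    also have "\<dots> = of_bool (i = a) * word_entry ?F N (v @ u) b i"
      by (rule sum_of_bool_eq) (use ab in auto)
    finally show "word_entry ?F N (Ind_e a b # (v @ u)) i i = of_bool (i = a) * word_entry ?F N (v @ u) b i" .
  qed
  also have "\<dots> = word_entry ?F N (v @ u) b a"
    by (rule sum_of_bool_eq) (use ab in auto)
  finally show "(\<Sum>i<N. word_entry ?F N (u @ Ind_e a b # v) i i) =
      items_prod (mat_entries (A N)) N (segments b [] (v @ u) a) \<omega>"
    unfolding word_entry_items[OF w' ab(2,1)] .
qed

lemma word_trace_e_tendsto:
  assumes w: "set (u @ Ind_e a b # v) \<subseteq> a_indets k \<union> e_indets N0"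
  shows "(\<lambda>N. word_trace N (u @ Ind_e a b # v)) \<longlonglongrightarrow> items_limit t (segments b [] (v @ u) a)"
proof -
  have "(\<lambda>N. \<integral>\<omega>. items_prod (mat_entries (A N)) N (segments b [] (v @ u) a) \<omega> \<partial>M N) \<longlonglongrightarrow>
      items_limit t (segments b [] (v @ u) a)"
  proof (rule items_tendsto, rule ok_segments)
    show "set (v @ u) \<subseteq> a_indets k \<union> e_indets N0" using w by auto
    show "b < N0" "a < N0" using w by (auto simp: a_indets_def e_indets_def)
  qed auto
  then show ?thesis
    by (rule Lim_transform_eventually)
      (use eventually_ge_at_top[of N0] in eventually_elim, simp only: word_trace_e[OF _ w])
qed

lemma word_trace_pure_tendsto:
  assumes "set x \<subseteq> {..<k}"
  shows "(\<lambda>N. word_trace N (map Ind_a x) / of_nat N) \<longlonglongrightarrow> t x"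
  by (rule Lim_transform_eventually[OF trace_tendsto[OF assms]])
    (use eventually_ge_at_top[of N0] in eventually_elim, simp only: word_trace_pure[OF _ assms])

lemma word_trace_leading:
  assumes w: "set w \<subseteq> a_indets k \<union> e_indets N0"
  shows "(\<lambda>N. word_trace N w / of_nat N) \<longlonglongrightarrow> leading t [] w"
proof (cases w rule: indet_list_cases)
  case (pure x)
  then have "set x \<subseteq> {..<k}" using w set_map_Ind_a by blast
  from word_trace_pure_tendsto[OF this] show ?thesis by (simp add: pure leading_a)
next
  case (e x a b v)
  \<comment> \<open>The unnormalised trace already converges, so the factor 1/N makes the limit
    0.\<close>
  have "(\<lambda>N. word_trace N w * inverse (of_nat N)) \<longlonglongrightarrow> items_limit t (segments b [] (v @ map Ind_a x) a) * 0"
    unfolding e by (intro tendsto_mult word_trace_e_tendsto lim_inverse_n) (use w e in simp)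
  then show ?thesis by (simp add: e leading_e divide_inverse)
qed

lemma word_trace_correction:
  assumes w: "set w \<subseteq> a_indets k \<union> e_indets N0"
    and t': "\<And>x. set x \<subseteq> {..<k} \<Longrightarrow> (\<lambda>N. word_trace N (map Ind_a x) - of_nat N * t x) \<longlonglongrightarrow> t' x"
  shows "(\<lambda>N. word_trace N w - of_nat N * leading t [] w) \<longlonglongrightarrow> correction t t' [] w"
proof (cases w rule: indet_list_cases)
  case (pure x)
  then have "set x \<subseteq> {..<k}" using w set_map_Ind_a by blast
  from t'[OF this] show ?thesis by (simp add: pure leading_a correction_a)
next
  case (e x a b v)
  have "(\<lambda>N. word_trace N w) \<longlonglongrightarrow> items_limit t (segments b [] (v @ map Ind_a x) a)"
    unfolding e by (rule word_trace_e_tendsto) (use w e in simp)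
  then show ?thesis by (simp add: e leading_e correction_e)
qed

lemma lin_ext_tendsto:
  assumes p: "p \<in> ncpolys S" and "\<And>w. set w \<subseteq> S \<Longrightarrow> (\<lambda>N. g N w) \<longlonglongrightarrow> h w"
  shows "(\<lambda>N. lin_ext (g N) p) \<longlonglongrightarrow> lin_ext h p"
  unfolding lin_ext_def using ncpolysD[OF p] by (intro tendsto_sum tendsto_mult tendsto_const assms(2))

theorem expected_trace_leading:
  assumes p: "p \<in> ncpolys (a_indets k \<union> e_indets N0)"
  shows "(\<lambda>N. expected_trace M A N p / of_nat N) \<longlonglongrightarrow> lin_ext (leading t []) p"
proof (rule Lim_transform_eventually[OF lin_ext_tendsto[OF p word_trace_leading]])
  show "\<forall>\<^sub>F N in sequentially. lin_ext (\<lambda>w. word_trace N w / of_nat N) p = expected_trace M A N p / of_nat N"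
    using eventually_ge_at_top[of N0]
    by eventually_elim (simp only: expected_trace_eq[OF _ p] divide_inverse lin_ext_mult_right)
qed

theorem expected_trace_correction:
  assumes p: "p \<in> ncpolys (a_indets k \<union> e_indets N0)"
    and t': "\<And>x. set x \<subseteq> {..<k} \<Longrightarrow> (\<lambda>N. word_trace N (map Ind_a x) - of_nat N * t x) \<longlonglongrightarrow> t' x"
  shows "(\<lambda>N. expected_trace M A N p - of_nat N * lin_ext (leading t []) p) \<longlonglongrightarrow> lin_ext (correction t t' []) p"
proof (rule Lim_transform_eventually[OF lin_ext_tendsto[OF p word_trace_correction[OF _ t']]])
  show "\<forall>\<^sub>F N in sequentially. lin_ext (\<lambda>w. word_trace N w - of_nat N * leading t [] w) p =
      expected_trace M A N p - of_nat N * lin_ext (leading t []) p"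
    using eventually_ge_at_top[of N0]
  proof eventually_elim
    case (elim N)
    have "lin_ext (\<lambda>w. word_trace N w - of_nat N * leading t [] w) p =
        lin_ext (word_trace N) p - lin_ext (\<lambda>w. of_nat N * leading t [] w) p"
      unfolding lin_ext_def by (simp only: right_diff_distrib sum_subtractf)
    then show ?case by (simp only: expected_trace_eq[OF elim p] lin_ext_mult_left)
  qed
qed

lemma t_Nil: "t [] = 1"
proof -
  have "(\<lambda>N. word_trace N (map Ind_a []) / of_nat N) \<longlonglongrightarrow> t []"
    by (rule word_trace_pure_tendsto) simp
  moreover have "(\<lambda>N. word_trace N (map Ind_a []) / of_nat N) \<longlonglongrightarrow> 1"
  proof (rule Lim_transform_eventually[OF tendsto_const])
    show "\<forall>\<^sub>F N in sequentially. 1 = word_trace N (map Ind_a []) / of_nat N"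
      using eventually_ge_at_top[of N0] eventually_gt_at_top[of 0]
    proof eventually_elim
      case (elim N)
      interpret prob_space "M N" by (rule prob[OF elim(1)])
      show ?case using elim by (simp add: word_trace_def prob_space)
    qed
  qed
  ultimately show ?thesis by (rule LIMSEQ_unique)
qed

text \<open>Inherited from cyclicity of the trace at every size. The freeness formula needs it when
  two outer factors, joined around the trace, meet in the reversed order.\<close>

lemma t_cyclic:
  assumes "set u \<subseteq> {..<k}" "set v \<subseteq> {..<k}"
  shows "t (u @ v) = t (v @ u)"
proof (rule LIMSEQ_unique)
  show "(\<lambda>N. word_trace N (map Ind_a (u @ v)) / of_nat N) \<longlonglongrightarrow> t (u @ v)"
    by (rule word_trace_pure_tendsto) (use assms in simp)
  have "(\<lambda>N. word_trace N (map Ind_a (v @ u)) / of_nat N) \<longlonglongrightarrow> t (v @ u)"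
    by (rule word_trace_pure_tendsto) (use assms in simp)
  moreover have "word_trace N (map Ind_a (v @ u)) = word_trace N (map Ind_a (u @ v))" for N
    unfolding word_trace_def map_append by (subst word_entry_trace_cyclic) (rule refl)
  ultimately show "(\<lambda>N. word_trace N (map Ind_a (u @ v)) / of_nat N) \<longlonglongrightarrow> t (v @ u)" by simp
qed

lemma correction_Nil:
  assumes "(\<lambda>N. word_trace N (map Ind_a []) - of_nat N * t []) \<longlonglongrightarrow> c"
  shows "c = 0"
proof (rule LIMSEQ_unique[OF assms])
  show "(\<lambda>N. word_trace N (map Ind_a []) - of_nat N * t []) \<longlonglongrightarrow> 0"
  proof (rule Lim_transform_eventually[OF tendsto_const])
    show "\<forall>\<^sub>F N in sequentially. 0 = word_trace N (map Ind_a []) - of_nat N * t []"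
      using eventually_ge_at_top[of N0]
    proof eventually_elim
      case (elim N)
      interpret prob_space "M N" by (rule prob[OF elim])
      show ?case by (simp add: word_trace_def prob_space t_Nil)
    qed
  qed
qed

end

section \<open>Infinitesimal freeness\<close>

lemma prod_list_absorb:
  assumes mult: "\<And>a b. a \<in> J \<Longrightarrow> a * b \<in> J" "\<And>a b. b \<in> J \<Longrightarrow> a * b \<in> J"
    and x: "x \<in> set xs" "x \<in> J"
  shows "prod_list xs \<in> (J :: 'a::monoid_mult set)"
  using x(1) by (induction xs) (auto simp: x(2) mult)

lemma keys_multE:
  assumes "w \<in> Poly_Mapping.keys (p * q)"
  obtains u v where "u \<in> Poly_Mapping.keys p" "v \<in> Poly_Mapping.keys q" "letters w = letters u @ letters v"
  using assms Poly_Mapping.keys_mult[of p q] by (auto simp: plus_ncword_def)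

section \<open>Freeness for the limit functionals\<close>

locale limit_functionals =
  fixes t t' :: "nat list \<Rightarrow> complex" and k n :: nat
  assumes t_Nil: "t [] = 1" and t'_Nil: "t' [] = 0"
    and t_cyclic: "\<And>u v. set u \<subseteq> {..<k} \<Longrightarrow> set v \<subseteq> {..<k} \<Longrightarrow> t (u @ v) = t (v @ u)"
begin

abbreviation \<tau> :: "indet ncpoly \<Rightarrow> complex" where
  "\<tau> \<equiv> lin_ext (leading t [])"

abbreviation \<tau>' :: "indet ncpoly \<Rightarrow> complex" where
  "\<tau>' \<equiv> lin_ext (correction t t' [])"

text \<open>The two-sided ideal generated by the matrix units, on which \<open>\<tau>\<close>
  vanishes.\<close>

definition e_ideal :: "indet ncpoly set" where
  "e_ideal = {p. \<forall>w\<in>Poly_Mapping.keys p. \<exists>x\<in>set (letters w). is_e x}"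

definition e_last :: "indet ncpoly set" where
  "e_last = {p. \<forall>w\<in>Poly_Mapping.keys p. letters w \<noteq> [] \<and> is_e (last (letters w))}"

definition e_first :: "indet ncpoly set" where
  "e_first = {p. \<forall>w\<in>Poly_Mapping.keys p. letters w \<noteq> [] \<and> is_e (hd (letters w))}"

definition e_words :: "indet ncpoly set" where
  "e_words = {p. \<forall>w\<in>Poly_Mapping.keys p. letters w \<noteq> [] \<and> (\<forall>x\<in>set (letters w). is_e x)}"

lemma tau_e_ideal:
  assumes "p \<in> e_ideal"
  shows "\<tau> p = 0"
proof -
  have "leading t [] (letters w) = 0" if w: "w \<in> Poly_Mapping.keys p" for w
  proof -
    obtain x where "x \<in> set (letters w)" "is_e x"
      using assms w unfolding e_ideal_def by blast
    then obtain u v a b where "letters w = u @ Ind_e a b # v" by (metis is_e_def split_list)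
    then show ?thesis by (simp add: leading_e)
  qed
  then have "\<tau> p = lin_ext (\<lambda>_. 0) p" by (intro lin_ext_cong)
  then show ?thesis by (simp add: lin_ext_def)
qed

lemma e_ideal_mult:
  assumes "p \<in> e_ideal \<or> q \<in> e_ideal"
  shows "p * q \<in> e_ideal"
  unfolding e_ideal_def
proof (intro CollectI ballI)
  fix w assume "w \<in> Poly_Mapping.keys (p * q)"
  then show "\<exists>x\<in>set (letters w). is_e x"
  proof (rule keys_multE)
    fix u v assume "u \<in> Poly_Mapping.keys p" "v \<in> Poly_Mapping.keys q" "letters w = letters u @ letters v"
    moreover from this assms have "(\<exists>x\<in>set (letters u). is_e x) \<or> (\<exists>x\<in>set (letters v). is_e x)"
      unfolding e_ideal_def by blast
    ultimately show ?thesis by (metis Un_iff set_append)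
  qed
qed

lemma e_words_ideal: "e_words \<subseteq> e_ideal"
  unfolding e_words_def e_ideal_def using last_in_set by blast

lemma e_last_mult:
  assumes "b \<in> e_words"
  shows "p * b \<in> e_last"
proof -
  have "letters w \<noteq> [] \<and> is_e (last (letters w))" if "w \<in> Poly_Mapping.keys (p * b)" for w
    using that
  proof (rule keys_multE)
    fix u v assume v: "v \<in> Poly_Mapping.keys b" and w: "letters w = letters u @ letters v"
    have "letters v \<noteq> []" "\<forall>x\<in>set (letters v). is_e x" using assms v by (auto simp: e_words_def)
    then show ?thesis unfolding w by simp
  qed
  then show ?thesis by (simp add: e_last_def)
qed

lemma e_first_mult:
  assumes "b \<in> e_words"
  shows "b * q \<in> e_first"
proof -
  have "letters w \<noteq> [] \<and> is_e (hd (letters w))" if "w \<in> Poly_Mapping.keys (b * q)" for w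
    using that
  proof (rule keys_multE)
    fix v u assume v: "v \<in> Poly_Mapping.keys b" and w: "letters w = letters v @ letters u"
    have "letters v \<noteq> []" "\<forall>x\<in>set (letters v). is_e x" using assms v by (auto simp: e_words_def)
    then show ?thesis unfolding w by simp
  qed
  then show ?thesis by (simp add: e_first_def)
qed

text \<open>On polynomials in the \<open>e_ij\<close> the functional \<open>\<tau>\<close> reads off
  the constant coefficient, since it is 0 at every other word and 1 at the empty one. A centred
  element therefore has no constant term and lies in the ideal.\<close>

lemma centred_e_words:
  assumes b: "b \<in> ncpolys (e_indets n)" and "\<tau> b = 0"
  shows "b \<in> e_words"
proof -
  have e: "is_e x" if "w \<in> Poly_Mapping.keys b" "x \<in> set (letters w)" for w x
    using ncpolysD[OF b that(1)] that(2) by (auto simp: e_indets_def is_e_def)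
  have "leading t [] (letters w) = of_bool (w = 0)" if "w \<in> Poly_Mapping.keys b" for w
  proof (cases "letters w")
    case Nil
    then have "w = 0" by (cases w) (simp add: zero_ncword_def)
    then show ?thesis by (simp add: zero_ncword_def t_Nil)
  next
    case (Cons x l)
    then have "is_e x" by (intro e[OF that]) simp
    then obtain a b where "x = Ind_e a b" by (auto simp: is_e_def)
    moreover have "w \<noteq> 0" using Cons by (auto simp: zero_ncword_def)
    ultimately show ?thesis using Cons by simp
  qed
  then have "\<tau> b = (\<Sum>w\<in>Poly_Mapping.keys b. if w = 0 then Poly_Mapping.lookup b 0 else 0)"
    unfolding lin_ext_def by (intro sum.cong) auto
  then have 0: "Poly_Mapping.lookup b 0 = 0"
    using assms(2) by (simp add: in_keys_iff split: if_splits)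
  have "letters w \<noteq> []" if "w \<in> Poly_Mapping.keys b" for w
  proof
    assume "letters w = []"
    then have "w = 0" by (cases w) (simp add: zero_ncword_def)
    with that 0 show False by (simp add: in_keys_iff)
  qed
  with e show ?thesis by (simp add: e_words_def)
qed

text \<open>The bilinear extension of \<open>correction_between\<close>. A centred \<open>x\<close>
  enclosed by matrix units thus annihilates \<open>\<tau>'\<close>.\<close>

lemma tau'_between:
  assumes p: "p \<in> e_last" and x: "x \<in> ncpolys (a_indets k)" and q: "q \<in> e_first"
  shows "\<tau>' (p * (x * q)) = \<tau> x * \<tau>' (p * q)"
proof -
  have c: "correction t t' [] (letters u @ letters y @ letters v) =
      leading t [] (letters y) * correction t t' [] (letters u @ letters v)"
    if u: "u \<in> Poly_Mapping.keys p" and y: "y \<in> Poly_Mapping.keys x" and v: "v \<in> Poly_Mapping.keys q" for u y v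
  proof -
    obtain y' where y': "letters y = map Ind_a y'" using ncpolysD[OF x y] by (rule set_a_indets)
    have "letters u \<noteq> []" "is_e (last (letters u))" using p u by (auto simp: e_last_def)
    then obtain u' a b where u': "letters u = u' @ [Ind_e a b]"
      by (metis append_butlast_last_id is_e_def)
    have "letters v \<noteq> []" "is_e (hd (letters v))" using q v by (auto simp: e_first_def)
    then obtain c d v' where v': "letters v = Ind_e c d # v'"
      by (metis list.collapse is_e_def)
    show ?thesis
      using correction_between[of t t' u' a b y' c d v', OF t_Nil] by (simp add: u' v' y' leading_a)
  qed
  have "\<tau>' (p * (x * q)) = lin_ext (\<lambda>u. lin_ext (\<lambda>y. lin_ext (\<lambda>v. correction t t' [] (u @ y @ v)) q) x) p"
    by (simp only: lin_ext_mult)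
  also have "\<dots> = lin_ext (\<lambda>u. lin_ext (\<lambda>y. lin_ext (\<lambda>v. leading t [] y * correction t t' [] (u @ v)) q) x) p"
    by (intro lin_ext_cong c)
  also have "\<dots> = \<tau> x * \<tau>' (p * q)"
    by (simp only: lin_ext_mult_left lin_ext_mult_right lin_ext_mult)
  finally show ?thesis .
qed

text \<open>The extension of \<open>correction_around\<close> to polynomials; the outer factors meet
  in the order \<open>y * x\<close> because the trace is cyclic.\<close>

lemma tau'_around:
  assumes x: "x \<in> ncpolys (a_indets k)" and b: "b \<in> e_words" and y: "y \<in> ncpolys (a_indets k)"
  shows "\<tau>' (x * (b * y)) = \<tau> (y * x) * \<tau>' b"
proof -
  have c: "correction t t' [] (letters u @ letters w @ letters v) =
      leading t [] (letters v @ letters u) * correction t t' [] (letters w)"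
    if u: "u \<in> Poly_Mapping.keys x" and w: "w \<in> Poly_Mapping.keys b" and v: "v \<in> Poly_Mapping.keys y" for u w v
  proof -
    obtain u' where u': "letters u = map Ind_a u'" using ncpolysD[OF x u] by (rule set_a_indets)
    obtain v' where v': "letters v = map Ind_a v'" using ncpolysD[OF y v] by (rule set_a_indets)
    have "letters w \<noteq> []" "\<And>x. x \<in> set (letters w) \<Longrightarrow> is_e x" using b w by (auto simp: e_words_def)
    from correction_around[of t "letters w" t' u' v', OF t_Nil this]
    have "correction t t' [] (map Ind_a u' @ letters w @ map Ind_a v') = t (v' @ u') * correction t t' [] (letters w)" .
    moreover have "leading t [] (map Ind_a v' @ map Ind_a u') = t (v' @ u')"
      using leading_a[of t "[]" "v' @ u'"] by simp
    ultimately show ?thesis unfolding u' v' by simp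
  qed
  have "\<tau>' (x * (b * y)) = lin_ext (\<lambda>u. lin_ext (\<lambda>w. lin_ext (\<lambda>v. correction t t' [] (u @ w @ v)) y) b) x"
    by (simp only: lin_ext_mult)
  also have "\<dots> = lin_ext (\<lambda>u. lin_ext (\<lambda>w. lin_ext (\<lambda>v. leading t [] (v @ u) * correction t t' [] w) y) b) x"
    by (intro lin_ext_cong c)
  also have "\<dots> = lin_ext (\<lambda>u. lin_ext (\<lambda>v. leading t [] (v @ u)) y) x * \<tau>' b"
    by (simp only: lin_ext_mult_left lin_ext_mult_right)
  also have "lin_ext (\<lambda>u. lin_ext (\<lambda>v. leading t [] (v @ u)) y) x = \<tau> (y * x)"
    unfolding lin_ext_mult by (simp add: lin_ext_def sum_distrib_left mult_ac) (rule sum.swap)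
  finally show ?thesis .
qed

lemma tau_commute:
  assumes x: "x \<in> ncpolys (a_indets k)" and y: "y \<in> ncpolys (a_indets k)"
  shows "\<tau> (x * y) = \<tau> (y * x)"
proof -
  have c: "leading t [] (letters u @ letters v) = leading t [] (letters v @ letters u)"
    if u: "u \<in> Poly_Mapping.keys x" and v: "v \<in> Poly_Mapping.keys y" for u v
  proof -
    obtain u' where u': "letters u = map Ind_a u'" "set u' \<subseteq> {..<k}" using ncpolysD[OF x u] by (rule set_a_indets)
    obtain v' where v': "letters v = map Ind_a v'" "set v' \<subseteq> {..<k}" using ncpolysD[OF y v] by (rule set_a_indets)
    show ?thesis
      using t_cyclic[OF u'(2) v'(2)] leading_a[of t "[]" "v' @ u'"] leading_a[of t "[]" "u' @ v'"]
      by (simp add: u' v')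
  qed
  have "\<tau> (x * y) = lin_ext (\<lambda>u. lin_ext (\<lambda>v. leading t [] (v @ u)) y) x"
    unfolding lin_ext_mult by (intro lin_ext_cong c)
  also have "\<dots> = \<tau> (y * x)"
    unfolding lin_ext_mult by (simp add: lin_ext_def sum_distrib_left mult_ac) (rule sum.swap)
  finally show ?thesis .
qed

text \<open>A product of two factors reduces to \<open>tau'_around\<close> with 1 as the second
  outer factor. For the pattern a, e, a the right-hand side retains only its middle term, as
  omitting an outer factor leaves the e-factor and \<open>\<tau>\<close> vanishes. Where e, a, e
  occurs as neighbours, the enclosed centred factor makes \<open>\<tau>'\<close> vanish.\<close>

theorem inf_free_limit: "inf_free_subalgebras \<tau> \<tau>' (ncpolys (a_indets k)) (ncpolys (e_indets n))"
  unfolding inf_free_subalgebras_def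
proof (intro allI impI)
  fix xs :: "indet ncpoly list" and ind :: "nat \<Rightarrow> nat"
  assume H: "xs \<noteq> [] \<and>
        (\<forall>m<length xs. ind m \<in> {1, 2} \<and> xs ! m \<in> (if ind m = 1 then ncpolys (a_indets k) else ncpolys (e_indets n))) \<and>
        (\<forall>m. Suc m < length xs \<longrightarrow> ind m \<noteq> ind (Suc m)) \<and> (\<forall>m<length xs. \<tau> (xs ! m) = 0)"
  let ?R = "\<Sum>j<length xs. \<tau>' (xs ! j) * \<tau> (prod_list (take j xs @ drop (Suc j) xs))"
  have ind: "ind m = 1 \<or> ind m = 2" if "m < length xs" for m using H that by auto
  have alt: "ind m \<noteq> ind (Suc m)" if "Suc m < length xs" for m using H that by blast
  have ctr: "\<tau> (xs ! m) = 0" if "m < length xs" for m using H that by blast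
  have xa: "xs ! m \<in> ncpolys (a_indets k)" if "m < length xs" "ind m = 1" for m
    using H that by (metis (full_types))
  have xe: "xs ! m \<in> e_words" if "m < length xs" "ind m = 2" for m
  proof (rule centred_e_words[OF _ ctr[OF that(1)]])
    have "xs ! m \<in> (if ind m = 1 then ncpolys (a_indets k) else ncpolys (e_indets n))" using H that(1) by blast
    then show "xs ! m \<in> ncpolys (e_indets n)" using that(2) by simp
  qed
  have prod0: "\<tau> (prod_list ys) = 0" if "y \<in> set ys" "y \<in> e_words" for y ys
    using that e_words_ideal by (intro tau_e_ideal prod_list_absorb[of e_ideal y] e_ideal_mult) blast+
  have step: "ind (Suc m) = (if ind m = 1 then 2 else 1)" if "Suc m < length xs" for m
    using ind[of m] ind[of "Suc m"] alt[OF that] that by auto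
  \<comment> \<open>An alternating product without three neighbours e, a, e has at most two factors
    or is of the form a, e, a. From length 4 on, such neighbours begin at position 0 or 1.\<close>
  consider x where "xs = [x]"
    | x y where "xs = [x, y]"
    | x y z where "xs = [x, y, z]" "ind 0 = 1"
    | m where "m + 2 < length xs" "ind m = 2"
  proof -
    have l: "length xs \<ge> 1" using H by (cases xs) auto
    have i0: "ind 0 = 1 \<or> ind 0 = 2" by (rule ind) (use l in linarith)
    consider "length xs = 1" | "length xs = 2" | "length xs \<ge> 3" using l by linarith
    then show ?thesis
    proof cases
      case 1
      then show ?thesis using that(1) by (auto simp: length_Suc_conv)
    next
      case 2
      then show ?thesis using that(2) by (auto simp: numeral_2_eq_2 length_Suc_conv)
    next
      case 3
      consider "ind 0 = 2" | "length xs = 3" "ind 0 = 1" | "length xs \<ge> 4" "ind 0 = 1"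
        using i0 3 by linarith
      then show ?thesis
      proof cases
        case 1
        then show ?thesis using that(4)[of 0] 3 by simp
      next
        case 2
        then show ?thesis using that(3) by (auto simp: numeral_3_eq_3 length_Suc_conv)
      next
        case 3
        then show ?thesis using that(4)[of 1] step[of 0] by simp
      qed
    qed
  qed
  then show "\<tau> (prod_list xs) = 0 \<and> \<tau>' (prod_list xs) = ?R"
  proof cases
    case (1 x)
    then show ?thesis using ctr[of 0] by (simp add: lin_ext_one t_Nil)
  next
    case (2 x y)
    have z: "\<tau> x = 0" "\<tau> y = 0" using ctr[of 0] ctr[of 1] by (simp_all add: 2)
    have R: "?R = 0" by (simp add: 2 z numeral_2_eq_2)
    have one: "1 \<in> ncpolys (a_indets k)"
      using unital_subalgebra_ncpolys by (auto simp: unital_subalgebra_def)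
    consider "ind 0 = 1" "ind 1 = 2" | "ind 0 = 2" "ind 1 = 1"
      using ind[of 0] step[of 0] by (auto simp: 2)
    then show ?thesis
    proof cases
      case a: 1
      have x: "x \<in> ncpolys (a_indets k)" using xa[of 0] a by (simp add: 2)
      have y: "y \<in> e_words" using xe[of 1] a by (simp add: 2)
      have "\<tau>' (x * y) = 0" using tau'_around[OF x y one] z by simp
      moreover have "\<tau> (prod_list xs) = 0" by (rule prod0[OF _ y]) (simp add: 2)
      ultimately show ?thesis using R by (simp add: 2)
    next
      case a: 2
      have y: "y \<in> ncpolys (a_indets k)" using xa[of 1] a by (simp add: 2)
      have x: "x \<in> e_words" using xe[of 0] a by (simp add: 2)
      have "\<tau>' (x * y) = 0" using tau'_around[OF one x y] z by simp
      moreover have "\<tau> (prod_list xs) = 0" by (rule prod0[OF _ x]) (simp add: 2)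
      ultimately show ?thesis using R by (simp add: 2)
    qed
  next
    case (3 x y z)
    have i: "ind 1 = 2" "ind 2 = 1" using step[of 0] step[of 1] by (simp_all add: 3 numeral_2_eq_2)
    have x: "x \<in> ncpolys (a_indets k)" using xa[of 0] by (simp add: 3)
    have y: "y \<in> e_words" using xe[of 1] i by (simp add: 3)
    have z: "z \<in> ncpolys (a_indets k)" using xa[of 2] i by (simp add: 3)
    have "\<tau> (prod_list [x, y]) = 0" "\<tau> (prod_list [y, z]) = 0" "\<tau> (prod_list [x, y, z]) = 0"
      by (rule prod0[OF _ y], simp)+
    then have e: "\<tau> (x * y) = 0" "\<tau> (y * z) = 0" "\<tau> (x * (y * z)) = 0" by simp_all
    have "?R = \<tau>' y * \<tau> (x * z)"
      by (simp add: 3 numeral_3_eq_3 e)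
    moreover have "\<tau>' (x * (y * z)) = \<tau> (x * z) * \<tau>' y"
      using tau'_around[OF x y z] tau_commute[OF x z] by simp
    ultimately show ?thesis using e by (simp add: 3 mult.commute)
  next
    case (4 m)
    have len: "m < length xs" "Suc m < length xs" "Suc (Suc m) < length xs" using 4 by simp_all
    have i: "ind (Suc m) = 1" "ind (Suc (Suc m)) = 2" using step[OF len(2)] step[OF len(3)] 4(2) by simp_all
    have b: "xs ! m \<in> e_words" "xs ! Suc (Suc m) \<in> e_words"
      using xe[OF len(1) 4(2)] xe[OF len(3) i(2)] .
    have x: "xs ! Suc m \<in> ncpolys (a_indets k)" by (rule xa[OF len(2) i(1)])
    have "\<tau> (prod_list xs) = 0" by (rule prod0[OF _ b(1)]) (use len in simp)
    moreover have "\<tau>' (prod_list xs) = 0"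
    proof -
      have d: "xs = take m xs @ xs ! m # xs ! Suc m # xs ! Suc (Suc m) # drop (Suc (Suc (Suc m))) xs"
        using len by (metis Cons_nth_drop_Suc append_take_drop_id)
      have "prod_list xs = (prod_list (take m xs) * xs ! m) *
          (xs ! Suc m * (xs ! Suc (Suc m) * prod_list (drop (Suc (Suc (Suc m))) xs)))"
        by (subst d) (simp add: mult.assoc)
      then show ?thesis
        using tau'_between[OF e_last_mult[OF b(1)] x e_first_mult[OF b(2)]] ctr[OF len(2)] by simp
    qed
    \<comment> \<open>There are two e-factors, at \<open>m\<close> and \<open>m + 2\<close>.
      Omitting one factor of the product leaves at least one of them, so the remaining product lies
      in the ideal.\<close>
    moreover have "?R = 0"
    proof (rule sum.neutral, rule ballI)
      fix j assume "j \<in> {..<length xs}"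
      then have j: "j < length xs" by simp
      have rem: "y \<in> set (take j xs @ drop (Suc j) xs)" if "i < length xs" "i \<noteq> j" "y = xs ! i" for i y
      proof (cases "i < j")
        case True
        then have "y \<in> set (take j xs)" using that j by (auto simp: in_set_conv_nth)
        then show ?thesis by simp
      next
        case False
        then have "drop (Suc j) xs ! (i - Suc j) = y" "i - Suc j < length (drop (Suc j) xs)"
          using that by auto
        then have "y \<in> set (drop (Suc j) xs)" by (metis nth_mem)
        then show ?thesis by simp
      qed
      have "\<tau> (prod_list (take j xs @ drop (Suc j) xs)) = 0"
      proof (cases "m = j")
        case True
        show ?thesis by (rule prod0[OF rem[OF len(3) _ refl] b(2)]) (use True in simp)
      next
        case False
        show ?thesis by (rule prod0[OF rem[OF len(1) False refl] b(1)])
      qed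
      then show "\<tau>' (xs ! j) * \<tau> (prod_list (take j xs @ drop (Suc j) xs)) = 0" by simp
    qed
    ultimately show ?thesis by simp
  qed
qed

end

section \<open>Freeness for the two ensembles\<close>

lemma indet_star_involutive: "indet_star (indet_star x) = x"
  by (cases x) simp_all

lemma indet_star_indets: "indet_star ` (a_indets k \<union> e_indets n) \<subseteq> a_indets k \<union> e_indets n"
  by (force simp: a_indets_def e_indets_def)

context moment_model
begin

text \<open>Convergence is asked for polynomials in the \<open>a_r\<close> alone; on words with
  matrix units the correction converges by the limits of products of entries.\<close>

theorem infinitesimal_freeness:
  assumes "\<And>q. q \<in> ncpolys (a_indets k) \<Longrightarrow>
      convergent (\<lambda>N. expected_trace M A N q - of_nat N * lin_ext (leading t []) q)"
  shows "\<exists>\<tau>'. (\<forall>p\<in>ncpolys (a_indets k \<union> e_indets N0).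
        (\<lambda>N. expected_trace M A N p - of_nat N * lin_ext (leading t []) p) \<longlonglongrightarrow> \<tau>' p) \<and>
      infinitesimal_ncps nc_scale (ncpolys (a_indets k \<union> e_indets N0)) (nc_star indet_star) (lin_ext (leading t [])) \<tau>' \<and>
      infinitesimally_free nc_scale (lin_ext (leading t [])) \<tau>' (nc_var ` a_indets k) (nc_var ` e_indets N0)"
proof -
  have "\<exists>c. set x \<subseteq> {..<k} \<longrightarrow> (\<lambda>N. word_trace N (map Ind_a x) - of_nat N * t x) \<longlonglongrightarrow> c" for x
  proof (cases "set x \<subseteq> {..<k}")
    case True
    \<comment> \<open>Evaluating the assumption at a single monomial supplies the value of
      \<open>t'\<close> at the word \<open>x\<close>.\<close>
    define q :: "indet ncpoly" where "q = Poly_Mapping.single (NCWord (map Ind_a x)) 1"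
    have q: "q \<in> ncpolys (a_indets k)"
      by (rule ncpolysI) (use True in \<open>auto simp: q_def a_indets_def\<close>)
    then have q': "q \<in> ncpolys (a_indets k \<union> e_indets N0)"
      using ncpolys_mono[of "a_indets k" "a_indets k \<union> e_indets N0"] by blast
    obtain c where c: "(\<lambda>N. expected_trace M A N q - of_nat N * lin_ext (leading t []) q) \<longlonglongrightarrow> c"
      using assms[OF q] by (auto simp: convergent_def)
    have "(\<lambda>N. word_trace N (map Ind_a x) - of_nat N * t x) \<longlonglongrightarrow> c"
      by (rule Lim_transform_eventually[OF c])
        (use eventually_ge_at_top[of N0] in eventually_elim, simp add: expected_trace_eq[OF _ q'], simp add: q_def leading_a)
    then show ?thesis by blast
  qed simp
  then obtain t' where t': "\<And>x. set x \<subseteq> {..<k} \<Longrightarrow> (\<lambda>N. word_trace N (map Ind_a x) - of_nat N * t x) \<longlonglongrightarrow> t' x"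
    by metis
  have t'_Nil: "t' [] = 0" by (rule correction_Nil[OF t']) simp
  interpret limit_functionals t t' k N0
    by unfold_locales (rule t_Nil, rule t'_Nil, rule t_cyclic)
  show ?thesis
  proof (intro exI[of _ \<tau>'] conjI ballI)
    show "(\<lambda>N. expected_trace M A N p - of_nat N * \<tau> p) \<longlonglongrightarrow> \<tau>' p"
      if "p \<in> ncpolys (a_indets k \<union> e_indets N0)" for p
      by (rule expected_trace_correction[OF that t'])
    show "infinitesimal_ncps nc_scale (ncpolys (a_indets k \<union> e_indets N0)) (nc_star indet_star) \<tau> \<tau>'"
      by (rule infinitesimal_ncps_lin_ext[OF indet_star_involutive indet_star_indets])
        (simp_all add: t_Nil t'_Nil)
    show "infinitesimally_free nc_scale \<tau> \<tau>' (nc_var ` a_indets k) (nc_var ` e_indets N0)"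
      unfolding infinitesimally_free_def
      by (rule inf_free_subalgebras_mono[OF inf_free_limit hull_nc_var_subset hull_nc_var_subset])
  qed
qed

end

text \<open>The limits that the ensemble postulates are used on monomials to define
  \<open>t\<close>; concentration of the entries then provides the remaining properties of the
  model.\<close>

theorem moment_model_ensemble_U:
  assumes U: "ensemble_U k N0 M A" and N0: "N0 \<ge> 1"
  shows "\<exists>t. moment_model M A k N0 t"
proof -
  obtain U \<Lambda> where UL: "\<And>N. N \<ge> N0 \<Longrightarrow> haar_unitary (M N) N (U N) \<and>
        (\<forall>j<k. \<Lambda> N j \<in> self_adjoint_mats N \<and>
           (\<forall>\<omega>\<in>space (M N). A N j \<omega> = U N \<omega> * \<Lambda> N j * mat_adjoint (U N \<omega>)))"
    using U unfolding ensemble_U_def by metis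
  obtain C where C: "\<And>N j \<omega>. N \<ge> N0 \<Longrightarrow> j < k \<Longrightarrow> \<omega> \<in> space (M N) \<Longrightarrow> mat_op_norm (A N j \<omega>) \<le> C"
    using U unfolding ensemble_U_def by metis
  have conv: "convergent (\<lambda>N. expected_trace M A N q / of_nat N)" if "q \<in> ncpolys (a_indets k)" for q
    using U that unfolding ensemble_U_def by blast
  have prob: "prob_space (M N)" if "N \<ge> N0" for N
    using U that unfolding ensemble_U_def by blast
  interpret unitary_models M A U \<Lambda> k N0 C
    by (rule unitary_models.intro) (use prob UL C in \<open>auto simp: self_adjoint_mats_def\<close>)
  let ?q = "\<lambda>w. Poly_Mapping.single (NCWord (map Ind_a w)) 1 :: indet ncpoly"
  define t where "t = (\<lambda>w. lim (\<lambda>N. expected_trace M A N (?q w) / of_nat N))"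
  have tr: "expected_trace M A N (?q w) = (\<Sum>i<N. \<integral>\<omega>. items_prod (mat_entries (A N)) N [(w, i, i)] \<omega> \<partial>M N)"
    if N: "N \<ge> N0" and w: "set w \<subseteq> {..<k}" for N w
  proof -
    interpret prob_space "M N" by (rule prob[OF N])
    have N1: "N > 0" using N N0 by simp
    have int: "integrable (M N) (items_prod (mat_entries (A N)) N [(w, i, i)])" if i: "i < N" for i
    proof -
      note h = haar_conjugate[OF N N1 w]
      have "integrable (M N) (haar_conjugate.Y (U N) (B N w) i i)"
        by (rule integrable_const_bound[OF _ haar_conjugate.Y_measurable[OF h i i]])
          (auto intro: haar_conjugate.Y_bound'[OF h _ i i])
      then show ?thesis
        by (rule Bochner_Integration.integrable_cong[THEN iffD1, OF refl, rotated])
          (simp add: haar_conjugate.Y_def[OF h] items_prod_def E_conjugate[OF N w _ i i, unfolded E_def])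
    qed
    have "expected_trace M A N (?q w) = (\<integral>\<omega>. (\<Sum>i<N. items_prod (mat_entries (A N)) N [(w, i, i)] \<omega>) \<partial>M N)"
      unfolding expected_trace_def
    proof (rule Bochner_Integration.integral_cong[OF refl])
      fix \<omega> assume \<omega>: "\<omega> \<in> space (M N)"
      have "mat_tr (nc_eval N (assign N (\<lambda>j. A N j \<omega>)) (?q w)) =
        lin_ext (\<lambda>w. \<Sum>i<N. word_entry (\<lambda>x i j. assign N (\<lambda>j. A N j \<omega>) x $$ (i, j)) N w i i) (?q w)"
        by (rule mat_tr_nc_eval) (use A_carrier[OF N _ \<omega>] w in \<open>auto split: if_splits\<close>)
      then show "mat_tr (nc_eval N (assign N (\<lambda>j. A N j \<omega>)) (?q w)) =
          (\<Sum>i<N. items_prod (mat_entries (A N)) N [(w, i, i)] \<omega>)"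
        by (simp add: word_entry_map items_prod_def)
    qed
    then show ?thesis
      by (simp add: Bochner_Integration.integral_sum int)
  qed
  have "unitary_limit M A U \<Lambda> k N0 C t"
  proof (intro unitary_limit.intro unitary_limit_axioms.intro)
    show "unitary_models M A U \<Lambda> k N0 C" by (rule unitary_models_axioms)
    show "N0 \<ge> 1" by (rule N0)
    fix w :: "nat list" assume w: "set w \<subseteq> {..<k}"
    have "?q w \<in> ncpolys (a_indets k)"
      by (rule ncpolysI) (use w in \<open>auto simp: a_indets_def\<close>)
    then have "(\<lambda>N. expected_trace M A N (?q w) / of_nat N) \<longlonglongrightarrow> t w"
      unfolding t_def using conv convergent_LIMSEQ_iff by blast
    then show "(\<lambda>N. (\<Sum>i<N. \<integral>\<omega>. items_prod (mat_entries (A N)) N [(w, i, i)] \<omega> \<partial>M N) / of_nat N) \<longlonglongrightarrow> t w"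
      by (rule Lim_transform_eventually)
        (use eventually_ge_at_top[of N0] in eventually_elim, simp only: tr[OF _ w])
  qed
  then show ?thesis by (intro exI) (rule unitary_limit.moment_model)
qed

theorem theorem3p1:
  fixes k N0 :: nat
    and M :: "nat \<Rightarrow> 'w measure"
    and A :: "nat \<Rightarrow> nat \<Rightarrow> 'w \<Rightarrow> complex mat"
  assumes "k \<ge> 1" and "N0 \<ge> 1"
    and "ensemble_U k N0 M A \<or> ensemble_G k N0 M A"
  shows "\<exists>\<tau>.
    (\<forall>p\<in>ncpolys (a_indets k \<union> e_indets N0).
       (\<lambda>N. expected_trace M A N p / of_nat N) \<longlonglongrightarrow> \<tau> p) \<and>
    ((ensemble_U k N0 M A \<longrightarrow>
        (\<forall>q\<in>ncpolys (a_indets k). convergent (\<lambda>N. expected_trace M A N q - of_nat N * \<tau> q)))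
     \<longrightarrow>
     (\<exists>\<tau>'.
        (\<forall>p\<in>ncpolys (a_indets k \<union> e_indets N0).
           (\<lambda>N. expected_trace M A N p - of_nat N * \<tau> p) \<longlonglongrightarrow> \<tau>' p) \<and>
        infinitesimal_ncps nc_scale (ncpolys (a_indets k \<union> e_indets N0)) (nc_star indet_star) \<tau> \<tau>' \<and>
        infinitesimally_free nc_scale \<tau> \<tau>' (nc_var ` a_indets k) (nc_var ` e_indets N0)))"
proof -
  \<comment> \<open>The case distinction is on \<open>ensemble_U\<close> itself. If it holds, the
    guarded premise yields convergence of the correction; otherwise the ensemble is Gaussian and the
    convergence is proved here.\<close>
  have "\<exists>t. moment_model M A k N0 t \<and> (\<not> ensemble_U k N0 M A \<longrightarrow>
      (\<forall>q\<in>ncpolys (a_indets k). convergent (\<lambda>N. expected_trace M A N q - of_nat N * lin_ext (leading t []) q)))"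
  proof (cases "ensemble_U k N0 M A")
    case True
    then show ?thesis using moment_model_ensemble_U[OF True assms(2)] by blast
  next
    case False
    then have "ensemble_G k N0 M A" using assms(3) by blast
    then obtain re where re: "gaussian_ensemble (if re then real_gaussian else complex_gaussian) k N0 M A"
      unfolding ensemble_G_def by (metis (full_types))
    interpret moment_model M A k N0 free_moment by (rule moment_model_gaussian(1)[OF re assms(2)])
    have "convergent (\<lambda>N. expected_trace M A N q - of_nat N * lin_ext (leading free_moment []) q)"
      if q: "q \<in> ncpolys (a_indets k)" for q
    proof -
      have q': "q \<in> ncpolys (a_indets k \<union> e_indets N0)"
        using q ncpolys_mono[of "a_indets k" "a_indets k \<union> e_indets N0"] by blast
      have "convergent (\<lambda>N. word_trace N (map Ind_a x) - of_nat N * free_moment x)" if x: "set x \<subseteq> {..<k}" for x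
      proof -
        obtain c where c: "(\<lambda>N. (\<Sum>i<N. \<integral>\<omega>. items_prod (mat_entries (A N)) N [(x, i, i)] \<omega> \<partial>M N) - of_nat N * free_moment x) \<longlonglongrightarrow> c"
          using moment_model_gaussian(2)[OF re assms(2) x] by (auto simp: convergent_def)
        have "(\<lambda>N. word_trace N (map Ind_a x) - of_nat N * free_moment x) \<longlonglongrightarrow> c"
          by (rule Lim_transform_eventually[OF c])
            (use eventually_ge_at_top[of N0] in eventually_elim, simp only: word_trace_pure[OF _ x])
        then show ?thesis by (rule convergentI)
      qed
      then have "\<And>x. set x \<subseteq> {..<k} \<Longrightarrow> (\<lambda>N. word_trace N (map Ind_a x) - of_nat N * free_moment x) \<longlonglongrightarrow>
          lim (\<lambda>N. word_trace N (map Ind_a x) - of_nat N * free_moment x)"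
        by (simp add: convergent_LIMSEQ_iff)
      from expected_trace_correction[OF q' this] show ?thesis by (rule convergentI)
    qed
    then show ?thesis using moment_model_axioms by blast
  qed
  then obtain t where t: "moment_model M A k N0 t"
    and c: "\<not> ensemble_U k N0 M A \<Longrightarrow>
      \<forall>q\<in>ncpolys (a_indets k). convergent (\<lambda>N. expected_trace M A N q - of_nat N * lin_ext (leading t []) q)"
    by blast
  interpret moment_model M A k N0 t by (rule t)
  show ?thesis
  proof (rule exI[of _ "lin_ext (leading t [])"], intro conjI ballI impI)
    show "(\<lambda>N. expected_trace M A N p / of_nat N) \<longlonglongrightarrow> lin_ext (leading t []) p"
      if "p \<in> ncpolys (a_indets k \<union> e_indets N0)" for p
      by (rule expected_trace_leading[OF that])
    assume U: "ensemble_U k N0 M A \<longrightarrow>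
        (\<forall>q\<in>ncpolys (a_indets k). convergent (\<lambda>N. expected_trace M A N q - of_nat N * lin_ext (leading t []) q))"
    show "\<exists>\<tau>'. (\<forall>p\<in>ncpolys (a_indets k \<union> e_indets N0).
           (\<lambda>N. expected_trace M A N p - of_nat N * lin_ext (leading t []) p) \<longlonglongrightarrow> \<tau>' p) \<and>
        infinitesimal_ncps nc_scale (ncpolys (a_indets k \<union> e_indets N0)) (nc_star indet_star) (lin_ext (leading t [])) \<tau>' \<and>
        infinitesimally_free nc_scale (lin_ext (leading t [])) \<tau>' (nc_var ` a_indets k) (nc_var ` e_indets N0)"
      by (rule infinitesimal_freeness) (use U c in blast)
  qed
qed

end
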